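(* Let $0<\alpha<1$, $\gamma\ge0$ with $0<\alpha+\gamma\le1$, and consider one of the three Pearson diffusions (Ornstein-Uhlenbeck, Cox-Ingersoll-Ross, Jacobi) with state space $S$, generator $\mathcal{G}$, stationary density $\boldsymbol{m}$, eigenvalues $\lambda_n$ and orthonormal polynomials $Q_n$. Let $h\in L_2(\boldsymbol{m}(x)dx)$ be such that the series $\sum_n a_nQ_n$, where $a_n=\int_S h(x)Q_n(x)\boldsymbol{m}(x)\,dx$, converges to $h$ uniformly on finite intervals contained in $S$. Then the fractional Cauchy problem $$\mathcal{D}^{(\alpha,\gamma)}_t g(t,y)=\mathcal{G}g(t,y),\qquad g(0,y)=h(y)$$ has a strong solution given by $$g_{\alpha,\gamma}(t,y)=\sum_{n=0}^{\infty}\operatorname{E}_{\alpha,1+\gamma/\alpha,\gamma/\alpha}\left(-\lambda_nt^{\alpha+\gamma}\right)Q_n(y)\,a_n .$$ The series converges absolutely for each fixed $t>0$, $y\in S$, and the equation of the Cauchy problem holds pointwise.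
   Context: For $0<\alpha<1$, $\gamma\ge0$: $\mathcal{D}^{(\alpha,\gamma)}_t f(t)=\frac{t^{-\gamma}}{\Gamma(1-\alpha)}\int_0^t\frac{f'(s)}{(t-s)^{\alpha}}\,ds$. Pearson diffusions: drift $\mu(x)$, diffusion coefficient $D(x)$, generator $\mathcal{G}g=\mu g'+Dg''$ (acting in the space variable). (OU) $S=\mathbb{R}$, $D(x)=\theta\sigma^2$, $\mu(x)=-\theta(x-\mu_0)$, $\theta,\sigma^2>0$, $\mu_0\in\mathbb{R}$; $\boldsymbol{m}(x)=\frac{1}{\sqrt{2\pi\sigma^2}}e^{-(x-\mu_0)^2/(2\sigma^2)}$; $\lambda_n=\theta n$ (Hermite polynomials). (CIR) $S=(0,\infty)$, $D(x)=\theta x/a$, $\mu(x)=-\theta(x-b/a)$, $\theta,a,b>0$; $\boldsymbol{m}(x)=\frac{a^b}{\Gamma(b)}x^{b-1}e^{-ax}$; $\lambda_n=\theta n$ (Laguerre polynomials $L_n^{b-1}(ax)$). (Jacobi) $S=(-1,1)$, $D(x)=1-x^2$, $\mu(x)=-(a+b+2)x+b-a$, $a,b>-1$; $\boldsymbol{m}(x)=\frac{(1-x)^a(1+x)^b}{B(a+1,b+1)2^{a+b+1}}$; $\lambda_n=n(n+a+b+1)$ (Jacobi polynomials $P_n^{(a,b)}$). In each case $Q_n$ is the corresponding degree-$n$ polynomial, $\mathcal{G}Q_n=-\lambda_nQ_n$, normalized so that $\int_S Q_nQ_k\boldsymbol{m}\,dx=\delta_{nk}$. Kilbas-Saigo function: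 for $a,m>0$, $l>-1/a$, $\operatorname{E}_{a,m,l}(z)=\sum_{n=0}^\infty c_n z^n$ with $c_0=1$ and $c_n=\prod_{k=0}^{n-1}\frac{\Gamma[1+a(km+l)]}{\Gamma[1+a(km+l+1)]}$. "Strong solution" means that the equation holds pointwise for $t>0$, $y\in S$, and the initial condition holds. *)

theory Defs
  imports "HOL-Analysis.Analysis" "HOL-Computational_Algebra.Polynomial"
begin

datatype pearson =
    OU real real real    \<comment> \<open>\<open>\<theta>\<close>, \<open>\<sigma>\<close>, \<open>\<mu>0\<close>\<close>
  | CIR real real real   \<comment> \<open>\<open>\<theta>\<close>, \<open>a\<close>, \<open>b\<close>\<close>
  | Jacobi real real     \<comment> \<open>\<open>a\<close>, \<open>b\<close>\<close>

fun admissible :: "pearson \<Rightarrow> bool" where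
  "admissible (OU \<theta> \<sigma> \<mu>0) \<longleftrightarrow> \<theta> > 0 \<and> \<sigma>\<^sup>2 > 0"
| "admissible (CIR \<theta> a b) \<longleftrightarrow> \<theta> > 0 \<and> a > 0 \<and> b > 0"
| "admissible (Jacobi a b) \<longleftrightarrow> a > -1 \<and> b > -1"

fun state_space :: "pearson \<Rightarrow> real set" where
  "state_space (OU \<theta> \<sigma> \<mu>0) = UNIV"
| "state_space (CIR \<theta> a b) = {0<..}"
| "state_space (Jacobi a b) = {-1<..<1}"

fun drift :: "pearson \<Rightarrow> real \<Rightarrow> real" where
  "drift (OU \<theta> \<sigma> \<mu>0) x = - \<theta> * (x - \<mu>0)"
| "drift (CIR \<theta> a b) x = - \<theta> * (x - b / a)"
| "drift (Jacobi a b) x = - (a + b + 2) * x + b - a"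

fun diffusion :: "pearson \<Rightarrow> real \<Rightarrow> real" where
  "diffusion (OU \<theta> \<sigma> \<mu>0) x = \<theta> * \<sigma>\<^sup>2"
| "diffusion (CIR \<theta> a b) x = \<theta> * x / a"
| "diffusion (Jacobi a b) x = 1 - x\<^sup>2"

text \<open>Only the values on the state space matter.\<close>
fun stat_density :: "pearson \<Rightarrow> real \<Rightarrow> real" where
  "stat_density (OU \<theta> \<sigma> \<mu>0) x = 1 / sqrt (2 * pi * \<sigma>\<^sup>2) * exp (- (x - \<mu>0)\<^sup>2 / (2 * \<sigma>\<^sup>2))"
| "stat_density (CIR \<theta> a b) x = a powr b / Gamma b * x powr (b - 1) * exp (- a * x)"
| "stat_density (Jacobi a b) x =
     (1 - x) powr a * (1 + x) powr b / (Beta (a + 1) (b + 1) * 2 powr (a + b + 1))"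

fun eigenvalue :: "pearson \<Rightarrow> nat \<Rightarrow> real" where
  "eigenvalue (OU \<theta> \<sigma> \<mu>0) n = \<theta> * real n"
| "eigenvalue (CIR \<theta> a b) n = \<theta> * real n"
| "eigenvalue (Jacobi a b) n = real n * (real n + a + b + 1)"

definition generator :: "pearson \<Rightarrow> (real \<Rightarrow> real) \<Rightarrow> real \<Rightarrow> real" where
  "generator P g y = drift P y * deriv g y + diffusion P y * deriv (deriv g) y"

text \<open>Hermite polynomials orthogonal with respect to exp (- x^2 / 2).
  The recursion is the Rodrigues formula He_n = (-1)^n exp (x^2/2) (d/dx)^n exp (- x^2/2),
  unfolded one step at a time.\<close>
fun hermite_poly :: "nat \<Rightarrow> real poly" where
  "hermite_poly 0 = 1"
| "hermite_poly (Suc n) = [:0, 1:] * hermite_poly n - pderiv (hermite_poly n)"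

text \<open>L_n^(\<kappa>)(x) = sum_i (-1)^i binom(n + \<kappa>, n - i) x^i / i!\<close>
definition laguerre_poly :: "real \<Rightarrow> nat \<Rightarrow> real poly" where
  "laguerre_poly \<kappa> n =
     (\<Sum>i\<le>n. monom ((-1) ^ i * ((real n + \<kappa>) gchoose (n - i)) / fact i) i)"

text \<open>P_n^(a,b)(x) = sum_s binom(n + a, n - s) binom(n + b, s) ((x - 1)/2)^s ((x + 1)/2)^(n - s)\<close>
definition jacobi_poly :: "real \<Rightarrow> real \<Rightarrow> nat \<Rightarrow> real poly" where
  "jacobi_poly a b n =
     (\<Sum>s\<le>n. smult (((real n + a) gchoose (n - s)) * ((real n + b) gchoose s))
        ([:-1/2, 1/2:] ^ s * [:1/2, 1/2:] ^ (n - s)))"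

fun classical_poly :: "pearson \<Rightarrow> nat \<Rightarrow> real poly" where
  "classical_poly (OU \<theta> \<sigma> \<mu>0) n = pcompose (hermite_poly n) [:- \<mu>0 / \<sigma>, 1 / \<sigma>:]"
| "classical_poly (CIR \<theta> a b) n = pcompose (laguerre_poly (b - 1) n) [:0, a:]"
| "classical_poly (Jacobi a b) n = jacobi_poly a b n"

definition orth_poly :: "pearson \<Rightarrow> nat \<Rightarrow> real \<Rightarrow> real" where
  "orth_poly P n x = poly (classical_poly P n) x /
     sqrt (LINT y:state_space P|lborel. (poly (classical_poly P n) y)\<^sup>2 * stat_density P y)"

definition in_L2 :: "pearson \<Rightarrow> (real \<Rightarrow> real) \<Rightarrow> bool" where
  "in_L2 P h \<longleftrightarrow> set_borel_measurable lborel (state_space P) h \<and>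
     set_integrable lborel (state_space P) (\<lambda>x. (h x)\<^sup>2 * stat_density P x)"

definition fourier_coeff :: "pearson \<Rightarrow> (real \<Rightarrow> real) \<Rightarrow> nat \<Rightarrow> real" where
  "fourier_coeff P h n = (LINT x:state_space P|lborel. h x * orth_poly P n x * stat_density P x)"

definition kilbas_saigo :: "real \<Rightarrow> real \<Rightarrow> real \<Rightarrow> real \<Rightarrow> real" where
  "kilbas_saigo a m l z =
     (\<Sum>n. (\<Prod>k<n. Gamma (1 + a * (real k * m + l)) / Gamma (1 + a * (real k * m + l + 1))) * z ^ n)"

text \<open>The time integral is the gauge (Henstock-Kurzweil) integral, which contains both the
  Lebesgue integral and the improper Riemann integral. For the series solution under the stated
  hypothesis on the initial datum, f' need not be absolutely integrable at 0.\<close>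
definition frac_deriv :: "real \<Rightarrow> real \<Rightarrow> (real \<Rightarrow> real) \<Rightarrow> real \<Rightarrow> real" where
  "frac_deriv \<alpha> \<gamma> f t = t powr (- \<gamma>) / Gamma (1 - \<alpha>) *
     integral {0..t} (\<lambda>s. deriv f s / (t - s) powr \<alpha>)"

definition has_frac_deriv :: "real \<Rightarrow> (real \<Rightarrow> real) \<Rightarrow> real \<Rightarrow> bool" where
  "has_frac_deriv \<alpha> f t \<longleftrightarrow>
     (\<forall>s\<in>{0<..t}. f field_differentiable (at s)) \<and>
     (\<lambda>s. deriv f s / (t - s) powr \<alpha>) integrable_on {0..t}"

text \<open>\<open>deriv\<close> and \<open>integral\<close> are total, so the existence of all derivatives and integrals
  occurring in the equation is required explicitly.\<close>
definition strong_solution ::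
  "real \<Rightarrow> real \<Rightarrow> pearson \<Rightarrow> (real \<Rightarrow> real) \<Rightarrow> (real \<Rightarrow> real \<Rightarrow> real) \<Rightarrow> bool" where
  "strong_solution \<alpha> \<gamma> P h g \<longleftrightarrow>
     (\<forall>t>0. \<forall>y\<in>state_space P.
        has_frac_deriv \<alpha> (\<lambda>s. g s y) t \<and>
        g t field_differentiable (at y) \<and>
        deriv (g t) field_differentiable (at y) \<and>
        frac_deriv \<alpha> \<gamma> (\<lambda>s. g s y) t = generator P (g t) y) \<and>
     (\<forall>y\<in>state_space P. g 0 y = h y)"

end

theory Submission
  imports Defs "HOL-Probability.Probability" "HOL-Real_Asymp.Real_Asymp"
begin

text \<open>Write \<open>\<beta> = \<alpha> + \<gamma>\<close>, \<open>e\<^sub>\<lambda>(t)\<close> for the Kilbas-Saigo function at \<open>- \<lambda> t\<^sup>\<beta>\<close>, and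
  \<open>b\<^sub>n(y) = Q\<^sub>n(y) a\<^sub>n\<close>. Termwise integration (Beta integrals) shows that \<open>e\<^sub>\<lambda>\<close> is an eigenfunction of
  the fractional derivative. A fractional derivative is negative at a minimum that lies below the
  initial value; this minimum principle, applied to \<open>e\<close>, \<open>- t e'\<close> and \<open>t\<^sup>2 e''\<close>, shows that \<open>e\<^sub>\<lambda>\<close> is
  nonnegative, decreasing and (since \<open>\<beta> \<le> 1\<close>) convex, whence \<open>e\<^sub>\<lambda>(t) = O(1/\<lambda>)\<close> and
  \<open>e\<^sub>\<lambda>'(t) = O(1/\<lambda>)\<close> locally uniformly for \<open>t > 0\<close>.

  The series \<open>\<Sum> e\<^sub>\<lambda>\<^sub>n(s) b\<^sub>n(y)\<close> converges uniformly in \<open>s \<ge> 0\<close> by Abel summation, as \<open>e\<^sub>\<lambda>\<close> decreases in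
  \<open>\<lambda>\<close>, and its \<open>s\<close>-derivative converges uniformly for \<open>s\<close> away from \<open>0\<close> because \<open>\<Sum> |b\<^sub>n(y)| / \<lambda>\<^sub>n\<close>
  converges locally uniformly. For Jacobi polynomials the latter follows from \<open>\<lambda>\<^sub>n \<ge> n\<^sup>2 / 2\<close>; otherwise
  one uses the Cauchy-Schwarz inequality with \<open>\<Sum> a\<^sub>n\<^sup>2 < \<infinity>\<close> and \<open>\<Sum> (Q\<^sub>n(y) / \<lambda>\<^sub>n)\<^sup>2 < \<infinity>\<close>, where the last sum
  is bounded by writing \<open>Q\<^sub>n(y)\<close>, via Green's formula on \<open>[y, y + 1]\<close>, through Fourier coefficients of
  two fixed functions and applying Bessel's inequality. Hence the fractional derivative may be
  taken termwise, which also yields the locally uniform convergence of \<open>\<Sum> \<lambda>\<^sub>n e\<^sub>\<lambda>\<^sub>n(t) b\<^sub>n\<close>, i.e. of the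
  generator applied to the series. An a priori bound for \<open>u'\<close> in terms of \<open>u\<close> and \<open>\<G>u\<close> then gives
  the convergence of the first and second space derivatives.\<close>

section \<open>Classical polynomials and the generator\<close>

text \<open>The ratio of neighbouring generalised binomials, free of division so that
  \<open>x = k\<close> needs no exception; it yields the coefficient recursions of the Laguerre and
  Jacobi polynomials.\<close>

lemma gbinomial_absorb:
  fixes x :: real
  shows "(x - real k) * (x gchoose k) = (real k + 1) * (x gchoose Suc k)"
  using gbinomial_absorption'[of "Suc k" x] gbinomial_mult_1[of x k]
  by (simp add: algebra_simps)

section \<open>The Hermite equation\<close>

text \<open>Differentiating the recursion and inserting the induction hypothesis leaves
  \<open>Suc n\<close> copies of the recursion for \<open>hermite_poly (Suc n)\<close>; the product
  rule adds one more.\<close>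

lemma pderiv_hermite_Suc: "pderiv (hermite_poly (Suc n)) = of_nat (Suc n) * hermite_poly n"
proof (induction n)
  case 0
  show ?case by (simp add: pderiv_pCons one_pCons)
next
  case (Suc n)
  define x :: "real poly" where "x = [:0, 1:]"
  have x: "pderiv x = 1" by (simp add: x_def pderiv_pCons one_pCons)
  have H: "hermite_poly (Suc m) = x * hermite_poly m - pderiv (hermite_poly m)" for m
    by (simp add: x_def)
  have "pderiv (hermite_poly (Suc (Suc n))) =
      hermite_poly (Suc n) + x * pderiv (hermite_poly (Suc n)) - pderiv (pderiv (hermite_poly (Suc n)))"
    unfolding H[of "Suc n"] by (simp add: pderiv_mult pderiv_diff x del: hermite_poly.simps)
  also have "\<dots> = hermite_poly (Suc n) + of_nat (Suc n) * (x * hermite_poly n - pderiv (hermite_poly n))"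
    unfolding Suc by (simp add: pderiv_mult algebra_simps del: of_nat_Suc hermite_poly.simps)
  also have "\<dots> = of_nat (Suc (Suc n)) * hermite_poly (Suc n)"
    unfolding H by (simp add: algebra_simps)
  finally show ?case .
qed

text \<open>Once the derivatives are expressed through the polynomial of degree
  \<open>n - 1\<close>, the equation is \<open>- n\<close> times the defining recursion.\<close>

lemma hermite_ode:
  "pderiv (pderiv (hermite_poly n)) - [:0, 1:] * pderiv (hermite_poly n) = - of_nat n * hermite_poly n"
proof (cases n)
  case 0
  then show ?thesis by simp
next
  case (Suc k)
  show ?thesis
    unfolding Suc pderiv_hermite_Suc
    by (simp add: pderiv_mult right_diff_distrib del: of_nat_Suc mult_pCons_left mult_pCons_right)
qed

section \<open>The Laguerre equation\<close>

lemma laguerre_coeff: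
  "coeff (laguerre_poly \<kappa> n) i =
     (if i \<le> n then (-1) ^ i * ((real n + \<kappa>) gchoose (n - i)) / fact i else 0)"
  by (simp add: laguerre_poly_def coeff_sum)

text \<open>Absorption in the binomial gives the ratio of consecutive coefficients. The recursion
  persists beyond the degree: at \<open>i = n\<close> the factor \<open>n - i\<close> vanishes, and
  for \<open>i > n\<close> both coefficients do.\<close>

lemma laguerre_coeff_Suc:
  "(real i + 1) * (real i + \<kappa> + 1) * coeff (laguerre_poly \<kappa> n) (Suc i) =
     - ((real n - real i) * coeff (laguerre_poly \<kappa> n) i)"
proof (cases "Suc i \<le> n")
  case True
  define k where "k = n - Suc i"
  have n: "n = k + i + 1" using True by (simp add: k_def)
  have "(real n + \<kappa> - real k) * ((real n + \<kappa>) gchoose k) = (real k + 1) * ((real n + \<kappa>) gchoose Suc k)"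
    by (rule gbinomial_absorb)
  then have *: "(real i + \<kappa> + 1) * ((real n + \<kappa>) gchoose k) = (real k + 1) * ((real n + \<kappa>) gchoose Suc k)"
    by (simp add: n algebra_simps)
  have nk: "n - i = Suc k" "n - Suc i = k" "real n - real i = real k + 1" "i \<le> n" by (auto simp: n)
  have "(real i + 1) * (real i + \<kappa> + 1) * coeff (laguerre_poly \<kappa> n) (Suc i) =
     - ((-1) ^ i * ((real i + \<kappa> + 1) * ((real n + \<kappa>) gchoose k)) / fact i)"
    using True by (simp add: laguerre_coeff nk field_simps del: of_nat_Suc) (simp add: algebra_simps)
  also have "\<dots> = - ((real n - real i) * coeff (laguerre_poly \<kappa> n) i)"
    unfolding * by (simp add: laguerre_coeff nk del: of_nat_Suc)
  finally show ?thesis .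
qed (auto simp: laguerre_coeff)

text \<open>Comparing the coefficients of \<open>x^i\<close> leaves exactly
  \<open>laguerre_coeff_Suc\<close>; \<open>i = 0\<close> is separate because multiplication by
  \<open>x\<close> shifts coefficients.\<close>

lemma laguerre_ode:
  "[:0, 1:] * pderiv (pderiv (laguerre_poly \<kappa> n)) + [:\<kappa> + 1, -1:] * pderiv (laguerre_poly \<kappa> n)
     = - of_nat n * laguerre_poly \<kappa> n"
proof (rule poly_eqI)
  fix i
  let ?c = "coeff (laguerre_poly \<kappa> n)"
  have of_nat: "coeff (- of_nat n * laguerre_poly \<kappa> n) i = - real n * ?c i"
    by (simp add: of_nat_poly)
  show "coeff ([:0, 1:] * pderiv (pderiv (laguerre_poly \<kappa> n)) +
      [:\<kappa> + 1, -1:] * pderiv (laguerre_poly \<kappa> n)) i = coeff (- of_nat n * laguerre_poly \<kappa> n) i"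
  proof (cases i)
    case 0
    then show ?thesis
      unfolding of_nat using laguerre_coeff_Suc[of 0 \<kappa> n] by (simp add: coeff_pderiv)
  next
    case (Suc j)
    then show ?thesis
      unfolding of_nat using laguerre_coeff_Suc[of i \<kappa> n] by (simp add: coeff_pderiv algebra_simps)
  qed
qed

lemma pderiv_sum: "pderiv (sum f A) = (\<Sum>x\<in>A. pderiv (f x :: real poly))"
  using higher_pderiv_sum[of 1 f A] by simp

section \<open>The Jacobi equation\<close>

text \<open>With \<open>U = (x - 1)/2\<close> and \<open>W = (x + 1)/2\<close>, the operator sends
  \<open>U^s * W^(n - s)\<close> to a combination of itself and its two neighbours. The weights
  \<open>A s\<close> obey a recursion that turns both neighbour sums into diagonal ones.\<close>

lemma jacobi_ode:
  fixes a b x :: real and n :: nat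
  defines "p \<equiv> jacobi_poly a b n"
  shows "(1 - x\<^sup>2) * poly (pderiv (pderiv p)) x + (- (a + b + 2) * x + b - a) * poly (pderiv p) x
     = - (real n * (real n + a + b + 1)) * poly p x"
proof -
  define u w :: "real poly" where "u = [:-1/2, 1/2:]" and "w = [:1/2, 1/2:]"
  define U W where "U = poly u x" and "W = poly w x"
  define A where "A s = ((real n + a) gchoose (n - s)) * ((real n + b) gchoose s)" for s
  define M where "M s r = u ^ s * w ^ r" for s r
  define L where "L f = (1 - x\<^sup>2) * poly (pderiv (pderiv f)) x + (- (a + b + 2) * x + b - a) * poly (pderiv f) x" for f
  have p: "p = (\<Sum>s\<le>n. smult (A s) (M s (n - s)))"
    by (simp add: p_def jacobi_poly_def A_def M_def u_def w_def)
  have du: "pderiv u = [:1/2:]" "pderiv w = [:1/2:]" by (auto simp: u_def w_def pderiv_pCons)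
  have D: "1 - x\<^sup>2 = - 4 * U * W" by (simp add: U_def W_def u_def w_def field_simps power2_eq_square)
  have mu: "- (a + b + 2) * x + b - a = - 2 * (a + 1) * W - 2 * (b + 1) * U"
    by (simp add: U_def W_def u_def w_def field_simps)
  define up dn where "up s = real s * (real s + a) * (U ^ (s - 1) * W ^ Suc (n - s))"
    and "dn s = real (n - s) * (real (n - s) + b) * (U ^ Suc s * W ^ (n - s - 1))" for s
  define di where "di s = 2 * real s * real (n - s) + (a + 1) * real (n - s) + (b + 1) * real s" for s
  \<comment> \<open>The first two identities are multiplied by the linear factor, so that its root
    needs no separate treatment; the third is the power rule.\<close>
  have euler: "poly f x * poly (pderiv (f ^ k)) x = real k / 2 * poly f x ^ k"
      "poly f x * poly (pderiv (pderiv (f ^ k))) x = (real k - 1) / 2 * poly (pderiv (f ^ k)) x"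
      "poly (pderiv (f ^ k)) x = real k / 2 * poly f x ^ (k - 1)"
    if "pderiv f = [:1/2:]" for f k
  proof -
    have *: "f * pderiv (f ^ k) = smult (real k / 2) (f ^ k)"
    proof (cases k)
      case (Suc m)
      have "f * pderiv (f ^ k) = f * (smult (real (Suc m)) (f ^ m) * [:1/2:])"
        unfolding Suc pderiv_power_Suc that ..
      also have "\<dots> = smult (real k / 2) (f ^ k)"
        by (simp add: Suc del: of_nat_Suc)
      finally show ?thesis .
    qed simp
    then show "poly f x * poly (pderiv (f ^ k)) x = real k / 2 * poly f x ^ k"
      by (metis poly_mult poly_smult poly_power)
    have "pderiv (f * pderiv (f ^ k)) = smult (real k / 2) (pderiv (f ^ k))"
      unfolding * by (simp add: pderiv_smult)
    then have "poly (f * pderiv (pderiv (f ^ k)) + smult (1 / 2) (pderiv (f ^ k))) x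
        = poly (smult (real k / 2) (pderiv (f ^ k))) x"
      by (simp add: pderiv_mult that)
    then show "poly f x * poly (pderiv (pderiv (f ^ k))) x = (real k - 1) / 2 * poly (pderiv (f ^ k)) x"
      by (simp add: field_simps)
    show "poly (pderiv (f ^ k)) x = real k / 2 * poly f x ^ (k - 1)"
      by (cases k) (simp_all add: pderiv_power_Suc that del: of_nat_Suc power_Suc)
  qed
  have LM: "L (M s (n - s)) = - (up s + di s * (U ^ s * W ^ (n - s)) + dn s)" if "s \<le> n" for s
  proof -
    define r where "r = n - s"
    define g h where "g = poly (u ^ s) x" and "h = poly (w ^ r) x"
    define g1 h1 where "g1 = poly (pderiv (u ^ s)) x" and "h1 = poly (pderiv (w ^ r)) x"
    define g2 h2 where "g2 = poly (pderiv (pderiv (u ^ s))) x" and "h2 = poly (pderiv (pderiv (w ^ r))) x"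
    have e: "U * g1 = real s / 2 * g" "W * h1 = real r / 2 * h"
      "U * g2 = (real s - 1) / 2 * g1" "W * h2 = (real r - 1) / 2 * h1"
      using euler(1,2)[OF du(1), of s] euler(1,2)[OF du(2), of r]
      by (simp_all add: U_def W_def g_def h_def g1_def h1_def g2_def h2_def)
    have "L (M s r) = - 4 * U * W * (g2 * h + 2 * (g1 * h1) + g * h2)
        + (- 2 * (a + 1) * W - 2 * (b + 1) * U) * (g1 * h + g * h1)"
      unfolding L_def D mu M_def
      by (simp add: pderiv_mult pderiv_add g_def h_def g1_def h1_def g2_def h2_def algebra_simps)
    also have "\<dots> = - 4 * W * h * (U * g2) - 8 * ((U * g1) * (W * h1)) - 4 * U * g * (W * h2)
        - 2 * (a + 1) * (W * h * g1 + g * (W * h1)) - 2 * (b + 1) * (h * (U * g1) + U * g * h1)"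
      by (simp add: algebra_simps)
    also have "\<dots> = - (2 * (real s + a) * (W * h * g1) + di s * (g * h) + 2 * (real r + b) * (U * g * h1))"
      unfolding e di_def r_def[symmetric] by (simp add: field_simps)
    also have "2 * (real s + a) * (W * h * g1) = up s"
      using euler(3)[OF du(1), of s]
      by (simp add: up_def g1_def h_def U_def W_def algebra_simps flip: r_def)
    also have "2 * (real r + b) * (U * g * h1) = dn s"
      using euler(3)[OF du(2), of r]
      by (simp add: dn_def h1_def g_def U_def W_def algebra_simps flip: r_def)
    finally show ?thesis by (simp add: g_def h_def U_def W_def r_def)
  qed
  \<comment> \<open>Absorption in each of the two binomials balances neighbouring weights; after an
    index shift the sums over \<open>up\<close> and \<open>dn\<close> thereby become
    diagonal.\<close>
  have A_Suc: "A (Suc s) * (real (Suc s) * (real (Suc s) + a)) = A s * (real (n - s) * (real (n - s) + b))"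
    if "s < n" for s
  proof -
    define k where "k = n - Suc s"
    have k: "n - s = Suc k" "n - Suc s = k" "real n = real s + real k + 1" using that by (auto simp: k_def)
    have 1: "(real s + 1 + a) * ((real n + a) gchoose k) = real (Suc k) * ((real n + a) gchoose Suc k)"
      using gbinomial_absorb[of "real n + a" k] by (simp add: k algebra_simps)
    have 2: "real (Suc s) * ((real n + b) gchoose Suc s) = (real (Suc k) + b) * ((real n + b) gchoose s)"
      using gbinomial_absorb[of "real n + b" s] by (simp add: k algebra_simps)
    have "A (Suc s) * (real (Suc s) * (real (Suc s) + a)) =
        ((real s + 1 + a) * ((real n + a) gchoose k)) * (real (Suc s) * ((real n + b) gchoose Suc s))"
      by (simp add: A_def k)
    also have "\<dots> = A s * (real (n - s) * (real (n - s) + b))"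
      unfolding 1 2 by (simp add: A_def k del: of_nat_Suc)
    finally show ?thesis .
  qed
  define T where "T s = U ^ s * W ^ (n - s)" for s
  have up: "(\<Sum>s\<le>n. A s * up s) = (\<Sum>s\<le>n. A s * (real (n - s) * (real (n - s) + b)) * T s)"
  proof -
    have "(\<Sum>s\<le>n. A s * up s) = (\<Sum>s<n. A (Suc s) * up (Suc s))"
      by (simp add: sum.atMost_shift up_def)
    also have "\<dots> = (\<Sum>s<n. A s * (real (n - s) * (real (n - s) + b)) * T s)"
    proof (intro sum.cong refl)
      fix s assume "s \<in> {..<n}"
      then have "s < n" by simp
      have "A (Suc s) * up (Suc s) = A (Suc s) * (real (Suc s) * (real (Suc s) + a)) * T s"
        using \<open>s < n\<close> by (simp add: up_def T_def flip: power_Suc) (simp add: Suc_diff_Suc)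
      then show "A (Suc s) * up (Suc s) = A s * (real (n - s) * (real (n - s) + b)) * T s"
        by (simp only: A_Suc[OF \<open>s < n\<close>])
    qed
    finally show ?thesis by (simp add: lessThan_Suc_atMost[symmetric])
  qed
  have dn: "(\<Sum>s\<le>n. A s * dn s) = (\<Sum>s\<le>n. A s * (real s * (real s + a)) * T s)"
  proof -
    have "(\<Sum>s\<le>n. A s * dn s) = (\<Sum>s<n. A s * dn s)"
      by (simp add: dn_def lessThan_Suc_atMost[symmetric])
    also have "\<dots> = (\<Sum>s<n. A (Suc s) * (real (Suc s) * (real (Suc s) + a)) * T (Suc s))"
    proof (intro sum.cong refl)
      fix s assume "s \<in> {..<n}"
      then have "s < n" by simp
      have "A s * dn s = A s * (real (n - s) * (real (n - s) + b)) * T (Suc s)"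
        by (simp add: dn_def T_def)
      then show "A s * dn s = A (Suc s) * (real (Suc s) * (real (Suc s) + a)) * T (Suc s)"
        by (simp only: A_Suc[OF \<open>s < n\<close>])
    qed
    also have "\<dots> = (\<Sum>s\<le>n. A s * (real s * (real s + a)) * T s)"
      by (subst sum.atMost_shift) simp
    finally show ?thesis .
  qed
  have "L p = (\<Sum>s\<le>n. A s * L (M s (n - s)))"
    unfolding p L_def
    by (simp add: pderiv_sum pderiv_smult poly_sum sum_distrib_left sum.distrib[symmetric] algebra_simps)
  also have "\<dots> = - ((\<Sum>s\<le>n. A s * up s) + (\<Sum>s\<le>n. A s * di s * T s) + (\<Sum>s\<le>n. A s * dn s))"
    by (simp add: LM T_def sum.distrib[symmetric] sum_negf[symmetric] algebra_simps)
  \<comment> \<open>With \<open>r = n - s\<close>, the weights \<open>r * (r + b)\<close>,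
    \<open>di s\<close> and \<open>s * (s + a)\<close> add up to
    \<open>(r + s)^2 + (a + b + 1) * (r + s)\<close>.\<close>
  also have "\<dots> = - (\<Sum>s\<le>n. A s * T s * (real n * (real n + a + b + 1)))"
    unfolding up dn sum.distrib[symmetric]
    by (intro arg_cong[of _ _ uminus] sum.cong refl) (simp add: di_def of_nat_diff algebra_simps)
  also have "\<dots> = - (real n * (real n + a + b + 1)) * poly p x"
  proof -
    have "poly p x = (\<Sum>s\<le>n. A s * T s)"
      by (simp add: p M_def T_def U_def W_def poly_sum)
    then show ?thesis by (simp add: sum_distrib_right[symmetric] mult.commute)
  qed
  finally show ?thesis by (simp add: L_def)
qed

section \<open>The common eigenvalue equation\<close>

lemma poly_pderiv_pcompose_linear:
  fixes p :: "real poly"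
  shows "poly (pderiv (pcompose p [:c, d:])) y = d * poly (pderiv p) (c + d * y)"
    and "poly (pderiv (pderiv (pcompose p [:c, d:]))) y = d\<^sup>2 * poly (pderiv (pderiv p)) (c + d * y)"
  by (simp_all add: pderiv_pcompose pderiv_pCons pderiv_smult poly_pcompose power2_eq_square mult.commute)

lemma classical_poly_ode:
  assumes "admissible P"
  shows "diffusion P y * poly (pderiv (pderiv (classical_poly P n))) y
    + drift P y * poly (pderiv (classical_poly P n)) y = - eigenvalue P n * poly (classical_poly P n) y"
proof (cases P)
  case (OU \<theta> \<sigma> \<mu>0)
  define z where "z = - \<mu>0 / \<sigma> + 1 / \<sigma> * y"
  have s: "\<sigma> \<noteq> 0" using assms OU by auto
  have "poly (pderiv (pderiv (hermite_poly n)) - [:0, 1:] * pderiv (hermite_poly n)) z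
      = poly (- of_nat n * hermite_poly n) z"
    by (simp only: hermite_ode)
  then have *: "poly (pderiv (pderiv (hermite_poly n))) z - z * poly (pderiv (hermite_poly n)) z
      = - real n * poly (hermite_poly n) z" by simp
  have "diffusion P y * poly (pderiv (pderiv (classical_poly P n))) y + drift P y * poly (pderiv (classical_poly P n)) y
    = \<theta> * (poly (pderiv (pderiv (hermite_poly n))) z - z * poly (pderiv (hermite_poly n)) z)"
    using s by (simp add: OU poly_pderiv_pcompose_linear z_def[symmetric])
      (simp add: z_def field_simps power2_eq_square)
  also have "\<dots> = - eigenvalue P n * poly (classical_poly P n) y"
    unfolding * by (simp add: OU poly_pcompose z_def)
  finally show ?thesis .
next
  case (CIR \<theta> a b)
  define z where "z = a * y"
  have a: "a > 0" using assms CIR by auto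
  have "poly ([:0, 1:] * pderiv (pderiv (laguerre_poly (b - 1) n)) + [:b - 1 + 1, -1:] * pderiv (laguerre_poly (b - 1) n)) z
      = poly (- of_nat n * laguerre_poly (b - 1) n) z"
    by (simp only: laguerre_ode)
  then have *: "z * poly (pderiv (pderiv (laguerre_poly (b - 1) n))) z + (b - z) * poly (pderiv (laguerre_poly (b - 1) n)) z
      = - real n * poly (laguerre_poly (b - 1) n) z" by (simp add: algebra_simps)
  have "diffusion P y * poly (pderiv (pderiv (classical_poly P n))) y + drift P y * poly (pderiv (classical_poly P n)) y
    = \<theta> * (z * poly (pderiv (pderiv (laguerre_poly (b - 1) n))) z + (b - z) * poly (pderiv (laguerre_poly (b - 1) n)) z)"
    using a by (simp add: CIR poly_pderiv_pcompose_linear)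
      (simp add: z_def field_simps power2_eq_square)
  also have "\<dots> = - eigenvalue P n * poly (classical_poly P n) y"
    unfolding * by (simp add: CIR poly_pcompose z_def mult.commute)
  finally show ?thesis .
next
  case (Jacobi a b)
  then show ?thesis
    using jacobi_ode[of y a b n] by (simp add: algebra_simps)
qed

text \<open>A polynomial version of \<open>orth_poly\<close>, so that its derivatives are given by
  \<open>pderiv\<close>.\<close>

definition orth_pol :: "pearson \<Rightarrow> nat \<Rightarrow> real poly" where
  "orth_pol P n = smult (1 / sqrt (LINT y:state_space P|lborel. (poly (classical_poly P n) y)\<^sup>2 * stat_density P y))
     (classical_poly P n)"

lemma orth_poly_eq: "orth_poly P n = poly (orth_pol P n)"
  by (rule ext) (simp add: orth_poly_def orth_pol_def)

lemma orth_pol_ode: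
  assumes "admissible P"
  shows "diffusion P y * poly (pderiv (pderiv (orth_pol P n))) y
    + drift P y * poly (pderiv (orth_pol P n)) y = - eigenvalue P n * poly (orth_pol P n) y"
proof -
  have "diffusion P y * poly (pderiv (pderiv (orth_pol P n))) y + drift P y * poly (pderiv (orth_pol P n)) y
    = 1 / sqrt (LINT y:state_space P|lborel. (poly (classical_poly P n) y)\<^sup>2 * stat_density P y) *
      (diffusion P y * poly (pderiv (pderiv (classical_poly P n))) y + drift P y * poly (pderiv (classical_poly P n)) y)"
    by (simp add: orth_pol_def pderiv_smult add_divide_distrib)
  then show ?thesis
    unfolding classical_poly_ode[OF assms] by (simp add: orth_pol_def)
qed

section \<open>The flux identity and the growth of the eigenvalues\<close>

lemma diffusion_pos:
  "admissible P \<Longrightarrow> y \<in> state_space P \<Longrightarrow> diffusion P y > 0"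
  by (cases P) (auto simp: power2_eq_square square_eq_iff abs_square_less_1[unfolded power2_eq_square])

lemma stat_density_pos:
  "admissible P \<Longrightarrow> y \<in> state_space P \<Longrightarrow> stat_density P y > 0"
  by (cases P) (auto simp: Beta_def Gamma_real_pos intro!: mult_pos_pos divide_pos_pos)

text \<open>Pearson's equation. It puts the generator into the divergence form
  \<open>m * G u = (D m u')'\<close>, on which Green's formula and the bound for space derivatives
  rest.\<close>

lemma has_real_derivative_flux:
  assumes "admissible P" "y \<in> state_space P"
  shows "((\<lambda>x. diffusion P x * stat_density P x) has_real_derivative drift P y * stat_density P y) (at y)"
proof (cases P)
  case (OU \<theta> \<sigma> \<mu>0)
  then have s: "\<sigma> \<noteq> 0" using assms by auto
  define C where "C = 1 / sqrt (2 * pi * \<sigma>\<^sup>2)"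
  have "((\<lambda>x. \<theta> * \<sigma>\<^sup>2 * (C * exp (- (x - \<mu>0)\<^sup>2 / (2 * \<sigma>\<^sup>2)))) has_real_derivative
     - \<theta> * (y - \<mu>0) * (C * exp (- (y - \<mu>0)\<^sup>2 / (2 * \<sigma>\<^sup>2)))) (at y)"
    using s by (auto intro!: derivative_eq_intros simp: power2_eq_square)
  then show ?thesis by (simp add: OU C_def)
next
  case (CIR \<theta> a b)
  then have a: "a > 0" "y > 0" using assms by auto
  define C where "C = a powr b / Gamma b"
  have "((\<lambda>x. \<theta> * x / a * (C * x powr (b - 1) * exp (- a * x))) has_real_derivative
     - \<theta> * (y - b / a) * (C * y powr (b - 1) * exp (- a * y))) (at y)"
    using a by (auto intro!: derivative_eq_intros has_real_derivative_powr simp del: Gamma_eq_zero_iff)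
      (auto simp: powr_diff field_simps power2_eq_square)
  then show ?thesis by (simp add: CIR C_def)
next
  case (Jacobi a b)
  then have y: "1 - y > 0" "1 + y > 0" using assms by auto
  define C where "C = Beta (a + 1) (b + 1) * 2 powr (a + b + 1)"
  have "((\<lambda>x. (1 - x\<^sup>2) * ((1 - x) powr a * (1 + x) powr b)) has_real_derivative
     (- (a + b + 2) * y + b - a) * ((1 - y) powr a * (1 + y) powr b)) (at y)"
  proof (rule DERIV_cong)
    show "((\<lambda>x. (1 - x\<^sup>2) * ((1 - x) powr a * (1 + x) powr b)) has_real_derivative
      (1 - y\<^sup>2) * ((1 - y) powr a * (b * (1 + y) powr (b - 1)) - a * (1 - y) powr (a - 1) * (1 + y) powr b)
       - 2 * y * ((1 - y) powr a * (1 + y) powr b)) (at y)"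
      using y by (auto intro!: derivative_eq_intros)
    define u v where "u = 1 - y" and "v = 1 + y"
    have uv: "1 - y\<^sup>2 = u * v" "u > 0" "v > 0"
      using y by (auto simp: u_def v_def field_simps power2_eq_square)
    have "(1 - y\<^sup>2) * ((1 - y) powr a * (b * (1 + y) powr (b - 1)) - a * (1 - y) powr (a - 1) * (1 + y) powr b)
        = u powr a * v powr b * (b * u - a * v)"
      using uv(2,3) by (simp add: uv(1) powr_diff flip: u_def v_def) (simp add: field_simps)
    also have "\<dots> - 2 * y * ((1 - y) powr a * (1 + y) powr b)
        = (- (a + b + 2) * y + b - a) * ((1 - y) powr a * (1 + y) powr b)"
      by (simp add: u_def v_def algebra_simps)
    finally show "(1 - y\<^sup>2) * ((1 - y) powr a * (b * (1 + y) powr (b - 1)) - a * (1 - y) powr (a - 1) * (1 + y) powr b)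
       - 2 * y * ((1 - y) powr a * (1 + y) powr b)
        = (- (a + b + 2) * y + b - a) * ((1 - y) powr a * (1 + y) powr b)" .
  qed
  from DERIV_cdivide[OF this, of C] show ?thesis by (simp add: Jacobi C_def)
qed

lemma continuous_on_stat_density:
  "admissible P \<Longrightarrow> continuous_on (state_space P) (stat_density P)"
  by (cases P) (auto intro!: continuous_intros simp: Beta_def Gamma_eq_zero_iff elim!: nonpos_Ints_cases')

lemma continuous_on_drift: "continuous_on A (drift P)"
  by (cases P) (auto intro!: continuous_intros)

lemma continuous_on_diffusion: "continuous_on A (diffusion P)"
  by (cases P) (auto intro!: continuous_intros simp: divide_inverse)

lemma eigenvalue_0 [simp]: "eigenvalue P 0 = 0"
  by (cases P) auto

text \<open>In the Jacobi case the increment is \<open>2 * n + a + b + 2\<close>, which is positive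
  because \<open>a\<close> and \<open>b\<close> exceed -1. Strictness separates the eigenvalues for
  orthogonality; monotonicity serves Abel summation.\<close>

lemma eigenvalue_strict_mono: "admissible P \<Longrightarrow> strict_mono (eigenvalue P)"
  by (rule strict_monoI_Suc, cases P) (auto simp: algebra_simps)

lemma open_state_space: "open (state_space P)"
  by (cases P) auto

section \<open>Kilbas-Saigo functions\<close>

definition entire :: "(nat \<Rightarrow> real) \<Rightarrow> bool" where
  "entire p \<longleftrightarrow> (\<forall>x. summable (\<lambda>n. p n * x ^ n))"

definition pws :: "(nat \<Rightarrow> real) \<Rightarrow> real \<Rightarrow> real" where
  "pws p x = (\<Sum>n. p n * x ^ n)"

lemma entire_diffs: "entire p \<Longrightarrow> entire (diffs p)"
  unfolding entire_def using termdiff_converges_all by blast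

lemma pws_0 [simp]: "pws p 0 = p 0"
  unfolding pws_def by (rule powser_zero)

lemma DERIV_pws: "entire p \<Longrightarrow> (pws p has_real_derivative pws (diffs p) x) (at x)"
  unfolding entire_def pws_def by (rule termdiffs_strong_converges_everywhere) blast

lemma DERIV_pws_chain [derivative_intros]:
  assumes "entire p" "(f has_real_derivative D) (at x within A)"
  shows "((\<lambda>x. pws p (f x)) has_real_derivative pws (diffs p) (f x) * D) (at x within A)"
  using DERIV_chain2[OF DERIV_pws[OF assms(1)] assms(2)] .

lemma continuous_on_pws: "entire p \<Longrightarrow> continuous_on A f \<Longrightarrow> continuous_on A (\<lambda>x. pws p (f x))"
  by (rule continuous_on_compose2[of UNIV "pws p"])
     (auto intro!: continuous_at_imp_continuous_on DERIV_isCont[OF DERIV_pws])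

lemma entire_abs_summable:
  assumes "entire p" shows "summable (\<lambda>n. \<bar>p n\<bar> * \<bar>x\<bar> ^ n)"
proof -
  have "summable (\<lambda>n. p n * (\<bar>x\<bar> + 1) ^ n)" using assms by (simp add: entire_def)
  from powser_insidea[OF this, of x] show ?thesis by (simp add: abs_mult power_abs)
qed

text \<open>Multiplying the coefficients by \<open>n\<close> is the Euler operator
  \<open>x d/dx\<close>, so the series arises from the differentiated one by an index shift.\<close>

lemma entire_times_nat: "entire p \<Longrightarrow> entire (\<lambda>n. real n * p n)"
proof -
  assume p: "entire p"
  have "summable (\<lambda>n. real n * p n * x ^ n)" for x
  proof -
    have "summable (\<lambda>n. x * (diffs p n * x ^ n))"
      using entire_diffs[OF p] unfolding entire_def by (intro summable_mult) blast
    then have "summable (\<lambda>n. real (Suc n) * p (Suc n) * x ^ Suc n)"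
      by (simp add: diffs_def mult_ac)
    then show ?thesis by (subst (asm) summable_Suc_iff)
  qed
  then show ?thesis by (simp add: entire_def)
qed

lemma entire_cmult: "entire p \<Longrightarrow> entire (\<lambda>n. c * p n)"
  unfolding entire_def by (auto simp: mult.assoc intro: summable_mult)

lemma entire_add: "entire p \<Longrightarrow> entire q \<Longrightarrow> entire (\<lambda>n. p n + q n)"
  unfolding entire_def by (auto simp: distrib_right intro: summable_add)

lemma pws_cmult: "entire p \<Longrightarrow> pws (\<lambda>n. c * p n) x = c * pws p x"
  unfolding entire_def pws_def by (simp add: mult.assoc suminf_mult)

lemma pws_add: "entire p \<Longrightarrow> entire q \<Longrightarrow> pws (\<lambda>n. p n + q n) x = pws p x + pws q x"
  unfolding entire_def pws_def by (simp add: distrib_right suminf_add)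

lemma pws_times_nat: "entire p \<Longrightarrow> pws (\<lambda>n. real n * p n) x = x * pws (diffs p) x"
proof -
  assume p: "entire p"
  have "(\<lambda>n. x * (diffs p n * x ^ n)) sums (x * pws (diffs p) x)"
    using entire_diffs[OF p] unfolding entire_def pws_def by (intro sums_mult summable_sums) blast
  then have "(\<lambda>n. real (Suc n) * p (Suc n) * x ^ Suc n) sums (x * pws (diffs p) x)"
    by (simp add: diffs_def mult_ac)
  from sums_Suc[OF this] show ?thesis by (simp add: pws_def sums_iff)
qed

lemma entire_scale: "entire p \<Longrightarrow> entire (\<lambda>n. p n * l ^ n)"
  unfolding entire_def by (simp add: mult.assoc flip: power_mult_distrib)

lemma pws_scale: "pws (\<lambda>n. p n * l ^ n) x = pws p (l * x)"
  unfolding pws_def by (simp add: mult.assoc power_mult_distrib)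

section \<open>Fractional integrals of powers and the sign at a minimum\<close>

text \<open>The substitution \<open>s = t * x\<close> in Euler's Beta integral.\<close>

lemma has_integral_Beta_scaled:
  fixes a b t :: real
  assumes "a > 0" "b > 0" "t > 0"
  shows "((\<lambda>s. s powr (a - 1) * (t - s) powr (b - 1)) has_integral t powr (a + b - 1) * Beta a b) {0..t}"
proof -
  have "((\<lambda>x. (1 / t * x) powr (a - 1) * (1 - 1 / t * x) powr (b - 1)) has_integral (1 / \<bar>1 / t\<bar>) *\<^sub>R Beta a b)
      ((\<lambda>x. x / (1 / t)) ` {0..1})"
    using assms by (intro has_integral_stretch_real has_integral_Beta_real) auto
  also have "(\<lambda>x. x / (1 / t)) ` {0..1} = {0..t}"
    using assms image_mult_atLeastAtMost[of t 0 1] by (simp add: mult.commute)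
  finally have "((\<lambda>x. t powr (a + b - 2) * ((1 / t * x) powr (a - 1) * (1 - 1 / t * x) powr (b - 1))) has_integral
      t powr (a + b - 2) * (t * Beta a b)) {0..t}"
    using assms by (intro has_integral_mult_right) simp
  also have "t powr (a + b - 2) * (t * Beta a b) = t powr (a + b - 1) * Beta a b"
    using assms powr_add[of t "a + b - 2" 1] by simp
  also have "((\<lambda>x. t powr (a + b - 2) * ((1 / t * x) powr (a - 1) * (1 - 1 / t * x) powr (b - 1))) has_integral
      t powr (a + b - 1) * Beta a b) {0..t} \<longleftrightarrow> ?thesis"
  proof (rule has_integral_cong)
    fix x assume x: "x \<in> {0..t}"
    have "1 - 1 / t * x = (t - x) / t" using assms by (simp add: field_simps)
    moreover have "t powr (a + b - 2) = t powr (a - 1) * t powr (b - 1)"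
      by (simp flip: powr_add)
    ultimately show "t powr (a + b - 2) * ((1 / t * x) powr (a - 1) * (1 - 1 / t * x) powr (b - 1))
        = x powr (a - 1) * (t - x) powr (b - 1)"
      using assms x by (simp add: powr_divide)
  qed
  finally show ?thesis .
qed

text \<open>Integrating \<open>F - F t\<close> by parts against the kernel up to
  \<open>\<tau> < t\<close> leaves boundary terms and an integral that has a sign because
  \<open>F t\<close> is the minimum. As \<open>\<tau>\<close> tends to \<open>t\<close>, the upper
  boundary term vanishes and the lower one is
  \<open>(F t - F 0) * t powr (- \<alpha>) < 0\<close>.\<close>

lemma caputo_at_minimum:
  fixes F F' :: "real \<Rightarrow> real"
  assumes \<alpha>: "0 < \<alpha>" "\<alpha> < 1" and t: "t > 0"
    and cont: "continuous_on {0..t} F"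
    and deriv: "\<And>s. 0 < s \<Longrightarrow> s \<le> t \<Longrightarrow> (F has_real_derivative F' s) (at s)"
    and min: "\<And>s. 0 \<le> s \<Longrightarrow> s \<le> t \<Longrightarrow> F t \<le> F s" and less: "F t < F 0"
    and I: "((\<lambda>s. F' s / (t - s) powr \<alpha>) has_integral I) {0..t}"
  shows "I < 0"
proof -
  let ?f = "\<lambda>s. F' s / (t - s) powr \<alpha>"
  define G where "G s = (F s - F t) * (t - s) powr (- \<alpha>)" for s
  have int: "?f integrable_on {0..t}" using I by (rule has_integral_integrable)
  have le: "integral {0..\<tau>} ?f \<le> G \<tau> - G 0" if \<tau>: "0 < \<tau>" "\<tau> < t" for \<tau>
  proof (rule has_integral_le)
    show "(?f has_integral integral {0..\<tau>} ?f) {0..\<tau>}"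
      using int \<tau> by (intro integrable_integral integrable_on_subinterval[OF int]) auto
    show "((\<lambda>s. F' s * (t - s) powr (- \<alpha>) + (F s - F t) * (\<alpha> * (t - s) powr (- \<alpha> - 1)))
        has_integral (G \<tau> - G 0)) {0..\<tau>}"
      unfolding G_def
    proof (rule fundamental_theorem_of_calculus_interior)
      show "continuous_on {0..\<tau>} (\<lambda>s. (F s - F t) * (t - s) powr - \<alpha>)"
        using \<tau> by (intro continuous_intros continuous_on_subset[OF cont]) auto
      show "((\<lambda>s. (F s - F t) * (t - s) powr - \<alpha>) has_vector_derivative
         F' s * (t - s) powr - \<alpha> + (F s - F t) * (\<alpha> * (t - s) powr (- \<alpha> - 1))) (at s)"
        if "s \<in> {0<..<\<tau>}" for s
        using that \<tau> unfolding has_real_derivative_iff_has_vector_derivative[symmetric]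
        by (auto intro!: derivative_eq_intros deriv has_real_derivative_powr simp: powr_diff)
    qed (use \<tau> in auto)
    show "?f s \<le> F' s * (t - s) powr (- \<alpha>) + (F s - F t) * (\<alpha> * (t - s) powr (- \<alpha> - 1))"
      if "s \<in> {0..\<tau>}" for s
      using that \<tau> \<alpha> min[of s] by (simp add: powr_minus divide_inverse)
  qed
  \<comment> \<open>The integrals up to \<open>\<tau>\<close> converge to the one up to
    \<open>t\<close>, although the kernel is singular there, because the indefinite integral is
    continuous.\<close>
  have "continuous_on {0..t} (\<lambda>x. integral {0..x} ?f)"
    using int by (rule indefinite_integral_continuous_1)
  then have lim1: "((\<lambda>\<tau>. integral {0..\<tau>} ?f) \<longlongrightarrow> integral {0..t} ?f) (at_left t)"
    using t by (auto simp: continuous_on_def at_within_Icc_at_left dest: bspec[of _ _ t])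
  \<comment> \<open>Near \<open>t\<close>, \<open>G \<tau>\<close> is the difference quotient of
    \<open>F\<close> times \<open>- ((t - \<tau>) powr (1 - \<alpha>))\<close>: a convergent factor
    times one that tends to 0.\<close>
  have "((\<lambda>\<tau>. (F \<tau> - F t) / (\<tau> - t)) \<longlongrightarrow> F' t) (at_left t)"
    using deriv[of t] t unfolding has_field_derivative_iff
    by (auto intro: tendsto_within_subset)
  moreover have "((\<lambda>\<tau>. (t - \<tau>) powr (1 - \<alpha>)) \<longlongrightarrow> 0) (at_left t)"
  proof -
    have "((\<lambda>\<tau>. (t - \<tau>) powr (1 - \<alpha>)) \<longlongrightarrow> (t - t) powr (1 - \<alpha>)) (at_left t)"
      using \<alpha> by (intro tendsto_powr' tendsto_intros) (auto simp: eventually_at_filter)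
    then show ?thesis by simp
  qed
  ultimately have "((\<lambda>\<tau>. (F \<tau> - F t) / (\<tau> - t) * (- ((t - \<tau>) powr (1 - \<alpha>)))) \<longlongrightarrow> F' t * (- 0)) (at_left t)"
    by (intro tendsto_intros)
  moreover have "eventually (\<lambda>\<tau>. (F \<tau> - F t) / (\<tau> - t) * (- ((t - \<tau>) powr (1 - \<alpha>))) = G \<tau>) (at_left t)"
    unfolding eventually_at_filter
    by (intro always_eventually)
       (auto simp: G_def powr_diff powr_minus divide_simps, auto simp: algebra_simps)
  ultimately have "(G \<longlongrightarrow> F' t * (- 0)) (at_left t)" by (rule Lim_transform_eventually)
  then have "((\<lambda>\<tau>. G \<tau> - G 0) \<longlongrightarrow> F' t * (- 0) - G 0) (at_left t)" by (intro tendsto_intros)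
  then have lim2: "((\<lambda>\<tau>. G \<tau> - G 0) \<longlongrightarrow> - G 0) (at_left t)" by simp
  have "eventually (\<lambda>\<tau>. \<tau> \<in> {0<..<t}) (at_left t)" using t by (intro eventually_at_leftI[of 0]) auto
  then have ev: "eventually (\<lambda>\<tau>. integral {0..\<tau>} ?f \<le> G \<tau> - G 0) (at_left t)"
    by eventually_elim (auto intro: le)
  have "integral {0..t} ?f \<le> - G 0"
    by (rule tendsto_le[OF _ lim2 lim1 ev]) (simp add: trivial_limit_at_left_real)
  also have "- G 0 < 0" using less t by (simp add: G_def)
  finally show ?thesis using I by (simp add: integral_unique)
qed

section \<open>Asymptotics of Gamma quotients\<close>

text \<open>Log-convexity of Gamma on \<open>[x + \<alpha>, x + \<alpha> + 1]\<close>, evaluated at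
  \<open>x + 1\<close>, the convex combination with weight \<open>1 - \<alpha>\<close> on the right
  endpoint.\<close>

lemma Gamma_ratio_le:
  fixes x \<alpha> :: real
  assumes "x > 0" "0 < \<alpha>" "\<alpha> < 1"
  shows "Gamma x / Gamma (x + \<alpha>) \<le> (x + \<alpha>) powr (1 - \<alpha>) / x"
proof -
  have "(ln \<circ> Gamma) ((1 - (1 - \<alpha>)) *\<^sub>R (x + \<alpha>) + (1 - \<alpha>) *\<^sub>R (x + \<alpha> + 1))
      \<le> (1 - (1 - \<alpha>)) * (ln \<circ> Gamma) (x + \<alpha>) + (1 - \<alpha>) * (ln \<circ> Gamma) (x + \<alpha> + 1)"
    using assms by (intro convex_onD[OF log_convex_Gamma_real]) auto
  also have "(1 - (1 - \<alpha>)) *\<^sub>R (x + \<alpha>) + (1 - \<alpha>) *\<^sub>R (x + \<alpha> + 1) = x + 1"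
    by (simp add: algebra_simps)
  also have "(1 - (1 - \<alpha>)) * (ln \<circ> Gamma) (x + \<alpha>) + (1 - \<alpha>) * (ln \<circ> Gamma) (x + \<alpha> + 1)
      = ln (Gamma (x + \<alpha>)) + (1 - \<alpha>) * ln (x + \<alpha>)"
  proof -
    have "Gamma (x + \<alpha> + 1) = (x + \<alpha>) * Gamma (x + \<alpha>)"
      using assms by (intro Gamma_plus1) (auto elim!: nonpos_Ints_cases)
    moreover have "Gamma (x + \<alpha>) > 0" using assms by (intro Gamma_real_pos) simp
    ultimately have "ln (Gamma (x + \<alpha> + 1)) = ln (x + \<alpha>) + ln (Gamma (x + \<alpha>))"
      using assms by (metis add_pos_pos ln_mult_pos)
    then show ?thesis by (simp add: algebra_simps)
  qed
  also have "\<dots> = ln (Gamma (x + \<alpha>) * (x + \<alpha>) powr (1 - \<alpha>))"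
  proof -
    have "Gamma (x + \<alpha>) > 0" using assms by (intro Gamma_real_pos) simp
    then show ?thesis using assms by (subst ln_mult_pos) (auto simp: ln_powr)
  qed
  finally have "Gamma (x + 1) \<le> Gamma (x + \<alpha>) * (x + \<alpha>) powr (1 - \<alpha>)"
    using assms by (simp only: o_def) (subst (asm) ln_le_cancel_iff, auto intro!: Gamma_real_pos mult_pos_pos)
  moreover have "Gamma (x + 1) = x * Gamma x"
    using assms by (intro Gamma_plus1) (auto elim!: nonpos_Ints_cases)
  moreover have "Gamma (x + \<alpha>) > 0" using assms by (intro Gamma_real_pos) simp
  ultimately show ?thesis
    using \<open>x > 0\<close> by (simp only: divide_le_eq pos_divide_le_eq le_divide_eq if_True times_divide_eq_left times_divide_eq_right mult_ac)
qed

lemma Gamma_ratio_tendsto_0: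
  fixes \<alpha> :: real
  assumes "0 < \<alpha>" "\<alpha> < 1"
  shows "((\<lambda>x. Gamma x / Gamma (x + \<alpha>)) \<longlongrightarrow> 0) at_top"
proof (rule tendsto_sandwich)
  show "eventually (\<lambda>x. 0 \<le> Gamma x / Gamma (x + \<alpha>)) at_top"
    using eventually_gt_at_top[of 0]
    by eventually_elim (use assms in \<open>auto intro!: divide_nonneg_pos Gamma_real_pos less_imp_le\<close>)
  show "eventually (\<lambda>x. Gamma x / Gamma (x + \<alpha>) \<le> (x + \<alpha>) powr (1 - \<alpha>) / x) at_top"
    using eventually_gt_at_top[of 0] by eventually_elim (use assms in \<open>auto intro: Gamma_ratio_le\<close>)
  show "((\<lambda>x. (x + \<alpha>) powr (1 - \<alpha>) / x) \<longlongrightarrow> 0) at_top"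
    using assms by real_asymp
qed auto

section \<open>Fractional differentiation of power series in \<open>t powr \<beta>\<close>\<close>

locale frac_order =
  fixes \<alpha> \<gamma> \<beta> :: real
  assumes \<alpha>: "0 < \<alpha>" "\<alpha> < 1" and \<gamma>: "0 \<le> \<gamma>" and \<beta>_def: "\<beta> = \<alpha> + \<gamma>" and \<beta>_le: "\<beta> \<le> 1"
begin

lemma \<beta>_pos: "\<beta> > 0" using \<alpha> \<gamma> by (simp add: \<beta>_def)

lemma Gamma_pos: "Gamma (1 - \<alpha>) > 0" using \<alpha> by (intro Gamma_real_pos) auto

lemma DERIV_pws_powr:
  assumes "entire p" "t > 0"
  shows "((\<lambda>s. pws p (s powr \<beta>)) has_real_derivative \<beta> * t powr (\<beta> - 1) * pws (diffs p) (t powr \<beta>)) (at t)"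
  using assms by (auto intro!: derivative_eq_intros has_real_derivative_powr simp: powr_diff)

lemma continuous_on_pws_powr: "entire p \<Longrightarrow> continuous_on {0..t} (\<lambda>s. pws p (s powr \<beta>))"
  using \<beta>_pos by (intro continuous_on_pws continuous_on_powr' continuous_on_id continuous_on_const) auto

text \<open>The fractional derivative lowers \<open>t powr (\<beta> * (n + 1))\<close> to
  \<open>t powr (\<beta> * n + \<gamma>)\<close>, and its factor \<open>t powr (- \<gamma>)\<close>
  removes the excess. On series in \<open>t powr \<beta>\<close> it is therefore a weighted shift of
  coefficients, recorded here.\<close>

definition caputo_coeff :: "(nat \<Rightarrow> real) \<Rightarrow> nat \<Rightarrow> real" where
  "caputo_coeff p n = p (Suc n) * Gamma (1 + \<beta> * real (Suc n)) / Gamma (1 + \<beta> * real n + \<gamma>)"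

text \<open>Each power is a Beta integral, and dominated convergence permits termwise integration:
  \<open>K 0\<close> carries the singularities at both ends, and the remaining factor is bounded on
  \<open>{0..t}\<close>.\<close>

lemma caputo_pws:
  assumes p: "entire p" and t: "t > 0"
  defines "I \<equiv> Gamma (1 - \<alpha>) * t powr \<gamma> * pws (caputo_coeff p) (t powr \<beta>)"
  shows "((\<lambda>s. (\<beta> * s powr (\<beta> - 1) * pws (diffs p) (s powr \<beta>)) / (t - s) powr \<alpha>) has_integral I) {0..t}"
proof -
  note \<beta>_pos [simp]
  define K where "K n s = s powr (\<beta> * real (Suc n) - 1) * (t - s) powr (1 - \<alpha> - 1)" for n s
  define c where "c n = p (Suc n) * (\<beta> * real (Suc n))" for n
  \<comment> \<open>The absolute series at the right endpoint; by monotonicity in \<open>s\<close>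
    it bounds the regular factor of all partial sums.\<close>
  define M where "M = (\<Sum>n. \<beta> * (\<bar>diffs p n\<bar> * \<bar>t powr \<beta>\<bar> ^ n))"
  have dp: "entire (diffs p)" using p by (rule entire_diffs)
  have sumM: "summable (\<lambda>n. \<beta> * (\<bar>diffs p n\<bar> * \<bar>t powr \<beta>\<bar> ^ n))"
    by (intro summable_mult entire_abs_summable dp)
  have K: "(K n has_integral t powr (\<beta> * real (Suc n) + (1 - \<alpha>) - 1) * Beta (\<beta> * real (Suc n)) (1 - \<alpha>)) {0..t}" for n
    unfolding K_def using \<alpha> t by (intro has_integral_Beta_scaled) auto
  \<comment> \<open>At \<open>s = 0\<close> both sides vanish, since \<open>0 powr x = 0\<close> for
    every exponent.\<close>
  have K_eq: "c n * K n s = \<beta> * (diffs p n * (s powr \<beta>) ^ n) * (s powr (\<beta> - 1) * (t - s) powr (1 - \<alpha> - 1))"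
    if "0 \<le> s" for n s
  proof (cases "s = 0")
    case False
    then have "s powr (\<beta> * real (Suc n) - 1) = (s powr \<beta>) ^ n * s powr (\<beta> - 1)"
      using that by (simp add: powr_realpow[symmetric] powr_powr powr_add[symmetric] algebra_simps)
    then show ?thesis by (simp add: K_def c_def diffs_def)
  qed (simp add: K_def)
  define f where "f k s = (\<Sum>n<k. c n * K n s)" for k s
  have f_int: "(f k has_integral (\<Sum>n<k. c n * (t powr (\<beta> * real (Suc n) + (1 - \<alpha>) - 1) * Beta (\<beta> * real (Suc n)) (1 - \<alpha>)))) {0..t}" for k
    unfolding f_def by (intro has_integral_sum has_integral_mult_right K) auto
  define g where "g s = (\<beta> * s powr (\<beta> - 1) * pws (diffs p) (s powr \<beta>)) / (t - s) powr \<alpha>" for s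
  have f_integrable: "f k integrable_on {0..t}" for k using f_int by (rule has_integral_integrable)
  have h_integrable: "(\<lambda>s. M * K 0 s) integrable_on {0..t}"
    using K[of 0] by (intro integrable_on_mult_right has_integral_integrable)
  have f_le: "norm (f k s) \<le> M * K 0 s" if s: "s \<in> {0..t}" for k s
  proof -
    from s have s0: "0 \<le> s" by simp
    have "norm (f k s) \<le> (\<Sum>n<k. \<beta> * (\<bar>diffs p n\<bar> * \<bar>t powr \<beta>\<bar> ^ n) * K 0 s)"
      unfolding f_def
    proof (rule order_trans[OF norm_sum], rule sum_mono)
      fix n
      have "norm (c n * K n s) = \<beta> * (\<bar>diffs p n\<bar> * (s powr \<beta>) ^ n) * K 0 s"
        using s unfolding K_eq[OF s0] by (simp add: abs_mult K_def abs_of_pos[OF \<beta>_pos])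
      also have "\<dots> \<le> \<beta> * (\<bar>diffs p n\<bar> * \<bar>t powr \<beta>\<bar> ^ n) * K 0 s"
        using s by (intro mult_right_mono mult_left_mono power_mono) (auto simp: powr_mono2 K_def less_imp_le)
      finally show "norm (c n * K n s) \<le> \<beta> * (\<bar>diffs p n\<bar> * \<bar>t powr \<beta>\<bar> ^ n) * K 0 s" .
    qed
    also have "\<dots> \<le> M * K 0 s"
      unfolding sum_distrib_right[symmetric] M_def
      by (intro mult_right_mono sum_le_suminf sumM) (auto simp: K_def less_imp_le)
    finally show "norm (f k s) \<le> M * K 0 s" .
  qed
  have f_lim: "(\<lambda>k. f k s) \<longlonglongrightarrow> g s" if s: "s \<in> {0..t}" for s
  proof -
    have "(\<lambda>n. \<beta> * (diffs p n * (s powr \<beta>) ^ n) * (s powr (\<beta> - 1) * (t - s) powr (1 - \<alpha> - 1))) sums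
       (\<beta> * pws (diffs p) (s powr \<beta>) * (s powr (\<beta> - 1) * (t - s) powr (1 - \<alpha> - 1)))"
      using dp unfolding entire_def pws_def by (intro sums_mult sums_mult2 summable_sums) blast
    also have "\<beta> * pws (diffs p) (s powr \<beta>) * (s powr (\<beta> - 1) * (t - s) powr (1 - \<alpha> - 1)) = g s"
      by (simp add: g_def powr_minus divide_inverse)
    finally show "(\<lambda>k. f k s) \<longlonglongrightarrow> g s"
      using s unfolding f_def sums_def by (simp add: K_eq)
  qed
  note conv = dominated_convergence[OF f_integrable h_integrable f_le f_lim]
  \<comment> \<open>The factor \<open>\<beta> * (n + 1)\<close> left over from differentiation turns
    the Gamma value in the Beta function into its successor.\<close>
  have coeff: "c n * (t powr (\<beta> * real (Suc n) + (1 - \<alpha>) - 1) * Beta (\<beta> * real (Suc n)) (1 - \<alpha>)) =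
      Gamma (1 - \<alpha>) * t powr \<gamma> * (caputo_coeff p n * (t powr \<beta>) ^ n)" for n
  proof -
    have "\<beta> * real (Suc n) \<notin> \<int>\<^sub>\<le>\<^sub>0"
      using \<beta>_pos by (metis mult_pos_pos nonpos_Ints_nonpos not_less of_nat_0_less_iff zero_less_Suc)
    then have g: "\<beta> * real (Suc n) * Gamma (\<beta> * real (Suc n)) = Gamma (1 + \<beta> * real (Suc n))"
      by (simp add: Gamma_plus1 add.commute[of 1])
    have e: "\<beta> * real (Suc n) + (1 - \<alpha>) = 1 + \<beta> * real n + \<gamma>"
      by (simp add: \<beta>_def algebra_simps)
    have "\<beta> * real (Suc n) * Beta (\<beta> * real (Suc n)) (1 - \<alpha>) =
      Gamma (1 + \<beta> * real (Suc n)) * Gamma (1 - \<alpha>) / Gamma (1 + \<beta> * real n + \<gamma>)"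
      by (simp only: Beta_def e times_divide_eq_right mult.assoc[symmetric] g)
    moreover have "t powr (\<beta> * real (Suc n) + (1 - \<alpha>) - 1) = t powr \<gamma> * (t powr \<beta>) ^ n"
      using t by (simp add: powr_realpow[symmetric] powr_powr powr_add[symmetric] \<beta>_def algebra_simps)
    moreover have "c n * (t powr (\<beta> * real (Suc n) + (1 - \<alpha>) - 1) * Beta (\<beta> * real (Suc n)) (1 - \<alpha>)) =
      p (Suc n) * t powr (\<beta> * real (Suc n) + (1 - \<alpha>) - 1) * (\<beta> * real (Suc n) * Beta (\<beta> * real (Suc n)) (1 - \<alpha>))"
      by (simp only: c_def mult_ac)
    ultimately have "c n * (t powr (\<beta> * real (Suc n) + (1 - \<alpha>) - 1) * Beta (\<beta> * real (Suc n)) (1 - \<alpha>)) =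
      p (Suc n) * (t powr \<gamma> * (t powr \<beta>) ^ n) *
      (Gamma (1 + \<beta> * real (Suc n)) * Gamma (1 - \<alpha>) / Gamma (1 + \<beta> * real n + \<gamma>))"
      by (simp only:)
    then show ?thesis
      by (simp only: caputo_coeff_def) (simp only: times_divide_eq_left times_divide_eq_right mult_ac)
  qed
  have "(\<lambda>n. Gamma (1 - \<alpha>) * t powr \<gamma> * (caputo_coeff p n * (t powr \<beta>) ^ n)) sums integral {0..t} g"
    using conv(2) unfolding integral_unique[OF f_int] sums_def coeff .
  then have "(\<lambda>n. inverse (Gamma (1 - \<alpha>) * t powr \<gamma>) * (Gamma (1 - \<alpha>) * t powr \<gamma> * (caputo_coeff p n * (t powr \<beta>) ^ n)))
     sums (inverse (Gamma (1 - \<alpha>) * t powr \<gamma>) * integral {0..t} g)"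
    by (rule sums_mult)
  moreover have nz: "Gamma (1 - \<alpha>) * t powr \<gamma> \<noteq> 0"
    using t Gamma_pos by auto
  ultimately have "(\<lambda>n. caputo_coeff p n * (t powr \<beta>) ^ n) sums (inverse (Gamma (1 - \<alpha>) * t powr \<gamma>) * integral {0..t} g)"
    by (simp add: field_simps)
  then have "integral {0..t} g = I"
    using nz by (simp add: I_def pws_def sums_iff field_simps)
  then show ?thesis using conv(1) unfolding g_def by (metis integrable_integral)
qed

text \<open>The minimum principle. If the series became negative, its minimum on some
  \<open>{0..T}\<close> would lie below the initial value, so that the fractional derivative would
  be negative there, contrary to the sign required wherever the series is negative.\<close>

lemma pws_nonneg:
  assumes p: "entire p" and "p 0 \<ge> 0"
    and *: "\<And>x. x > 0 \<Longrightarrow> pws p x < 0 \<Longrightarrow> pws (caputo_coeff p) x \<ge> 0" and "x \<ge> 0"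
  shows "pws p x \<ge> 0"
proof (rule ccontr)
  assume "\<not> pws p x \<ge> 0"
  then have neg: "pws p x < 0" by simp
  define T where "T = x powr (1 / \<beta>)"
  define F where "F s = pws p (s powr \<beta>)" for s
  have "x > 0" using neg assms by (cases "x = 0") auto
  then have T: "T > 0" "F T < 0" using neg \<beta>_pos by (auto simp: T_def F_def powr_powr)
  have "continuous_on {0..T} F" unfolding F_def using p by (rule continuous_on_pws_powr)
  then obtain t where t: "t \<in> {0..T}" "\<And>s. s \<in> {0..T} \<Longrightarrow> F t \<le> F s"
    using continuous_attains_inf[of "{0..T}" F] T by auto
  have Ft: "F t < 0" using t(2)[of T] T by auto
  have F0: "F 0 \<ge> 0" using assms \<beta>_pos by (simp add: F_def)
  have "t > 0" using t Ft F0 by (cases "t = 0") auto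
  have "Gamma (1 - \<alpha>) * t powr \<gamma> * pws (caputo_coeff p) (t powr \<beta>) < 0"
  proof (rule caputo_at_minimum[OF \<alpha> \<open>t > 0\<close>])
    show "continuous_on {0..t} F" unfolding F_def using p by (rule continuous_on_pws_powr)
    show "(F has_real_derivative \<beta> * s powr (\<beta> - 1) * pws (diffs p) (s powr \<beta>)) (at s)" if "0 < s" for s
      unfolding F_def by (rule DERIV_pws_powr[OF p that])
    show "((\<lambda>s. \<beta> * s powr (\<beta> - 1) * pws (diffs p) (s powr \<beta>) / (t - s) powr \<alpha>) has_integral
     Gamma (1 - \<alpha>) * t powr \<gamma> * pws (caputo_coeff p) (t powr \<beta>)) {0..t}"
      by (rule caputo_pws[OF p \<open>t > 0\<close>])
  qed (use t Ft F0 in auto)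
  moreover have "pws (caputo_coeff p) (t powr \<beta>) \<ge> 0"
    using *[of "t powr \<beta>"] Ft \<open>t > 0\<close> by (auto simp: F_def)
  ultimately show False
    using Gamma_pos by (auto simp: mult_less_0_iff)
qed

section \<open>The coefficients of the Kilbas-Saigo function\<close>

text \<open>The sign is absorbed into the coefficients so that the argument stays nonnegative; for
  \<open>m = 1 + \<gamma> / \<alpha>\<close> and \<open>l = \<gamma> / \<alpha>\<close> the Gamma
  arguments simplify to these.\<close>

definition ks_coeff :: "nat \<Rightarrow> real" where
  "ks_coeff n = (-1) ^ n * (\<Prod>k<n. Gamma (1 + \<beta> * real k + \<gamma>) / Gamma (1 + \<beta> * real (Suc k)))"

lemma ks_coeff_Suc:
  "ks_coeff (Suc n) = - ks_coeff n * (Gamma (1 + \<beta> * real n + \<gamma>) / Gamma (1 + \<beta> * real (Suc n)))"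
  by (simp add: ks_coeff_def del: of_nat_Suc)

lemma kilbas_saigo_eq: "kilbas_saigo \<alpha> (1 + \<gamma> / \<alpha>) (\<gamma> / \<alpha>) (- x) = pws ks_coeff x"
proof -
  have "\<alpha> * (real k * (1 + \<gamma> / \<alpha>) + \<gamma> / \<alpha>) = \<beta> * real k + \<gamma>"
    "\<alpha> * (real k * (1 + \<gamma> / \<alpha>) + \<gamma> / \<alpha> + 1) = \<beta> * real (Suc k)" for k
    using \<alpha> by (simp_all add: \<beta>_def field_simps)
  then show ?thesis
    unfolding kilbas_saigo_def pws_def ks_coeff_def
    by (simp add: power_minus[of x] add.assoc mult_ac del: of_nat_Suc)
qed

text \<open>Ratio test: consecutive coefficients have the ratio
  \<open>Gamma y / Gamma (y + \<alpha>)\<close> up to sign, with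
  \<open>y = 1 + \<beta> * n + \<gamma>\<close>, and this tends to 0.\<close>

lemma entire_ks: "entire ks_coeff"
  unfolding entire_def
proof
  fix x :: real
  define r where "r n = Gamma (1 + \<beta> * real n + \<gamma>) / Gamma (1 + \<beta> * real n + \<gamma> + \<alpha>)" for n
  have pos: "1 + \<beta> * real n + \<gamma> > 0" for n
    using \<beta>_pos \<gamma> by (intro add_pos_nonneg) (auto simp: less_imp_le)
  have "filterlim (\<lambda>n. 1 + \<beta> * real n + \<gamma>) at_top sequentially"
    using \<beta>_pos by real_asymp
  from filterlim_compose[OF Gamma_ratio_tendsto_0[OF \<alpha>] this]
  have "r \<longlonglongrightarrow> 0" unfolding r_def .
  then have "(\<lambda>n. r n * \<bar>x\<bar>) \<longlonglongrightarrow> 0" by (rule tendsto_mult_left_zero)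
  then have "eventually (\<lambda>n. r n * \<bar>x\<bar> < 1 / 2) sequentially"
    by (rule order_tendstoD) simp
  then obtain N where N: "\<And>n. n \<ge> N \<Longrightarrow> r n * \<bar>x\<bar> < 1 / 2"
    by (auto simp: eventually_sequentially)
  show "summable (\<lambda>n. ks_coeff n * x ^ n)"
  proof (rule summable_ratio_test[where c = "1/2" and N = N])
    fix n assume n: "n \<ge> N"
    have "1 + \<beta> * real (Suc n) = 1 + \<beta> * real n + \<gamma> + \<alpha>" by (simp add: \<beta>_def algebra_simps)
    then have "ks_coeff (Suc n) = - ks_coeff n * r n"
      by (simp only: ks_coeff_Suc r_def)
    moreover have "r n \<ge> 0" unfolding r_def using pos[of n] \<alpha>
      by (intro divide_nonneg_nonneg less_imp_le[OF Gamma_real_pos]) auto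
    ultimately have "norm (ks_coeff (Suc n) * x ^ Suc n) = (r n * \<bar>x\<bar>) * norm (ks_coeff n * x ^ n)"
      by (simp add: abs_mult power_abs)
    also have "\<dots> \<le> 1 / 2 * norm (ks_coeff n * x ^ n)"
      using N[OF n] by (intro mult_right_mono) auto
    finally show "norm (ks_coeff (Suc n) * x ^ Suc n) \<le> 1 / 2 * norm (ks_coeff n * x ^ n)" .
  qed simp
qed

text \<open>The Gamma quotients cancel, so that a multiplier \<open>d\<close> is merely shifted and
  negated. For constant \<open>d\<close> this is the eigenvalue equation.\<close>

lemma caputo_coeff_ks:
  "caputo_coeff (\<lambda>n. d n * ks_coeff n) n = - d (Suc n) * ks_coeff n"
proof -
  have "1 + \<beta> * real n + \<gamma> > 0" "1 + \<beta> * real (Suc n) > 0"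
    using \<beta>_pos \<gamma> by (auto intro!: add_pos_nonneg simp: less_imp_le)
  then have "Gamma (1 + \<beta> * real n + \<gamma>) > 0" "Gamma (1 + \<beta> * real (Suc n)) > 0"
    by (auto intro: Gamma_real_pos)
  then show ?thesis
    unfolding caputo_coeff_def ks_coeff_Suc by (simp add: divide_simps del: of_nat_Suc)
qed

text \<open>For \<open>f t = E (t\<^sup>\<beta>)\<close> one has \<open>\<psi> (t\<^sup>\<beta>) = t f' t\<close> and \<open>\<eta> (t\<^sup>\<beta>) = t\<^sup>2 f'' t\<close>.\<close>

definition E :: "real \<Rightarrow> real" where "E = pws ks_coeff"
definition \<psi> :: "real \<Rightarrow> real" where "\<psi> = pws (\<lambda>n. \<beta> * real n * ks_coeff n)"
definition \<eta> :: "real \<Rightarrow> real" where "\<eta> = pws (\<lambda>n. \<beta> * real n * (\<beta> * real n - 1) * ks_coeff n)"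

lemma ks_0 [simp]: "ks_coeff 0 = 1" by (simp add: ks_coeff_def)

lemma E_0 [simp]: "E 0 = 1" by (simp add: E_def)

lemma entire_ks_theta: "entire (\<lambda>n. \<beta> * real n * ks_coeff n)"
  "entire (\<lambda>n. (\<beta> * real n)\<^sup>2 * ks_coeff n)"
  "entire (\<lambda>n. \<beta> * real n * (\<beta> * real n - 1) * ks_coeff n)"
proof -
  show 1: "entire (\<lambda>n. \<beta> * real n * ks_coeff n)"
    using entire_cmult[OF entire_times_nat[OF entire_ks], of \<beta>] by (simp add: mult.assoc)
  show 2: "entire (\<lambda>n. (\<beta> * real n)\<^sup>2 * ks_coeff n)"
    using entire_cmult[OF entire_times_nat[OF 1], of \<beta>] by (simp add: power2_eq_square mult_ac)
  show "entire (\<lambda>n. \<beta> * real n * (\<beta> * real n - 1) * ks_coeff n)"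
    using entire_add[OF 2 entire_cmult[OF 1, of "-1"]] by (simp add: power2_eq_square algebra_simps)
qed

section \<open>Signs of the Kilbas-Saigo function and of its derivatives\<close>

text \<open>Minimum principle: the fractional derivative is \<open>- E\<close>, which is positive
  wherever \<open>E\<close> is negative.\<close>

lemma E_nonneg: "x \<ge> 0 \<Longrightarrow> E x \<ge> 0"
proof -
  assume x: "x \<ge> 0"
  have "caputo_coeff ks_coeff = (\<lambda>n. - 1 * ks_coeff n)"
    using caputo_coeff_ks[of "\<lambda>_. 1"] by (simp add: fun_eq_iff)
  then have c: "pws (caputo_coeff ks_coeff) y = - pws ks_coeff y" for y
    by (simp only: pws_cmult[OF entire_ks])
  show ?thesis
    unfolding E_def
  proof (rule pws_nonneg[OF entire_ks])
    show "pws (caputo_coeff ks_coeff) y \<ge> 0" if "pws ks_coeff y < 0" for y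
      unfolding c using that by simp
  qed (use x in auto)
qed

text \<open>Minimum principle for \<open>p\<close>, which represents \<open>- \<psi>\<close>: its
  fractional derivative is \<open>- p + \<beta> * E\<close>, and \<open>E\<close> is
  nonnegative.\<close>

lemma \<psi>_nonpos: "x \<ge> 0 \<Longrightarrow> \<psi> x \<le> 0"
proof -
  assume x: "x \<ge> 0"
  define p where "p n = - 1 * (\<beta> * real n * ks_coeff n)" for n
  have p: "entire p" unfolding p_def by (intro entire_cmult entire_ks_theta)
  have pp: "pws p x = - \<psi> x" for x
    unfolding p_def \<psi>_def pws_cmult[OF entire_ks_theta(1)] by simp
  have "caputo_coeff p = (\<lambda>n. - 1 * p n + \<beta> * ks_coeff n)"
  proof
    have "p = (\<lambda>n. - \<beta> * real n * ks_coeff n)" by (simp add: p_def fun_eq_iff)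
    then have "caputo_coeff p n = - (- \<beta> * real (Suc n)) * ks_coeff n" for n
      by (simp only: caputo_coeff_ks)
    then show "caputo_coeff p n = - 1 * p n + \<beta> * ks_coeff n" for n
      by (simp add: p_def algebra_simps)
  qed
  then have cp: "pws (caputo_coeff p) x = - pws p x + \<beta> * E x" for x
    by (simp only: pws_add[OF entire_cmult[OF p] entire_cmult[OF entire_ks]] pws_cmult[OF entire_ks] pws_cmult[OF p] E_def)
  have "pws p x \<ge> 0"
  proof (rule pws_nonneg[OF p])
    fix y :: real assume "y > 0" "pws p y < 0"
    then show "pws (caputo_coeff p) y \<ge> 0"
      unfolding cp using E_nonneg[of y] \<beta>_pos by (intro add_nonneg_nonneg mult_nonneg_nonneg) auto
  qed (use x in \<open>auto simp: p_def\<close>)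
  then show ?thesis unfolding pp by simp
qed

text \<open>Minimum principle again: the fractional derivative is \<open>- \<eta> - 2 * \<beta> *
  \<psi> + \<beta> * (1 - \<beta>) * E\<close>, whose last two terms are nonnegative by the signs
  already known and \<open>\<beta> \<le> 1\<close>.\<close>

lemma \<eta>_nonneg: "x \<ge> 0 \<Longrightarrow> \<eta> x \<ge> 0"
proof -
  assume x: "x \<ge> 0"
  define p where "p n = \<beta> * real n * (\<beta> * real n - 1) * ks_coeff n" for n
  have p: "entire p" unfolding p_def by (intro entire_ks_theta)
  have pp: "pws p = \<eta>" unfolding p_def \<eta>_def ..
  have "caputo_coeff p = (\<lambda>n. (- 1 * p n + (- 2 * \<beta>) * (\<beta> * real n * ks_coeff n)) + (\<beta> * (1 - \<beta>)) * ks_coeff n)"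
  proof
    have "caputo_coeff p n = - (\<beta> * real (Suc n) * (\<beta> * real (Suc n) - 1)) * ks_coeff n" for n
      unfolding p_def by (simp only: caputo_coeff_ks)
    then show "caputo_coeff p n = (- 1 * p n + (- 2 * \<beta>) * (\<beta> * real n * ks_coeff n)) + (\<beta> * (1 - \<beta>)) * ks_coeff n" for n
      by (simp add: p_def algebra_simps)
  qed
  then have cp: "pws (caputo_coeff p) x = (- pws p x + (- 2 * \<beta>) * \<psi> x) + (\<beta> * (1 - \<beta>)) * E x" for x
    by (simp only: pws_add[OF entire_add[OF entire_cmult[OF p] entire_cmult[OF entire_ks_theta(1)]] entire_cmult[OF entire_ks]]
        pws_add[OF entire_cmult[OF p] entire_cmult[OF entire_ks_theta(1)]]
        pws_cmult[OF entire_ks] pws_cmult[OF p] pws_cmult[OF entire_ks_theta(1)] E_def \<psi>_def)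
  have "pws p x \<ge> 0"
  proof (rule pws_nonneg[OF p])
    fix y :: real assume y: "y > 0" "pws p y < 0"
    have "- 2 * \<beta> * \<psi> y \<ge> 0" using \<psi>_nonpos[of y] y \<beta>_pos by (intro mult_nonpos_nonpos) auto
    moreover have "\<beta> * (1 - \<beta>) * E y \<ge> 0"
      using E_nonneg[of y] y \<beta>_pos \<beta>_le by (intro mult_nonneg_nonneg) auto
    ultimately show "pws (caputo_coeff p) y \<ge> 0"
      unfolding cp using y by linarith
  qed (use x in \<open>auto simp: p_def\<close>)
  then show ?thesis unfolding pp .
qed

section \<open>Monotonicity, convexity and decay\<close>

definition f :: "real \<Rightarrow> real" where "f t = E (t powr \<beta>)"
definition f' :: "real \<Rightarrow> real" where "f' t = \<psi> (t powr \<beta>) / t"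

lemma f'_eq: "t > 0 \<Longrightarrow> f' t = \<beta> * t powr (\<beta> - 1) * pws (diffs ks_coeff) (t powr \<beta>)"
  using pws_cmult[OF entire_times_nat[OF entire_ks], of \<beta> "t powr \<beta>"]
  by (simp add: f'_def \<psi>_def pws_times_nat[OF entire_ks] powr_diff mult.assoc)

lemma DERIV_f: "t > 0 \<Longrightarrow> (f has_real_derivative f' t) (at t)"
  using DERIV_pws_powr[OF entire_ks, of t] f'_eq[of t] by (simp add: f_def[abs_def] E_def)

lemma f'_nonpos: "t > 0 \<Longrightarrow> f' t \<le> 0"
  using \<psi>_nonpos[of "t powr \<beta>"] by (simp add: f'_def divide_nonpos_pos)

lemma continuous_on_f: "continuous_on {0..t} f"
  using continuous_on_pws_powr[OF entire_ks] by (simp add: f_def[abs_def] E_def)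

lemma f_antimono: "0 \<le> s \<Longrightarrow> s \<le> t \<Longrightarrow> f t \<le> f s"
proof (rule DERIV_nonpos_imp_decreasing_open[of s t])
  assume "0 \<le> s"
  then show "\<exists>y. (f has_real_derivative y) (at x) \<and> y \<le> 0" if "s < x" for x
    using DERIV_f[of x] f'_nonpos[of x] that by auto
  show "continuous_on {s..t} f"
    using \<open>0 \<le> s\<close> by (auto intro: continuous_on_subset[OF continuous_on_f[of t]])
qed

lemma f_0 [simp]: "f 0 = 1" using \<beta>_pos by (simp add: f_def)

lemma f_bounds: "t \<ge> 0 \<Longrightarrow> 0 \<le> f t \<and> f t \<le> 1"
  using f_antimono[of 0 t] E_nonneg[of "t powr \<beta>"] by (simp add: f_def)

text \<open>Convexity of \<open>f\<close>. The derivative of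
  \<open>\<psi> (t powr \<beta>) / t\<close> is \<open>\<eta> (t powr \<beta>) / t^2\<close>,
  because the multipliers satisfy \<open>(\<beta> * n)^2 = \<beta> * n * (\<beta> * n - 1) + \<beta>
  * n\<close>.\<close>

lemma f'_mono: assumes "0 < s" "s \<le> t" shows "f' s \<le> f' t"
proof (rule DERIV_nonneg_imp_nondecreasing[OF assms(2)])
  fix x assume "s \<le> x" "x \<le> t"
  then have x: "x > 0" using assms by simp
  let ?p = "\<lambda>n. \<beta> * real n * ks_coeff n"
  have "(f' has_real_derivative
      ((\<beta> * x powr (\<beta> - 1) * pws (diffs ?p) (x powr \<beta>)) * x - \<psi> (x powr \<beta>)) / (x * x)) (at x)"
    using DERIV_divide[OF DERIV_pws_powr[OF entire_ks_theta(1) x] DERIV_ident] x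
    by (simp add: f'_def[abs_def] \<psi>_def)
  moreover have "(\<beta> * x powr (\<beta> - 1) * pws (diffs ?p) (x powr \<beta>)) * x - \<psi> (x powr \<beta>) = \<eta> (x powr \<beta>)"
  proof -
    have "(\<beta> * x powr (\<beta> - 1) * pws (diffs ?p) (x powr \<beta>)) * x = \<beta> * (x powr \<beta> * pws (diffs ?p) (x powr \<beta>))"
      using x by (simp add: powr_diff)
    also have "\<dots> = pws (\<lambda>n. (\<beta> * real n)\<^sup>2 * ks_coeff n) (x powr \<beta>)"
      unfolding pws_times_nat[OF entire_ks_theta(1), symmetric]
        pws_cmult[OF entire_times_nat[OF entire_ks_theta(1)], symmetric]
      by (simp add: power2_eq_square mult_ac)
    also have "\<dots> = pws (\<lambda>n. \<beta> * real n * (\<beta> * real n - 1) * ks_coeff n + ?p n) (x powr \<beta>)"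
      by (simp add: power2_eq_square algebra_simps)
    also have "\<dots> = \<eta> (x powr \<beta>) + \<psi> (x powr \<beta>)"
      unfolding \<eta>_def \<psi>_def by (rule pws_add[OF entire_ks_theta(3) entire_ks_theta(1)])
    finally show ?thesis by simp
  qed
  ultimately show "\<exists>y. (f' has_real_derivative y) (at x) \<and> 0 \<le> y"
    using \<eta>_nonneg[of "x powr \<beta>"] x by (intro exI[of _ "\<eta> (x powr \<beta>) / (x * x)"] conjI) auto
qed

text \<open>By convexity the slope at \<open>t\<close> is at least that of the secant over
  \<open>[s, t]\<close>, and \<open>f t\<close> is nonnegative; \<open>s = t / 2\<close> and
  \<open>s = 0\<close> give the two bounds.\<close>

lemma f'_bound:
  assumes t: "t > 0" shows "- t * f' t \<le> 2 * f (t / 2)" "- t * f' t \<le> 1"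
proof -
  have *: "- (t - s) * f' t \<le> f s" if s: "0 \<le> s" "s < t" for s
  proof -
    obtain z where z: "s < z" "z < t" "f t - f s = (t - s) * f' z"
    proof (rule mvt[of s t f "\<lambda>x y. y * f' x"])
      show "continuous_on {s..t} f" using s by (auto intro: continuous_on_subset[OF continuous_on_f])
      show "(f has_derivative (\<lambda>y. y * f' x)) (at x)" if "s < x" "x < t" for x
        using DERIV_f[of x] that s by (simp add: has_field_derivative_def mult_commute_abs)
    qed (use s in auto)
    have "f' z \<le> f' t" using z s by (intro f'_mono) auto
    then have "f t - f s \<le> (t - s) * f' t" unfolding z using s by (intro mult_left_mono) auto
    then show ?thesis using f_bounds[of t] t by linarith
  qed
  show "- t * f' t \<le> 2 * f (t / 2)" using *[of "t / 2"] t by simp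
  show "- t * f' t \<le> 1" using *[of 0] t by simp
qed

text \<open>The summands 2 and \<open>2 / (1 - \<alpha>)\<close> are the costs of the left and the
  right half of the time interval in \<open>f_decay\<close>.\<close>

definition decay_const :: real where "decay_const = (2 + 2 / (1 - \<alpha>)) / Gamma (1 - \<alpha>)"

lemma decay_const_pos: "decay_const > 0"
  unfolding decay_const_def using Gamma_pos \<alpha> by (intro divide_pos_pos add_pos_pos) auto

text \<open>The eigenvalue equation writes \<open>f t\<close> as an integral of \<open>- f'\<close>
  against the kernel. Left of \<open>t / 2\<close> the kernel is bounded and \<open>f\<close>
  decreases by at most 1; right of it \<open>- f' s \<le> 1 / s \<le> 2 / t\<close> and the kernel
  is integrable.\<close>

lemma f_decay: assumes t: "t > 0" shows "t powr \<beta> * f t \<le> decay_const"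
proof -
  let ?k = "\<lambda>s. (t - s) powr \<alpha>"
  have "caputo_coeff ks_coeff = (\<lambda>n. - 1 * ks_coeff n)"
    using caputo_coeff_ks[of "\<lambda>_. 1"] by (simp add: fun_eq_iff)
  then have "pws (caputo_coeff ks_coeff) (t powr \<beta>) = - f t"
    by (simp only: pws_cmult[OF entire_ks] f_def E_def)
  then have "((\<lambda>s. f' s / ?k s) has_integral Gamma (1 - \<alpha>) * t powr \<gamma> * (- f t)) {0<..<t}"
    using caputo_pws[OF entire_ks t] 
    by (subst has_integral_cong[where g = "\<lambda>s. \<beta> * s powr (\<beta> - 1) * pws (diffs ks_coeff) (s powr \<beta>) / ?k s"])
       (auto simp: f'_eq has_integral_Icc_iff_Ioo)
  from has_integral_neg[OF this]
  have 1: "((\<lambda>s. - (f' s / ?k s)) has_integral Gamma (1 - \<alpha>) * t powr \<gamma> * f t) {0<..<t}" by simp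
  have "((\<lambda>s. f' s) has_integral f t - f 0) {0..t}"
    using t by (intro fundamental_theorem_of_calculus_interior continuous_on_f)
      (auto simp: DERIV_f has_real_derivative_iff_has_vector_derivative[symmetric])
  moreover have "((\<lambda>s. s powr (1 - 1) * (t - s) powr (1 - \<alpha> - 1)) has_integral t powr (1 + (1 - \<alpha>) - 1) * Beta 1 (1 - \<alpha>)) {0..t}"
    using \<alpha> t by (intro has_integral_Beta_scaled) auto
  \<comment> \<open>The majorant adds the bounds for both halves; each summand is nonnegative, so on
    either half the other one may be kept.\<close>
  ultimately have 2: "((\<lambda>s. - ((t / 2) powr (- \<alpha>)) * f' s + 2 / t * (s powr (1 - 1) * (t - s) powr (1 - \<alpha> - 1)))
     has_integral - ((t / 2) powr (- \<alpha>)) * (f t - f 0) + 2 / t * (t powr (1 + (1 - \<alpha>) - 1) * Beta 1 (1 - \<alpha>))) {0<..<t}"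
    unfolding has_integral_Icc_iff_Ioo by (intro has_integral_add has_integral_mult_right)
  have Beta: "Beta 1 (1 - \<alpha>) = 1 / (1 - \<alpha>)"
  proof -
    have "Gamma ((1 - \<alpha>) + 1) = (1 - \<alpha>) * Gamma (1 - \<alpha>)"
      using \<alpha> by (intro Gamma_plus1) (auto elim!: nonpos_Ints_cases)
    then have "Beta 1 (1 - \<alpha>) = Gamma (1 - \<alpha>) / ((1 - \<alpha>) * Gamma (1 - \<alpha>))"
      by (simp add: Beta_def add.commute)
    then show ?thesis using Gamma_pos by simp
  qed
  have "Gamma (1 - \<alpha>) * t powr \<gamma> * f t \<le>
     - ((t / 2) powr (- \<alpha>)) * (f t - f 0) + 2 / t * (t powr (1 + (1 - \<alpha>) - 1) * Beta 1 (1 - \<alpha>))"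
  proof (rule has_integral_le[OF 1 2])
    fix s assume s: "s \<in> {0<..<t}"
    have k: "- (f' s / ?k s) = - f' s * (t - s) powr (- \<alpha>)"
      by (simp add: powr_minus divide_inverse)
    show "- (f' s / ?k s) \<le> - ((t / 2) powr (- \<alpha>)) * f' s + 2 / t * (s powr (1 - 1) * (t - s) powr (1 - \<alpha> - 1))"
    proof (cases "s \<le> t / 2")
      case True
      have "(t - s) powr (- \<alpha>) \<le> (t / 2) powr (- \<alpha>)"
        using True s \<alpha> by (intro powr_mono2') auto
      then have "- f' s * (t - s) powr (- \<alpha>) \<le> - f' s * (t / 2) powr (- \<alpha>)"
        using f'_nonpos[of s] s by (intro mult_left_mono) auto
      also have "\<dots> = - ((t / 2) powr (- \<alpha>)) * f' s" by simp
      finally have "- f' s * (t - s) powr (- \<alpha>) \<le> - ((t / 2) powr (- \<alpha>)) * f' s" .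
      moreover have "2 / t * (s powr (1 - 1) * (t - s) powr (1 - \<alpha> - 1)) \<ge> 0" using t by simp
      ultimately show ?thesis unfolding k by linarith
    next
      case False
      have "- (s * f' s) \<le> 1" using f'_bound(2)[of s] s by simp
      then have "- f' s \<le> 1 / s" using s by (simp add: field_simps)
      also have "1 / s \<le> 2 / t" using False s by (simp add: field_simps)
      finally have "- f' s * (t - s) powr (- \<alpha>) \<le> 2 / t * (t - s) powr (- \<alpha>)"
        by (intro mult_right_mono) auto
      moreover have "- ((t / 2) powr (- \<alpha>)) * f' s \<ge> 0"
        using f'_nonpos[of s] s by (intro mult_nonpos_nonpos) auto
      ultimately show ?thesis unfolding k using s by simp
    qed
  qed
  also have "\<dots> = (t / 2) powr (- \<alpha>) * (1 - f t) + 2 / (1 - \<alpha>) * t powr (- \<alpha>)"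
    using t by (simp add: Beta powr_diff powr_minus field_simps)
  also have "\<dots> \<le> 2 * t powr (- \<alpha>) + 2 / (1 - \<alpha>) * t powr (- \<alpha>)"
  proof -
    have "(t / 2) powr (- \<alpha>) = 2 powr \<alpha> * t powr (- \<alpha>)"
      using t by (simp add: powr_divide powr_minus field_simps)
    moreover have "2 powr \<alpha> \<le> 2 powr (1::real)" using \<alpha> by (intro powr_mono) auto
    ultimately have "(t / 2) powr (- \<alpha>) \<le> 2 * t powr (- \<alpha>)" by (auto intro: mult_right_mono)
    moreover have "(t / 2) powr (- \<alpha>) * (1 - f t) \<le> (t / 2) powr (- \<alpha>) * 1"
      using f_bounds[of t] t by (intro mult_left_mono) auto
    ultimately show ?thesis by simp
  qed
  finally have "Gamma (1 - \<alpha>) * (t powr \<gamma> * f t) \<le> (2 + 2 / (1 - \<alpha>)) * t powr (- \<alpha>)"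
    by (simp add: distrib_right mult.assoc)
  then have "t powr \<gamma> * f t \<le> decay_const * t powr (- \<alpha>)"
    unfolding decay_const_def using Gamma_pos by (simp add: field_simps)
  then have "t powr \<alpha> * (t powr \<gamma> * f t) \<le> t powr \<alpha> * (decay_const * t powr (- \<alpha>))"
    by (intro mult_left_mono) auto
  also have "t powr \<alpha> * (decay_const * t powr (- \<alpha>)) = decay_const" using t by (simp add: powr_minus)
  finally have *: "t powr \<alpha> * t powr \<gamma> * f t \<le> decay_const" by (simp only: mult.assoc)
  have "t powr \<beta> = t powr \<alpha> * t powr \<gamma>" by (simp add: \<beta>_def powr_add)
  then show ?thesis using * by simp
qed

lemma powr_root_\<beta>: "x \<ge> 0 \<Longrightarrow> (x powr (1 / \<beta>)) powr \<beta> = x"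
  using \<beta>_pos by (simp add: powr_powr)

lemma E_bounds: "x \<ge> 0 \<Longrightarrow> 0 \<le> E x \<and> E x \<le> 1"
  using f_bounds[of "x powr (1 / \<beta>)"] by (simp add: f_def powr_root_\<beta>)

lemma E_antimono:
  assumes "0 \<le> x" "x \<le> y" shows "E y \<le> E x"
proof -
  have "x powr (1 / \<beta>) \<le> y powr (1 / \<beta>)" using assms \<beta>_pos by (intro powr_mono2) auto
  from f_antimono[OF _ this] show ?thesis using assms by (simp add: f_def powr_root_\<beta>)
qed

lemma E_decay: "x \<ge> 0 \<Longrightarrow> x * E x \<le> decay_const"
  using f_decay[of "x powr (1 / \<beta>)"] decay_const_pos by (cases "x = 0") (auto simp: f_def powr_root_\<beta>)

definition dE :: "real \<Rightarrow> real" where "dE = pws (diffs ks_coeff)"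

lemma DERIV_E: "(E has_real_derivative dE x) (at x)"
  unfolding E_def dE_def by (rule DERIV_pws[OF entire_ks])

lemma continuous_on_E: "continuous_on A E"
  by (intro continuous_at_imp_continuous_on ballI DERIV_isCont[OF DERIV_E])

lemma continuous_on_dE: "continuous_on A dE"
  unfolding dE_def
  by (intro continuous_at_imp_continuous_on ballI DERIV_isCont[OF DERIV_pws] entire_diffs entire_ks)

definition deriv_decay_const :: real where "deriv_decay_const = 2 * 2 powr \<beta> * decay_const / \<beta>"

lemma deriv_decay_const_pos: "deriv_decay_const > 0" unfolding deriv_decay_const_def using decay_const_pos \<beta>_pos by simp

text \<open>In terms of \<open>t\<close> with \<open>t powr \<beta> = x\<close>, the bound
  \<open>- t * f' t \<le> 2 * f (t / 2)\<close> gains a second power of \<open>1 / x\<close> from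
  the decay of \<open>f\<close> at \<open>t / 2\<close>; halving the time costs the factor
  \<open>2 powr \<beta>\<close>.\<close>

lemma dE_decay: assumes x: "x > 0" shows "\<bar>dE x\<bar> \<le> deriv_decay_const / x\<^sup>2"
proof -
  define t where "t = x powr (1 / \<beta>)"
  have t: "t > 0" "t powr \<beta> = x" using x by (auto simp: t_def powr_root_\<beta>)
  have "t * f' t = \<beta> * x * dE x"
    using t unfolding f'_eq[OF t(1)] dE_def[symmetric] by (simp add: powr_diff)
  moreover have "\<bar>t * f' t\<bar> = - t * f' t"
    using f'_nonpos[OF t(1)] t by (simp add: abs_mult)
  ultimately have "\<beta> * x * \<bar>dE x\<bar> = - t * f' t" using \<beta>_pos x by (simp add: abs_mult)
  also have "\<dots> \<le> 2 * f (t / 2)" by (rule f'_bound[OF t(1)])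
  finally have "(t / 2) powr \<beta> * (\<beta> * x * \<bar>dE x\<bar>) \<le> 2 * ((t / 2) powr \<beta> * f (t / 2))"
    by (simp add: mult.left_commute[of 2] mult_left_mono)
  also have "\<dots> \<le> 2 * decay_const" using f_decay[of "t / 2"] t by simp
  finally have "x / 2 powr \<beta> * (\<beta> * x * \<bar>dE x\<bar>) \<le> 2 * decay_const"
    using t by (simp add: powr_divide)
  then show ?thesis using x \<beta>_pos by (simp add: deriv_decay_const_def field_simps power2_eq_square)
qed

section \<open>The relaxation functions\<close>

text \<open>The time mode for eigenvalue \<open>l\<close>. Placing \<open>l\<close> inside
  \<open>E\<close> includes \<open>l = 0\<close> and makes the monotonicity in \<open>l\<close>
  immediate.\<close>

definition relax :: "real \<Rightarrow> real \<Rightarrow> real" where "relax l t = E (l * t powr \<beta>)"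
definition relax' :: "real \<Rightarrow> real \<Rightarrow> real" where "relax' l t = dE (l * t powr \<beta>) * (l * (\<beta> * t powr (\<beta> - 1)))"

lemma DERIV_relax: "t > 0 \<Longrightarrow> (relax l has_real_derivative relax' l t) (at t)"
  unfolding relax_def[abs_def] relax'_def
  by (rule DERIV_chain2[OF DERIV_E]) (auto intro!: derivative_eq_intros has_real_derivative_powr)

lemma continuous_on_relax: "continuous_on {0..t} (relax l)"
  unfolding relax_def[abs_def] using \<beta>_pos
  by (intro continuous_on_compose2[OF continuous_on_E[of UNIV]] continuous_intros continuous_on_powr') auto

lemma continuous_on_relax': "s > 0 \<Longrightarrow> continuous_on {s..t} (relax' l)"
  unfolding relax'_def[abs_def]
  by (intro continuous_intros continuous_on_compose2[OF continuous_on_dE[of UNIV]]) auto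

lemma relax_bounds: "l \<ge> 0 \<Longrightarrow> 0 \<le> relax l t \<and> relax l t \<le> 1"
  unfolding relax_def by (rule E_bounds) simp

lemma relax_antimono: "0 \<le> l \<Longrightarrow> l \<le> l' \<Longrightarrow> relax l' t \<le> relax l t"
  unfolding relax_def by (intro E_antimono mult_right_mono) auto

lemma relax_decay: assumes "l > 0" "t > 0" shows "relax l t \<le> decay_const / (l * t powr \<beta>)"
  using E_decay[of "l * t powr \<beta>"] assms by (simp add: relax_def field_simps)

text \<open>The factor \<open>l\<close> from the chain rule cancels one of the two powers of
  \<open>1 / l\<close> in \<open>dE_decay\<close>.\<close>

lemma relax'_decay: assumes "l > 0" "t > 0" shows "\<bar>relax' l t\<bar> \<le> \<beta> * deriv_decay_const / (l * t powr (\<beta> + 1))"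
proof -
  have "\<bar>relax' l t\<bar> = \<bar>dE (l * t powr \<beta>)\<bar> * (l * (\<beta> * t powr (\<beta> - 1)))"
    using assms \<beta>_pos by (simp add: relax'_def abs_mult)
  also have "\<dots> \<le> deriv_decay_const / (l * t powr \<beta>)\<^sup>2 * (l * (\<beta> * t powr (\<beta> - 1)))"
    using assms \<beta>_pos by (intro mult_right_mono dE_decay) auto
  also have "\<dots> = \<beta> * deriv_decay_const / (l * t powr (\<beta> + 1))"
    using assms by (simp add: power2_eq_square powr_diff powr_add field_simps)
  finally show ?thesis .
qed

text \<open>Rescaling the argument by \<open>l\<close> multiplies the coefficients by
  \<open>l^n\<close>; the shift in \<open>caputo_coeff\<close> then releases one factor
  \<open>l\<close>.\<close>

lemma relax_eigen:
  assumes t: "t > 0"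
  shows "((\<lambda>s. relax' l s / (t - s) powr \<alpha>) has_integral - (Gamma (1 - \<alpha>) * t powr \<gamma> * (l * relax l t))) {0..t}"
proof -
  define p where "p n = l ^ n * ks_coeff n" for n
  have p_scale: "p = (\<lambda>n. ks_coeff n * l ^ n)" by (simp add: p_def fun_eq_iff mult.commute)
  have p: "entire p" unfolding p_scale by (rule entire_scale[OF entire_ks])
  have "diffs p = (\<lambda>n. l * (diffs ks_coeff n * l ^ n))"
    by (simp add: p_def fun_eq_iff diffs_def)
  then have 1: "pws (diffs p) x = l * dE (l * x)" for x
    by (simp only: pws_cmult[OF entire_scale[OF entire_diffs[OF entire_ks]]] pws_scale dE_def)
  have "caputo_coeff p = (\<lambda>n. - l * (ks_coeff n * l ^ n))"
    unfolding p_def[abs_def] by (simp add: caputo_coeff_ks fun_eq_iff)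
  then have 2: "pws (caputo_coeff p) x = - l * E (l * x)" for x
    by (simp only: pws_cmult[OF entire_scale[OF entire_ks]] pws_scale E_def)
  show ?thesis
    using caputo_pws[OF p t] unfolding 1 2 by (simp add: relax'_def relax_def mult_ac)
qed

lemma relax_0 [simp]: "relax l 0 = 1" using \<beta>_pos by (simp add: relax_def)

lemma kilbas_saigo_relax: "kilbas_saigo \<alpha> (1 + \<gamma> / \<alpha>) (\<gamma> / \<alpha>) (- l * t powr \<beta>) = relax l t"
  using kilbas_saigo_eq[of "l * t powr \<beta>"] by (simp add: relax_def E_def)

end

section \<open>Convergence and a priori estimates\<close>

text \<open>After summation by parts the block sums carry the weights \<open>c M\<close> and
  \<open>c n - c (Suc n)\<close>, which are nonnegative and add up to \<open>c N\<close>.\<close>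

lemma abel_bound:
  fixes c b :: "nat \<Rightarrow> real"
  assumes c: "\<And>n. c (Suc n) \<le> c n" "\<And>n. 0 \<le> c n" and NM: "N \<le> M"
    and b: "\<And>j. N \<le> j \<Longrightarrow> \<bar>\<Sum>n\<in>{N..<j}. b n\<bar> \<le> \<epsilon>"
  shows "\<bar>\<Sum>n\<in>{N..<M}. c n * b n\<bar> \<le> c N * \<epsilon>"
proof -
  define S where "S j = (\<Sum>n\<in>{N..<j}. b n)" for j
  have 1: "(\<Sum>n\<in>{N..<M}. c n * b n) = c M * S M + (\<Sum>n\<in>{N..<M}. (c n - c (Suc n)) * S (Suc n))"
    using NM by (induction rule: dec_induct) (auto simp: S_def algebra_simps)
  have 2: "c M + (\<Sum>n\<in>{N..<M}. c n - c (Suc n)) = c N"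
    using NM by (induction rule: dec_induct) auto
  have "\<bar>c M * S M\<bar> \<le> c M * \<epsilon>"
    using b[OF NM] c by (simp add: abs_mult S_def mult_left_mono)
  moreover have "\<bar>\<Sum>n\<in>{N..<M}. (c n - c (Suc n)) * S (Suc n)\<bar> \<le> (\<Sum>n\<in>{N..<M}. (c n - c (Suc n)) * \<epsilon>)"
    using c b by (intro order_trans[OF sum_abs] sum_mono)
      (auto simp: abs_mult S_def simp del: sum.op_ivl_Suc intro!: mult_left_mono)
  ultimately have "\<bar>\<Sum>n\<in>{N..<M}. c n * b n\<bar> \<le> c M * \<epsilon> + (\<Sum>n\<in>{N..<M}. (c n - c (Suc n)) * \<epsilon>)"
    unfolding 1 by linarith
  also have "\<dots> = c N * \<epsilon>"
    unfolding 2[symmetric] by (simp add: sum_distrib_right distrib_right)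
  finally show ?thesis .
qed

text \<open>The Cauchy criterion in terms of blocks; \<open>M\<close> is unrestricted because the
  block is empty for \<open>M \<le> N\<close>.\<close>

lemma uniformly_convergent_sum_iff:
  fixes f :: "nat \<Rightarrow> 'a \<Rightarrow> real"
  shows "uniformly_convergent_on X (\<lambda>N x. \<Sum>n<N. f n x) \<longleftrightarrow>
    (\<forall>\<epsilon>>0. \<exists>N0. \<forall>N\<ge>N0. \<forall>M. \<forall>x\<in>X. \<bar>\<Sum>n\<in>{N..<M}. f n x\<bar> < \<epsilon>)"
proof -
  have d: "dist (\<Sum>n<m. f n x) (\<Sum>n<k. f n x) = \<bar>\<Sum>n\<in>{min m k..<max m k}. f n x\<bar>" for m k x
  proof -
    have *: "(\<Sum>n<k. f n x) = (\<Sum>n<m. f n x) + (\<Sum>n\<in>{m..<k}. f n x)" if "m \<le> k" for m k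
      using that by (simp add: lessThan_atLeast0 sum.atLeastLessThan_concat)
    show ?thesis
      using *[of m k] *[of k m] by (cases "m \<le> k") (auto simp: dist_real_def min_def max_def)
  qed
  show ?thesis
    unfolding uniformly_convergent_eq_Cauchy uniformly_Cauchy_on_def d
  proof (intro iffI allI impI)
    fix \<epsilon> :: real
    assume "\<forall>e>0. \<exists>M. \<forall>x\<in>X. \<forall>m\<ge>M. \<forall>n\<ge>M. \<bar>\<Sum>n\<in>{min m n..<max m n}. f n x\<bar> < e" "\<epsilon> > 0"
    then obtain N0 where N0: "\<And>x m n. x \<in> X \<Longrightarrow> m \<ge> N0 \<Longrightarrow> n \<ge> N0 \<Longrightarrow> \<bar>\<Sum>n\<in>{min m n..<max m n}. f n x\<bar> < \<epsilon>"
      by meson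
    have "\<bar>\<Sum>n\<in>{N..<M}. f n x\<bar> < \<epsilon>" if "N \<ge> N0" "x \<in> X" for N M x
      using N0[OF that(2,1), of M] that \<open>\<epsilon> > 0\<close> by (cases "N \<le> M") (auto simp: min_def max_def)
    then show "\<exists>N0. \<forall>N\<ge>N0. \<forall>M. \<forall>x\<in>X. \<bar>\<Sum>n\<in>{N..<M}. f n x\<bar> < \<epsilon>" by blast
  next
    fix e :: real
    assume "\<forall>\<epsilon>>0. \<exists>N0. \<forall>N\<ge>N0. \<forall>M. \<forall>x\<in>X. \<bar>\<Sum>n\<in>{N..<M}. f n x\<bar> < \<epsilon>" "e > 0"
    then show "\<exists>M. \<forall>x\<in>X. \<forall>m\<ge>M. \<forall>n\<ge>M. \<bar>\<Sum>n\<in>{min m n..<max m n}. f n x\<bar> < e"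
      by (metis min.boundedI)
  qed
qed

section \<open>A bound for the fractional derivative\<close>

lemma integrable_kernel:
  fixes \<alpha> t :: real
  assumes "0 < \<alpha>" "\<alpha> < 1" "t > 0"
  shows "(\<lambda>s. (t - s) powr (- \<alpha>)) integrable_on {t/2..t}"
proof (rule integrable_on_subinterval)
  have "((\<lambda>s. s powr (1 - 1) * (t - s) powr (1 - \<alpha> - 1)) has_integral t powr (1 + (1 - \<alpha>) - 1) * Beta 1 (1 - \<alpha>)) {0..t}"
    using assms by (intro has_integral_Beta_scaled) auto
  \<comment> \<open>The Beta integrand contains \<open>s powr 0\<close>, which is 1 except at
    \<open>s = 0\<close>, where it is 0; hence the exceptional set.\<close>
  then show "(\<lambda>s. (t - s) powr (- \<alpha>)) integrable_on {0..t}"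
    by (rule integrable_spike[OF has_integral_integrable, where S = "{0}"]) auto
qed (use assms in auto)

text \<open>On the left half, the boundary terms and the increment of the kernel add up to
  \<open>2 * (t / 2) powr (- \<alpha>)\<close>; on the right half the kernel itself is
  integrated.\<close>

definition kernel_const :: "real \<Rightarrow> real \<Rightarrow> real" where
  "kernel_const \<alpha> t = 2 * (t / 2) powr (- \<alpha>) + integral {t/2..t} (\<lambda>s. (t - s) powr (- \<alpha>))"

lemma kernel_const_nonneg: "0 < \<alpha> \<Longrightarrow> \<alpha> < 1 \<Longrightarrow> t > 0 \<Longrightarrow> kernel_const \<alpha> t \<ge> 0"
  unfolding kernel_const_def by (intro add_nonneg_nonneg integral_nonneg integrable_kernel) auto

text \<open>On the left half of the interval \<open>F'\<close> is integrated by parts, so that only the size of \<open>F\<close>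
  enters there and no bound on \<open>F'\<close> near \<open>0\<close> is required.\<close>

lemma caputo_bound:
  fixes F F' :: "real \<Rightarrow> real"
  assumes \<alpha>: "0 < \<alpha>" "\<alpha> < 1" and t: "t > 0"
    and cont: "continuous_on {0..t/2} F" and cont': "continuous_on {t/2..t} F'"
    and deriv: "\<And>s. 0 < s \<Longrightarrow> s \<le> t \<Longrightarrow> (F has_real_derivative F' s) (at s)"
    and F: "\<And>s. 0 \<le> s \<Longrightarrow> s \<le> t / 2 \<Longrightarrow> \<bar>F s\<bar> \<le> \<epsilon>"
    and F': "\<And>s. t / 2 \<le> s \<Longrightarrow> s \<le> t \<Longrightarrow> \<bar>F' s\<bar> \<le> \<epsilon>"
  shows "(\<lambda>s. F' s / (t - s) powr \<alpha>) integrable_on {0..t}" (is "?k integrable_on _")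
    and "\<bar>integral {0..t} (\<lambda>s. F' s / (t - s) powr \<alpha>)\<bar> \<le> kernel_const \<alpha> t * \<epsilon>"
proof -
  define G where "G s = F s * (t - s) powr (- \<alpha>)" for s
  define J where "J s = F s * (\<alpha> * (t - s) powr (- \<alpha> - 1))" for s
  define w where "w s = \<alpha> * (t - s) powr (- \<alpha> - 1)" for s
  have GJ: "((\<lambda>s. F' s * (t - s) powr (- \<alpha>) + J s) has_integral (G (t / 2) - G 0)) {0..t/2}"
    unfolding G_def J_def
  proof (rule fundamental_theorem_of_calculus_interior)
    show "continuous_on {0..t/2} (\<lambda>s. F s * (t - s) powr - \<alpha>)"
      using t by (intro continuous_intros cont) auto
    show "((\<lambda>s. F s * (t - s) powr - \<alpha>) has_vector_derivative
       F' s * (t - s) powr - \<alpha> + F s * (\<alpha> * (t - s) powr (- \<alpha> - 1))) (at s)"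
      if "s \<in> {0<..<t/2}" for s
      using that unfolding has_real_derivative_iff_has_vector_derivative[symmetric]
      by (auto intro!: derivative_eq_intros deriv has_real_derivative_powr simp: powr_diff)
  qed (use t in auto)
  \<comment> \<open>\<open>w\<close> is the derivative of the kernel, so the bound for
    \<open>J\<close> is the kernel's increment, whose subtracted term cancels the bound for
    \<open>G 0\<close>.\<close>
  have w: "(w has_integral (t - t / 2) powr (- \<alpha>) - (t - 0) powr (- \<alpha>)) {0..t/2}"
    unfolding w_def
  proof (rule fundamental_theorem_of_calculus_interior)
    show "((\<lambda>s. (t - s) powr - \<alpha>) has_vector_derivative \<alpha> * (t - s) powr (- \<alpha> - 1)) (at s)"
      if "s \<in> {0<..<t/2}" for s
      using that unfolding has_real_derivative_iff_has_vector_derivative[symmetric]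
      by (auto intro!: derivative_eq_intros has_real_derivative_powr simp: powr_diff)
  qed (use t in \<open>auto intro!: continuous_intros\<close>)
  have J_int: "J integrable_on {0..t/2}"
    unfolding J_def using t by (intro integrable_continuous_interval continuous_intros cont) auto
  have J_le: "\<bar>integral {0..t/2} J\<bar> \<le> \<epsilon> * ((t - t / 2) powr (- \<alpha>) - (t - 0) powr (- \<alpha>))"
  proof -
    have "norm (integral {0..t/2} J) \<le> integral {0..t/2} (\<lambda>s. \<epsilon> * w s)"
    proof (rule integral_norm_bound_integral[OF J_int])
      show "(\<lambda>s. \<epsilon> * w s) integrable_on {0..t/2}"
        using w by (intro integrable_on_mult_right has_integral_integrable)
      show "norm (J s) \<le> \<epsilon> * w s" if "s \<in> {0..t/2}" for s
        using F[of s] that \<alpha> unfolding J_def w_def by (simp add: abs_mult mult_right_mono)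
    qed
    then show ?thesis using integral_unique[OF w] by simp
  qed
  have k_eq: "F' s / (t - s) powr \<alpha> = F' s * (t - s) powr (- \<alpha>)" for s
    by (simp add: powr_minus divide_inverse)
  have left: "(?k has_integral (G (t / 2) - G 0 - integral {0..t/2} J)) {0..t/2}"
    using has_integral_diff[OF GJ integrable_integral[OF J_int]] by (simp add: k_eq)
  have left_le: "\<bar>G (t / 2) - G 0 - integral {0..t/2} J\<bar> \<le> 2 * (t / 2) powr (- \<alpha>) * \<epsilon>"
  proof -
    have "\<bar>G (t / 2)\<bar> \<le> \<epsilon> * (t / 2) powr (- \<alpha>)" "\<bar>G 0\<bar> \<le> \<epsilon> * t powr (- \<alpha>)"
      using F[of 0] F[of "t / 2"] t by (auto simp: G_def abs_mult intro!: mult_right_mono)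
    then show ?thesis using J_le by (simp add: right_diff_distrib mult.commute)
  qed
  have "(\<lambda>s. F' s * (t - s) powr (- \<alpha>)) absolutely_integrable_on {t/2..t}"
  proof (rule absolutely_integrable_bounded_measurable_product_real)
    show "F' \<in> borel_measurable (lebesgue_on {t/2..t})"
      by (intro continuous_imp_measurable_on_sets_lebesgue cont') auto
    show "bounded (F' ` {t/2..t})"
      by (intro compact_imp_bounded compact_continuous_image cont') auto
    show "(\<lambda>s. (t - s) powr (- \<alpha>)) absolutely_integrable_on {t/2..t}"
      using integrable_kernel[OF \<alpha> t] by (intro nonnegative_absolutely_integrable_1) auto
  qed auto
  then have right: "?k integrable_on {t/2..t}"
    unfolding k_eq by (rule set_lebesgue_integral_eq_integral(1))
  have right_le: "\<bar>integral {t/2..t} ?k\<bar> \<le> integral {t/2..t} (\<lambda>s. (t - s) powr (- \<alpha>)) * \<epsilon>"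
  proof -
    have "norm (integral {t/2..t} ?k) \<le> integral {t/2..t} (\<lambda>s. (t - s) powr (- \<alpha>) * \<epsilon>)"
    proof (rule integral_norm_bound_integral[OF right])
      show "(\<lambda>s. (t - s) powr (- \<alpha>) * \<epsilon>) integrable_on {t/2..t}"
        by (intro integrable_on_mult_left integrable_kernel \<alpha> t)
      show "norm (?k s) \<le> (t - s) powr (- \<alpha>) * \<epsilon>" if "s \<in> {t/2..t}" for s
        using F'[of s] that unfolding k_eq by (simp add: abs_mult mult.commute[of _ \<epsilon>] mult_right_mono)
    qed
    then show ?thesis by simp
  qed
  have *: "(?k has_integral (G (t / 2) - G 0 - integral {0..t/2} J) + integral {t/2..t} ?k) {0..t}"
    using t by (intro has_integral_combine[OF _ _ left integrable_integral[OF right]]) auto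
  then show "?k integrable_on {0..t}" by (rule has_integral_integrable)
  show "\<bar>integral {0..t} ?k\<bar> \<le> kernel_const \<alpha> t * \<epsilon>"
    using left_le right_le unfolding integral_unique[OF *] kernel_const_def distrib_right by linarith
qed

section \<open>An a priori estimate for the generator\<close>

text \<open>The mean value theorem yields a point \<open>z\<close> with
  \<open>\<bar>u' z\<bar> \<le> 2 * \<epsilon> / (d - c)\<close>. Since
  \<open>(p u')' = m * (D u'' + \<mu> u')\<close> is at most \<open>mmax * \<epsilon>\<close>, the
  bound on \<open>p u'\<close> spreads from \<open>z\<close> to the whole interval; division by
  \<open>pmin\<close> finishes.\<close>

lemma sturm_liouville_deriv_bound:
  fixes u u' u'' p m D \<mu> :: "real \<Rightarrow> real"
  assumes cd: "c < d" and x: "x \<in> {c..d}"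
    and u: "\<And>y. y \<in> {c..d} \<Longrightarrow> (u has_real_derivative u' y) (at y)"
    and u': "\<And>y. y \<in> {c..d} \<Longrightarrow> (u' has_real_derivative u'' y) (at y)"
    and p: "\<And>y. y \<in> {c..d} \<Longrightarrow> (p has_real_derivative \<mu> y * m y) (at y)"
    and pD: "\<And>y. y \<in> {c..d} \<Longrightarrow> p y = D y * m y"
    and A: "\<And>y. y \<in> {c..d} \<Longrightarrow> \<bar>u y\<bar> \<le> \<epsilon>"
    and B: "\<And>y. y \<in> {c..d} \<Longrightarrow> \<bar>D y * u'' y + \<mu> y * u' y\<bar> \<le> \<epsilon>"
    and m: "\<And>y. y \<in> {c..d} \<Longrightarrow> \<bar>m y\<bar> \<le> mmax"
    and pmin: "0 < pmin" "\<And>y. y \<in> {c..d} \<Longrightarrow> pmin \<le> p y"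
    and pmax: "\<And>y. y \<in> {c..d} \<Longrightarrow> p y \<le> pmax"
  shows "\<bar>u' x\<bar> \<le> (2 * pmax / (d - c) + (d - c) * mmax) / pmin * \<epsilon>"
proof -
  have eps: "\<epsilon> \<ge> 0" using A[OF x] by linarith
  obtain z where z: "c < z" "z < d" "u d - u c = (d - c) * u' z"
    using MVT2[OF cd, of u u'] u by auto
  have "(d - c) * \<bar>u' z\<bar> \<le> 2 * \<epsilon>"
    using A[of c] A[of d] cd z(3) by (auto simp: abs_mult[symmetric])
  then have uz: "\<bar>u' z\<bar> \<le> 2 * \<epsilon> / (d - c)" using cd by (simp add: field_simps)
  define w where "w y = p y * u' y" for y
  have w: "(w has_real_derivative m y * (D y * u'' y + \<mu> y * u' y)) (at y)" if "y \<in> {c..d}" for y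
    using DERIV_mult[OF p[OF that] u'[OF that]] pD[OF that] unfolding w_def by (simp add: algebra_simps)
  have "norm (w x - w z) \<le> mmax * \<epsilon> * norm (x - z)"
  proof (rule field_differentiable_bound[of "{c..d}"])
    show "(w has_real_derivative m y * (D y * u'' y + \<mu> y * u' y)) (at y within {c..d})" if "y \<in> {c..d}" for y
      using w[OF that] by (rule has_field_derivative_at_within)
    show "norm (m y * (D y * u'' y + \<mu> y * u' y)) \<le> mmax * \<epsilon>" if "y \<in> {c..d}" for y
      unfolding norm_mult using m[OF that] B[OF that] by (intro mult_mono) auto
  qed (use x z in auto)
  also have "\<dots> \<le> mmax * \<epsilon> * (d - c)"
    using x z eps m[OF x] by (intro mult_left_mono mult_nonneg_nonneg) auto
  finally have "\<bar>w x\<bar> \<le> \<bar>w z\<bar> + mmax * \<epsilon> * (d - c)" by simp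
  moreover have "\<bar>w z\<bar> \<le> pmax * (2 * \<epsilon> / (d - c))"
  proof -
    have "z \<in> {c..d}" using z by simp
    then have "0 \<le> p z" "p z \<le> pmax" using pmin(1) pmin(2)[of z] pmax[of z] by auto
    then show ?thesis unfolding w_def abs_mult using uz by (intro mult_mono) auto
  qed
  moreover have "pmin * \<bar>u' x\<bar> \<le> \<bar>w x\<bar>"
    unfolding w_def abs_mult using pmin(2)[OF x] pmin(1) by (intro mult_right_mono) auto
  ultimately have "pmin * \<bar>u' x\<bar> \<le> pmax * (2 * \<epsilon> / (d - c)) + mmax * \<epsilon> * (d - c)" by linarith
  also have "\<dots> = (2 * pmax / (d - c) + (d - c) * mmax) * \<epsilon>" by (simp add: algebra_simps)
  finally show ?thesis using pmin(1) by (simp add: pos_le_divide_eq mult.commute)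
qed

section \<open>Bessel's inequality\<close>

definition weight :: "pearson \<Rightarrow> real \<Rightarrow> real" where
  "weight P x = indicator (state_space P) x * stat_density P x"

lemma weight_nonneg: "admissible P \<Longrightarrow> weight P x \<ge> 0"
  using stat_density_pos[of P x] by (auto simp: weight_def indicator_def less_imp_le)

lemma measurable_weight [measurable]: "admissible P \<Longrightarrow> weight P \<in> borel_measurable lborel"
  using borel_measurable_continuous_on_indicator[OF _ continuous_on_stat_density, of P] open_state_space[of P]
  by (simp add: weight_def[abs_def])

lemma fourier_coeff_weight:
  "fourier_coeff P h n = (LINT x|lborel. weight P x * (h x * orth_poly P n x))"
  unfolding fourier_coeff_def set_lebesgue_integral_def weight_def by (simp add: mult_ac)

lemma in_L2_weightD:
  assumes P: "admissible P" and h: "in_L2 P h"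
  shows "(\<lambda>x. indicator (state_space P) x * h x) \<in> borel_measurable lborel"
    and "integrable lborel (\<lambda>x. weight P x * (h x)\<^sup>2)"
  using h by (simp_all add: in_L2_def set_borel_measurable_def set_integrable_def weight_def mult_ac)

lemma in_L2_weightI:
  assumes "admissible P" "h \<in> borel_measurable lborel" "integrable lborel (\<lambda>x. weight P x * (h x)\<^sup>2)"
  shows "in_L2 P h"
  using assms open_state_space[of P]
  by (simp add: in_L2_def set_borel_measurable_def set_integrable_def weight_def mult_ac)

lemma integrable_weight_mult:
  assumes P: "admissible P" and f: "in_L2 P f" and g: "in_L2 P g"
  shows "integrable lborel (\<lambda>x. weight P x * (f x * g x))"
proof (rule Bochner_Integration.integrable_bound)
  show "integrable lborel (\<lambda>x. weight P x * (f x)\<^sup>2 + weight P x * (g x)\<^sup>2)"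
    by (intro Bochner_Integration.integrable_add in_L2_weightD P f g)
  \<comment> \<open>Measurability is known only after restriction to the state space; the weight
    vanishes elsewhere, so the restriction leaves the product unchanged.\<close>
  have "(\<lambda>x. weight P x * ((indicator (state_space P) x * f x) * (indicator (state_space P) x * g x))) \<in> borel_measurable lborel"
    using P by (intro borel_measurable_times measurable_weight in_L2_weightD f g)
  moreover have "weight P x * ((indicator (state_space P) x * f x) * (indicator (state_space P) x * g x))
      = weight P x * (f x * g x)" for x
    by (simp add: weight_def indicator_def)
  ultimately show "(\<lambda>x. weight P x * (f x * g x)) \<in> borel_measurable lborel" by simp
  show "AE x in lborel. norm (weight P x * (f x * g x)) \<le> norm (weight P x * (f x)\<^sup>2 + weight P x * (g x)\<^sup>2)"
  proof (rule always_eventually, rule allI)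
    fix x
    have "2 * \<bar>f x * g x\<bar> \<le> (f x)\<^sup>2 + (g x)\<^sup>2"
      using sum_squares_bound[of "\<bar>f x\<bar>" "\<bar>g x\<bar>"] by (simp add: abs_mult)
    then have "\<bar>f x * g x\<bar> \<le> (f x)\<^sup>2 + (g x)\<^sup>2" by linarith
    then show "norm (weight P x * (f x * g x)) \<le> norm (weight P x * (f x)\<^sup>2 + weight P x * (g x)\<^sup>2)"
      using weight_nonneg[OF P, of x] unfolding distrib_left[symmetric] norm_mult
      by (intro mult_left_mono) auto
  qed
qed

text \<open>Expand the nonnegative weighted square norm of \<open>h\<close> minus its projection:
  the cross terms vanish, and on the diagonal the bound \<open>\<nu> n \<le> 1\<close>
  suffices.\<close>

lemma bessel_inequality:
  assumes P: "admissible P" and h: "in_L2 P h"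
    and Q: "\<And>n. in_L2 P (orth_poly P n)"
    and orth: "\<And>n k. n \<noteq> k \<Longrightarrow> (LINT x|lborel. weight P x * (orth_poly P n x * orth_poly P k x)) = 0"
    and A: "finite A"
  shows "(\<Sum>n\<in>A. (fourier_coeff P h n)\<^sup>2) \<le> (LINT x|lborel. weight P x * (h x)\<^sup>2)"
proof -
  let ?a = "fourier_coeff P h" and ?Q = "orth_poly P" and ?w = "weight P"
  define \<nu> where "\<nu> n = (LINT x|lborel. ?w x * (?Q n x * ?Q n x))" for n
  \<comment> \<open>Normalisation gives \<open>T / T\<close>, which is 1, or 0 if
    \<open>T = 0\<close> because division by zero yields 0; the bound covers both.\<close>
  have \<nu>: "\<nu> n \<le> 1" for n
  proof -
    define T where "T = (LINT y:state_space P|lborel. (poly (classical_poly P n) y)\<^sup>2 * stat_density P y)"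
    have T: "T = (LINT x|lborel. ?w x * (poly (classical_poly P n) x)\<^sup>2)"
      unfolding T_def set_lebesgue_integral_def weight_def by (simp add: mult_ac)
    have "T \<ge> 0" unfolding T using weight_nonneg[OF P] by (intro Bochner_Integration.integral_nonneg) auto
    have "\<nu> n = (LINT x|lborel. ?w x * (poly (classical_poly P n) x)\<^sup>2 / (sqrt T)\<^sup>2)"
      unfolding \<nu>_def orth_poly_def T_def[symmetric] by (simp add: power2_eq_square)
    also have "\<dots> = T / T" using \<open>T \<ge> 0\<close> by (simp add: T)
    finally show ?thesis by simp
  qed
  have int_hQ: "integrable lborel (\<lambda>x. ?w x * (h x * ?Q n x))" for n
    by (intro integrable_weight_mult P h Q)
  have int_QQ: "integrable lborel (\<lambda>x. ?w x * (?Q n x * ?Q k x))" for n k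
    by (intro integrable_weight_mult P Q)
  have int_hh: "integrable lborel (\<lambda>x. ?w x * (h x)\<^sup>2)" by (rule in_L2_weightD[OF P h])
  have "0 \<le> (LINT x|lborel. ?w x * (h x - (\<Sum>n\<in>A. ?a n * ?Q n x))\<^sup>2)"
    using weight_nonneg[OF P] by (intro Bochner_Integration.integral_nonneg) auto
  also have "(\<lambda>x. ?w x * (h x - (\<Sum>n\<in>A. ?a n * ?Q n x))\<^sup>2) =
      (\<lambda>x. ?w x * (h x)\<^sup>2 - 2 * (\<Sum>n\<in>A. ?a n * (?w x * (h x * ?Q n x)))
         + (\<Sum>n\<in>A. \<Sum>k\<in>A. ?a n * ?a k * (?w x * (?Q n x * ?Q k x))))"
    by (rule ext) (simp add: power2_diff power2_eq_square[of "sum _ _"] sum_product sum_distrib_left algebra_simps)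
  also have "(LINT x|lborel. ?w x * (h x)\<^sup>2 - 2 * (\<Sum>n\<in>A. ?a n * (?w x * (h x * ?Q n x)))
         + (\<Sum>n\<in>A. \<Sum>k\<in>A. ?a n * ?a k * (?w x * (?Q n x * ?Q k x)))) =
      (LINT x|lborel. ?w x * (h x)\<^sup>2) - 2 * (\<Sum>n\<in>A. ?a n * ?a n)
         + (\<Sum>n\<in>A. \<Sum>k\<in>A. ?a n * ?a k * (LINT x|lborel. ?w x * (?Q n x * ?Q k x)))"
    by (simp add: Bochner_Integration.integral_add Bochner_Integration.integral_diff Bochner_Integration.integral_sum
        int_hQ int_QQ int_hh fourier_coeff_weight[symmetric])
  also have "(\<Sum>n\<in>A. \<Sum>k\<in>A. ?a n * ?a k * (LINT x|lborel. ?w x * (?Q n x * ?Q k x))) = (\<Sum>n\<in>A. ?a n * ?a n * \<nu> n)"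
  proof (rule sum.cong[OF refl])
    fix n assume n: "n \<in> A"
    have "(\<Sum>k\<in>A. ?a n * ?a k * (LINT x|lborel. ?w x * (?Q n x * ?Q k x))) = (\<Sum>k\<in>A. if k = n then ?a n * ?a n * \<nu> n else 0)"
      by (intro sum.cong refl) (auto simp: orth \<nu>_def)
    then show "(\<Sum>k\<in>A. ?a n * ?a k * (LINT x|lborel. ?w x * (?Q n x * ?Q k x))) = ?a n * ?a n * \<nu> n"
      using A n by simp
  qed
  also have "(\<Sum>n\<in>A. ?a n * ?a n * \<nu> n) \<le> (\<Sum>n\<in>A. ?a n * ?a n)"
    using \<nu> by (intro sum_mono mult_left_le) auto
  finally show ?thesis by (simp add: power2_eq_square)
qed

text \<open>Only the Ornstein-Uhlenbeck and Cox-Ingersoll-Ross cases need the orthogonality of the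
  polynomials: there \<open>\<lambda>\<^sub>n\<close> grows linearly and square summability of the coefficients is used,
  whereas quadratic growth suffices for the Jacobi case.\<close>

lemma not_bounded_state_space_cases:
  assumes "\<not> bounded (state_space P)"
  obtains (OU) \<theta> \<sigma> \<mu>0 where "P = OU \<theta> \<sigma> \<mu>0" | (CIR) \<theta> a b where "P = CIR \<theta> a b"
  using assms by (cases P) auto

text \<open>Provides room for the interval \<open>[y, y + 1]\<close> in Green's formula.\<close>

lemma not_bounded_state_space_shift:
  "\<not> bounded (state_space P) \<Longrightarrow> y \<in> state_space P \<Longrightarrow> y \<le> x \<Longrightarrow> x \<in> state_space P"
  by (erule not_bounded_state_space_cases) auto

section \<open>Orthogonality of the polynomials\<close>

text \<open>All moments are finite: in the first case those of a normal density, in the second each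
  is a Gamma integral.\<close>

lemma integrable_weight_poly:
  assumes P: "admissible P" and unb: "\<not> bounded (state_space P)"
  shows "integrable lborel (\<lambda>x. weight P x * poly r x)"
  using unb
proof (cases rule: not_bounded_state_space_cases)
  case (OU \<theta> \<sigma> \<mu>0)
  have w: "weight P x = normal_density \<mu>0 \<bar>\<sigma>\<bar> x" for x
    by (simp add: weight_def OU normal_density_def)
  define q where "q = pcompose r [:\<mu>0, 1:]"
  have q: "poly r x = poly q (x - \<mu>0)" for x by (simp add: q_def poly_pcompose)
  have "\<bar>\<sigma>\<bar> > 0" using P OU by simp
  then have "integrable lborel (\<lambda>x. \<Sum>i\<le>degree q. coeff q i * (weight P x * (x - \<mu>0) ^ i))"
    unfolding w by (intro Bochner_Integration.integrable_sum integrable_mult_right integrable_normal_moment)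
  moreover have "weight P x * poly r x = (\<Sum>i\<le>degree q. coeff q i * (weight P x * (x - \<mu>0) ^ i))" for x
    unfolding q by (simp add: poly_altdef sum_distrib_left mult_ac)
  ultimately show ?thesis by simp
next
  case (CIR \<theta> a b)
  have ab: "a > 0" "b > 0" using P CIR by auto
  have mono: "integrable lborel (\<lambda>x. weight P x * x ^ k)" for k
  proof -
    \<comment> \<open>The Gamma integrand is complex-valued; its norm is the real integrand
      wanted.\<close>
    have "(\<lambda>t. complex_of_real t powr (of_real (b + real k) - 1) / of_real (exp (a * t))) absolutely_integrable_on {0<..}"
      using ab by (intro absolutely_integrable_Gamma_integral) auto
    from set_integrable_norm[OF this]
    have "set_integrable lebesgue {0<..} (\<lambda>t. norm (complex_of_real t powr (of_real (b + real k) - 1) / of_real (exp (a * t))))" .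
    then have "set_integrable lebesgue {0<..} (\<lambda>t. t powr (b + real k - 1) * exp (- a * t))"
      by (rule set_integrable_cong[THEN iffD1, rotated 3])
         (auto simp: norm_divide norm_powr_real_powr exp_minus field_simps)
    then have "integrable lebesgue (\<lambda>t. indicator {0<..} t * (t powr (b + real k - 1) * exp (- a * t)))"
      by (simp add: set_integrable_def)
    then have "integrable lborel (\<lambda>t. indicator {0<..} t * (t powr (b + real k - 1) * exp (- a * t)))"
      by (subst (asm) integrable_completion) auto
    from integrable_mult_right[OF this, of "a powr b / Gamma b"] show ?thesis
    proof (rule Bochner_Integration.integrable_cong[THEN iffD1, rotated 2])
      show "a powr b / Gamma b * (indicator {0<..} x * (x powr (b + real k - 1) * exp (- a * x))) = weight P x * x ^ k" for x
      proof (cases "x > 0")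
        case True
        then have "x powr (b + real k - 1) = x powr (b - 1) * x ^ k"
          by (simp add: powr_realpow[symmetric] powr_add[symmetric] algebra_simps)
        then show ?thesis by (simp add: weight_def CIR)
      qed (simp add: weight_def CIR)
    qed simp
  qed
  have "integrable lborel (\<lambda>x. \<Sum>i\<le>degree r. coeff r i * (weight P x * x ^ i))"
    by (intro Bochner_Integration.integrable_sum integrable_mult_right mono)
  then show ?thesis
    unfolding poly_altdef sum_distrib_left by (simp add: mult_ac)
qed

lemma tendsto_mult_poly_0:
  fixes f :: "real \<Rightarrow> real"
  assumes "\<And>k. ((\<lambda>x. x ^ k * f x) \<longlongrightarrow> 0) F"
  shows "((\<lambda>x. f x * poly r x) \<longlongrightarrow> 0) F"
proof -
  have "((\<lambda>x. \<Sum>i\<le>degree r. coeff r i * (x ^ i * f x)) \<longlongrightarrow> (\<Sum>i\<le>degree r. coeff r i * 0)) F"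
    by (intro tendsto_intros assms)
  then show ?thesis by (simp add: poly_altdef sum_distrib_left mult_ac)
qed

text \<open>Supplies the boundary values for Green's formula: \<open>D m\<close> decays faster than
  any power at infinite ends, and at the finite end 0 it behaves like \<open>x powr b\<close> with
  \<open>b > 0\<close>.\<close>

lemma flux_boundary:
  assumes P: "admissible P" and unb: "\<not> bounded (state_space P)"
  obtains l :: ereal where "state_space P = einterval l \<infinity>" "l < \<infinity>"
    "\<And>r. (((\<lambda>x. diffusion P x * stat_density P x * poly r x) \<circ> real_of_ereal) \<longlongrightarrow> 0) (at_right l)"
    "\<And>r. (((\<lambda>x. diffusion P x * stat_density P x * poly r x) \<circ> real_of_ereal) \<longlongrightarrow> 0) (at_left \<infinity>)"
  using unb
proof (cases rule: not_bounded_state_space_cases)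
  case (OU \<theta> \<sigma> \<mu>0)
  define s where "s = \<sigma>\<^sup>2"
  have s: "s > 0" using P OU by (auto simp: s_def)
  define C where "C = \<theta> * s / sqrt (2 * pi * s)"
  have eq: "diffusion P x * stat_density P x = C * exp (- (x - \<mu>0)\<^sup>2 / (2 * s))" for x
    by (simp add: OU C_def s_def)
  have bot: "((\<lambda>x::real. x ^ k * (C * exp (- (x - \<mu>0)\<^sup>2 / (2 * s)))) \<longlongrightarrow> 0) at_bot" for k
    using s by real_asymp
  have top: "((\<lambda>x::real. x ^ k * (C * exp (- (x - \<mu>0)\<^sup>2 / (2 * s)))) \<longlongrightarrow> 0) at_top" for k
    using s by real_asymp
  show ?thesis
  proof (rule that[of "-\<infinity>"])
    show "state_space P = einterval (-\<infinity>) \<infinity>" by (simp add: OU einterval_def)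
    show "(((\<lambda>x. diffusion P x * stat_density P x * poly r x) \<circ> real_of_ereal) \<longlongrightarrow> 0) (at_right (-\<infinity>))"
      and "(((\<lambda>x. diffusion P x * stat_density P x * poly r x) \<circ> real_of_ereal) \<longlongrightarrow> 0) (at_left \<infinity>)" for r
      unfolding ereal_tendsto_simps1 eq by (rule tendsto_mult_poly_0[OF bot], rule tendsto_mult_poly_0[OF top])
  qed simp
next
  case (CIR \<theta> a b)
  have ab: "a > 0" "b > 0" using P CIR by auto
  define C where "C = \<theta> / a * (a powr b / Gamma b)"
  have eq: "diffusion P x * stat_density P x = C * (x powr b * exp (- a * x))" if "x > 0" for x
    using that by (simp add: CIR C_def powr_diff)
  have bot: "((\<lambda>x::real. C * (x powr b * exp (- a * x))) \<longlongrightarrow> 0) (at_right 0)"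
    using ab by real_asymp
  have top: "((\<lambda>x::real. x ^ k * (C * (x powr b * exp (- a * x)))) \<longlongrightarrow> 0) at_top" for k
    using ab by real_asymp
  have 1: "((\<lambda>x. C * (x powr b * exp (- a * x)) * poly r x) \<longlongrightarrow> 0 * poly r 0) (at_right 0)" for r
    by (intro tendsto_mult bot) (auto intro!: tendsto_intros)
  have 2: "((\<lambda>x. diffusion P x * stat_density P x * poly r x) \<longlongrightarrow> 0) (at_right 0)" for r
  proof (rule Lim_transform_eventually)
    show "((\<lambda>x. C * (x powr b * exp (- a * x)) * poly r x) \<longlongrightarrow> 0) (at_right 0)"
      using 1[of r] by simp
  qed (auto simp: eventually_at_filter eq)
  have 3: "((\<lambda>x. diffusion P x * stat_density P x * poly r x) \<longlongrightarrow> 0) at_top" for r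
  proof (rule Lim_transform_eventually)
    show "((\<lambda>x. C * (x powr b * exp (- a * x)) * poly r x) \<longlongrightarrow> 0) at_top"
      by (rule tendsto_mult_poly_0[OF top])
    show "\<forall>\<^sub>F x in at_top. C * (x powr b * exp (- a * x)) * poly r x = diffusion P x * stat_density P x * poly r x"
      using eventually_gt_at_top[of 0] by eventually_elim (simp add: eq)
  qed
  show ?thesis
  proof (rule that[of "ereal 0"])
    show "state_space P = einterval (ereal 0) \<infinity>" by (auto simp: CIR einterval_def)
  qed (simp_all add: ereal_tendsto_simps1 2 3)
qed

text \<open>Green's formula: \<open>D m W\<close>, with the Wronskian \<open>W\<close>, has the
  derivative \<open>L * m * q * r\<close> and vanishes at both ends, while \<open>L\<close> is
  nonzero.\<close>

lemma orth_poly_orthogonal: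
  assumes P: "admissible P" and unb: "\<not> bounded (state_space P)" and "n \<noteq> k"
  shows "(LINT x|lborel. weight P x * (orth_poly P n x * orth_poly P k x)) = 0"
proof -
  obtain l where S: "state_space P = einterval l \<infinity>" and l: "l < \<infinity>"
    and bot: "\<And>r. (((\<lambda>x. diffusion P x * stat_density P x * poly r x) \<circ> real_of_ereal) \<longlongrightarrow> 0) (at_right l)"
    and top: "\<And>r. (((\<lambda>x. diffusion P x * stat_density P x * poly r x) \<circ> real_of_ereal) \<longlongrightarrow> 0) (at_left \<infinity>)"
    using flux_boundary[OF P unb] by metis
  define q r where "q = orth_pol P n" and "r = orth_pol P k"
  define L where "L = eigenvalue P n - eigenvalue P k"
  have "L \<noteq> 0" using strict_mono_eq[OF eigenvalue_strict_mono[OF P]] \<open>n \<noteq> k\<close> by (simp add: L_def)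
  define W where "W = q * pderiv r - pderiv q * r"
  have "(LBINT x=l..\<infinity>. L * (stat_density P x * poly (q * r) x)) = 0 - 0"
  proof (rule interval_integral_FTC_integrable[OF l])
    fix x assume "l < ereal x" "ereal x < \<infinity>"
    then have x: "x \<in> state_space P" unfolding S by (simp add: einterval_def)
    have q: "diffusion P x * poly (pderiv (pderiv q)) x = - eigenvalue P n * poly q x - drift P x * poly (pderiv q) x"
      and r: "diffusion P x * poly (pderiv (pderiv r)) x = - eigenvalue P k * poly r x - drift P x * poly (pderiv r) x"
      using orth_pol_ode[OF P, of x n] orth_pol_ode[OF P, of x k] by (simp_all add: q_def r_def)
    have "((\<lambda>x. diffusion P x * stat_density P x * poly W x) has_real_derivative
       drift P x * stat_density P x * poly W x + poly (pderiv W) x * (diffusion P x * stat_density P x)) (at x)"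
      by (rule DERIV_mult[OF has_real_derivative_flux[OF P x] poly_DERIV])
    moreover have "drift P x * stat_density P x * poly W x + poly (pderiv W) x * (diffusion P x * stat_density P x)
        = stat_density P x * (drift P x * poly W x + poly q x * (diffusion P x * poly (pderiv (pderiv r)) x)
           - poly r x * (diffusion P x * poly (pderiv (pderiv q)) x))"
      by (simp add: W_def pderiv_mult pderiv_diff algebra_simps)
    moreover have "\<dots> = L * (stat_density P x * poly (q * r) x)"
      unfolding q r by (simp add: W_def L_def algebra_simps)
    ultimately show "((\<lambda>x. diffusion P x * stat_density P x * poly W x) has_vector_derivative
        L * (stat_density P x * poly (q * r) x)) (at x)"
      by (simp add: has_real_derivative_iff_has_vector_derivative)
    show "isCont (\<lambda>x. L * (stat_density P x * poly (q * r) x)) x"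
      using continuous_on_stat_density[OF P] open_state_space x
      by (intro continuous_intros) (simp add: continuous_on_eq_continuous_at)
  next
    show "set_integrable lborel (einterval l \<infinity>) (\<lambda>x. L * (stat_density P x * poly (q * r) x))"
      unfolding S[symmetric] set_integrable_def
      using integrable_mult_right[OF integrable_weight_poly[OF P unb], of L "q * r"]
      by (simp add: weight_def mult_ac)
  qed (rule bot top)+
  then have "(LBINT x:state_space P. L * (stat_density P x * poly (q * r) x)) = 0"
    using l by (simp add: interval_lebesgue_integral_def S less_imp_le)
  then have "L * (LINT x|lborel. weight P x * poly (q * r) x) = 0"
    unfolding set_lebesgue_integral_def
    by (subst integral_mult_right_zero[symmetric]) (simp add: weight_def mult_ac)
  then show ?thesis using \<open>L \<noteq> 0\<close> by (simp add: orth_poly_eq q_def r_def)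
qed

lemma in_L2_orth_poly:
  assumes P: "admissible P" and unb: "\<not> bounded (state_space P)"
  shows "in_L2 P (orth_poly P n)"
proof (rule in_L2_weightI[OF P])
  show "orth_poly P n \<in> borel_measurable lborel"
    unfolding orth_poly_eq by (simp add: borel_measurable_continuous_onI continuous_on_poly)
  show "integrable lborel (\<lambda>x. weight P x * (orth_poly P n x)\<^sup>2)"
    using integrable_weight_poly[OF P unb, of "(orth_pol P n)\<^sup>2"] by (simp add: orth_poly_eq)
qed

section \<open>Polynomial values relative to the eigenvalues\<close>

text \<open>Truncation turns integrals over a compact interval, as they occur in Green's formula,
  into Fourier coefficients to which Bessel's inequality applies.\<close>

lemma in_L2_truncate:
  assumes P: "admissible P" and ab: "a < b" "{a..b} \<subseteq> state_space P"
    and v: "continuous_on {a..b} v"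
    and B: "\<And>x. x \<in> {a..b} \<Longrightarrow> \<bar>v x\<bar> \<le> B" and m: "\<And>x. x \<in> {a..b} \<Longrightarrow> stat_density P x \<le> mmax"
  defines "V \<equiv> \<lambda>x. indicator {a..b} x * v x"
  shows "in_L2 P V"
    and "(LINT x|lborel. weight P x * (V x)\<^sup>2) \<le> mmax * B\<^sup>2 * (b - a)"
    and "((\<lambda>x. v x * orth_poly P n x * stat_density P x) has_integral fourier_coeff P V n) {a..b}"
proof -
  have mc: "continuous_on {a..b} (stat_density P)"
    by (rule continuous_on_subset[OF continuous_on_stat_density[OF P] ab(2)])
  have V_eq: "weight P x * (V x)\<^sup>2 = indicator {a..b} x * (stat_density P x * (v x)\<^sup>2)" for x
    using ab(2) by (auto simp: weight_def V_def indicator_def)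
  have V_int: "set_integrable lborel {a..b} (\<lambda>x. stat_density P x * (v x)\<^sup>2)"
    by (intro borel_integrable_atLeastAtMost' continuous_intros mc v)
  show "in_L2 P V"
  proof (rule in_L2_weightI[OF P])
    show "V \<in> borel_measurable lborel"
      using borel_measurable_continuous_on_indicator[OF _ v] by (simp add: V_def[abs_def])
    show "integrable lborel (\<lambda>x. weight P x * (V x)\<^sup>2)"
      using V_int unfolding V_eq set_integrable_def by simp
  qed
  have "(LINT x|lborel. weight P x * (V x)\<^sup>2) = (LINT x:{a..b}|lborel. stat_density P x * (v x)\<^sup>2)"
    by (simp add: V_eq set_lebesgue_integral_def)
  also have "\<dots> \<le> (LINT x:{a..b}|lborel. mmax * B\<^sup>2)"
  proof (rule set_integral_mono[OF V_int])
    show "set_integrable lborel {a..b} (\<lambda>x. mmax * B\<^sup>2)"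
      by (intro borel_integrable_atLeastAtMost' continuous_intros)
    fix x assume x: "x \<in> {a..b}"
    have "(v x)\<^sup>2 \<le> B\<^sup>2" using B[OF x] by (simp add: power2_le_iff_abs_le)
    moreover have "stat_density P x > 0" using x ab(2) stat_density_pos[OF P] by blast
    ultimately show "stat_density P x * (v x)\<^sup>2 \<le> mmax * B\<^sup>2"
      using m[OF x] by (intro mult_mono) auto
  qed
  also have "\<dots> = mmax * B\<^sup>2 * (b - a)"
    using ab(1) by (simp add: set_lebesgue_integral_def)
  finally show "(LINT x|lborel. weight P x * (V x)\<^sup>2) \<le> mmax * B\<^sup>2 * (b - a)" .
  have Q: "continuous_on {a..b} (orth_poly P n)"
    unfolding orth_poly_eq by (intro continuous_intros)
  have "set_integrable lborel {a..b} (\<lambda>x. v x * orth_poly P n x * stat_density P x)"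
    by (intro borel_integrable_atLeastAtMost' continuous_intros mc v Q)
  note * = set_borel_integral_eq_integral[OF this]
  have "fourier_coeff P V n = (LINT x:{a..b}|lborel. v x * orth_poly P n x * stat_density P x)"
    unfolding fourier_coeff_def set_lebesgue_integral_def
    by (intro Bochner_Integration.integral_cong refl) (use ab(2) in \<open>auto simp: V_def indicator_def\<close>)
  then show "((\<lambda>x. v x * orth_poly P n x * stat_density P x) has_integral fourier_coeff P V n) {a..b}"
    using * by (simp add: has_integral_iff)
qed

text \<open>Green's formula on \<open>[y, y + 1]\<close> with a cubic \<open>v\<close> gives
  \<open>D m Q = - \<lambda> a - a'\<close> at \<open>y\<close>, where \<open>a\<close> and
  \<open>a'\<close> are the Fourier coefficients of the truncated \<open>v\<close> and of its image
  under the generator. Dividing by \<open>\<lambda>\<close> and applying Bessel's inequality twice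
  gives a bound that depends on \<open>c\<close> and \<open>d\<close> only.\<close>

lemma sum_orth_poly_over_eigenvalue:
  assumes P: "admissible P" and unb: "\<not> bounded (state_space P)" and cd: "c \<le> d" "c \<in> state_space P"
  obtains R where "\<And>y A. y \<in> {c..d} \<Longrightarrow> finite A \<Longrightarrow> (\<Sum>n\<in>A. (orth_poly P n y / eigenvalue P n)\<^sup>2) \<le> R"
proof -
  let ?ev = "eigenvalue P" and ?Q = "orth_poly P"
  have S: "{c..d + 1} \<subseteq> state_space P"
    using not_bounded_state_space_shift[OF unb cd(2)] by auto
  have mc: "continuous_on {c..d + 1} (stat_density P)"
    by (rule continuous_on_subset[OF continuous_on_stat_density[OF P] S])
  obtain mmax where mmax: "\<And>x. x \<in> {c..d + 1} \<Longrightarrow> stat_density P x \<le> mmax"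
    using continuous_attains_sup[OF _ _ mc] cd by fastforce
  obtain \<mu>max where \<mu>max: "\<And>x. x \<in> {c..d + 1} \<Longrightarrow> \<bar>drift P x\<bar> \<le> \<mu>max"
    using continuous_attains_sup[of "{c..d + 1}" "\<lambda>x. \<bar>drift P x\<bar>"] cd continuous_on_drift
    by (fastforce intro: continuous_on_rabs)
  obtain Dmax where Dmax: "\<And>x. x \<in> {c..d + 1} \<Longrightarrow> \<bar>diffusion P x\<bar> \<le> Dmax"
    using continuous_attains_sup[of "{c..d + 1}" "\<lambda>x. \<bar>diffusion P x\<bar>"] cd continuous_on_diffusion
    by (fastforce intro: continuous_on_rabs)
  obtain pmin where pmin: "pmin > 0" "\<And>x. x \<in> {c..d} \<Longrightarrow> pmin \<le> diffusion P x * stat_density P x"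
  proof -
    have "continuous_on {c..d} (\<lambda>x. diffusion P x * stat_density P x)"
      by (intro continuous_intros continuous_on_diffusion continuous_on_subset[OF mc]) auto
    from continuous_attains_inf[OF _ _ this] cd obtain z where z: "z \<in> {c..d}"
      "\<forall>x\<in>{c..d}. diffusion P z * stat_density P z \<le> diffusion P x * stat_density P x" by auto
    moreover have "z \<in> state_space P" using z(1) S by auto
    ultimately show ?thesis
      using that[of "diffusion P z * stat_density P z"] diffusion_pos[OF P] stat_density_pos[OF P] by auto
  qed
  define l where "l = ?ev 1"
  have l: "l > 0" using strict_monoD[OF eigenvalue_strict_mono[OF P], of 0 1] by (simp add: l_def)
  \<comment> \<open>Bounds the generator applied to \<open>v\<close>, whose first two derivatives
    are at most 8 and 4 in absolute value.\<close>
  define B where "B = 8 * \<mu>max + 4 * Dmax"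
  \<comment> \<open>As the interval has length 1, the square norms of the two truncated functions
    are at most \<open>mmax\<close> and \<open>mmax * B^2\<close>; \<open>R\<close> combines
    these.\<close>
  define R where "R = (2 * (mmax * 1\<^sup>2 * 1) + 2 * (mmax * B\<^sup>2 * 1) / l\<^sup>2) / pmin\<^sup>2"
  show ?thesis
  proof (rule that[of R])
    fix y :: real and A :: "nat set" assume y: "y \<in> {c..d}" and A: "finite A"
    \<comment> \<open>With \<open>z = x - y\<close> this is \<open>z * (1 - z)^2\<close>: it
      vanishes at \<open>y\<close> with slope 1 and doubly at \<open>y + 1\<close>, so the boundary
      terms reduce to the polynomial's value at \<open>y\<close>.\<close>
    define v where "v = [:-y, 1:] * [:y + 1, -1:]\<^sup>2"
    define G where "G x = diffusion P x * poly (pderiv (pderiv v)) x + drift P x * poly (pderiv v) x" for x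
    define V where "V x = indicator {y..y+1} x * poly v x" for x
    define V' where "V' x = indicator {y..y+1} x * G x" for x
    have sub: "{y..y + 1} \<subseteq> {c..d + 1}" using y by auto
    then have sub': "{y..y + 1} \<subseteq> state_space P" using S by auto
    have v: "poly v x = (x - y) * (1 - (x - y))\<^sup>2"
      "poly (pderiv v) x = 1 - 4 * (x - y) + 3 * (x - y)\<^sup>2"
      "poly (pderiv (pderiv v)) x = - 4 + 6 * (x - y)" for x
      by (simp_all add: v_def power2_eq_square pderiv_pCons algebra_simps)
    have v_le: "\<bar>poly v x\<bar> \<le> 1" "\<bar>poly (pderiv v) x\<bar> \<le> 8" "\<bar>poly (pderiv (pderiv v)) x\<bar> \<le> 4"
      if "x \<in> {y..y + 1}" for x
    proof -
      define z where "z = x - y"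
      have z: "0 \<le> z" "z \<le> 1" using that by (auto simp: z_def)
      have "0 \<le> z\<^sup>2" "z\<^sup>2 \<le> 1" "(1 - z)\<^sup>2 \<le> 1" using z by (auto simp: power2_eq_square mult_le_one)
      then have "\<bar>z * (1 - z)\<^sup>2\<bar> \<le> 1" "\<bar>1 - 4 * z + 3 * z\<^sup>2\<bar> \<le> 8" "\<bar>- 4 + 6 * z\<bar> \<le> 4"
        using z zero_le_power2[of z] by (simp add: abs_mult mult_le_one, linarith+)
      then show "\<bar>poly v x\<bar> \<le> 1" "\<bar>poly (pderiv v) x\<bar> \<le> 8" "\<bar>poly (pderiv (pderiv v)) x\<bar> \<le> 4"
        unfolding v z_def .
    qed
    have G_le: "\<bar>G x\<bar> \<le> B" if x: "x \<in> {y..y + 1}" for x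
    proof -
      have "\<bar>G x\<bar> \<le> \<bar>diffusion P x\<bar> * \<bar>poly (pderiv (pderiv v)) x\<bar> + \<bar>drift P x\<bar> * \<bar>poly (pderiv v) x\<bar>"
        unfolding G_def by (simp add: abs_mult[symmetric] abs_triangle_ineq)
      also have "\<dots> \<le> Dmax * 4 + \<mu>max * 8"
        using v_le[OF x] Dmax[of x] \<mu>max[of x] sub x by (intro add_mono mult_mono) auto
      finally show ?thesis by (simp add: B_def)
    qed
    have mm: "stat_density P x \<le> mmax" if "x \<in> {y..y + 1}" for x using mmax sub that by auto
    have vc: "continuous_on {y..y+1} (poly v)" by (intro continuous_intros)
    have Gc: "continuous_on {y..y+1} G"
      unfolding G_def[abs_def] by (intro continuous_intros continuous_on_drift continuous_on_diffusion)
    have yy: "y < y + 1" by simp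
    have V: "in_L2 P V" "(LINT x|lborel. weight P x * (V x)\<^sup>2) \<le> mmax * 1\<^sup>2 * (y + 1 - y)"
      "((\<lambda>x. poly v x * ?Q n x * stat_density P x) has_integral fourier_coeff P V n) {y..y + 1}" for n
      unfolding V_def[abs_def]
      by (rule in_L2_truncate(1)[OF P yy sub' vc v_le(1) mm] in_L2_truncate(2)[OF P yy sub' vc v_le(1) mm]
          in_L2_truncate(3)[OF P yy sub' vc v_le(1) mm]; assumption)+
    have V': "in_L2 P V'" "(LINT x|lborel. weight P x * (V' x)\<^sup>2) \<le> mmax * B\<^sup>2 * (y + 1 - y)"
      "((\<lambda>x. G x * ?Q n x * stat_density P x) has_integral fourier_coeff P V' n) {y..y + 1}" for n
      unfolding V'_def[abs_def]
      by (rule in_L2_truncate(1)[OF P yy sub' Gc G_le mm] in_L2_truncate(2)[OF P yy sub' Gc G_le mm]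
          in_L2_truncate(3)[OF P yy sub' Gc G_le mm]; assumption)+
    define a a' where "a = fourier_coeff P V" and "a' = fourier_coeff P V'"
    have green: "diffusion P y * stat_density P y * ?Q n y = - ?ev n * a n - a' n" for n
    proof -
      define q where "q = orth_pol P n"
      define W where "W = v * pderiv q - pderiv v * q"
      have "((\<lambda>x. stat_density P x * (poly v x * (- ?ev n * poly q x) - poly q x * G x)) has_integral
          diffusion P (y + 1) * stat_density P (y + 1) * poly W (y + 1) - diffusion P y * stat_density P y * poly W y) {y..y + 1}"
      proof (rule fundamental_theorem_of_calculus)
        fix x assume "x \<in> {y..y + 1}"
        then have x: "x \<in> state_space P" using sub' by auto
        have q: "- ?ev n * poly q x = diffusion P x * poly (pderiv (pderiv q)) x + drift P x * poly (pderiv q) x"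
          using orth_pol_ode[OF P, of x n] by (simp add: q_def)
        have "((\<lambda>x. diffusion P x * stat_density P x * poly W x) has_real_derivative
           drift P x * stat_density P x * poly W x + poly (pderiv W) x * (diffusion P x * stat_density P x)) (at x)"
          by (rule DERIV_mult[OF has_real_derivative_flux[OF P x] poly_DERIV])
        moreover have "drift P x * stat_density P x * poly W x + poly (pderiv W) x * (diffusion P x * stat_density P x)
            = stat_density P x * (poly v x * (- ?ev n * poly q x) - poly q x * G x)"
          unfolding q G_def by (simp add: W_def pderiv_mult pderiv_diff algebra_simps)
        ultimately show "((\<lambda>x. diffusion P x * stat_density P x * poly W x) has_vector_derivative
            stat_density P x * (poly v x * (- ?ev n * poly q x) - poly q x * G x)) (at x within {y..y + 1})"
          by (metis has_field_derivative_at_within has_real_derivative_iff_has_vector_derivative)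
      qed simp
      moreover have "((\<lambda>x. stat_density P x * (poly v x * (- ?ev n * poly q x) - poly q x * G x)) has_integral
          - ?ev n * a n - a' n) {y..y + 1}"
      proof -
        have "((\<lambda>x. - ?ev n * (poly v x * ?Q n x * stat_density P x) - G x * ?Q n x * stat_density P x) has_integral
            - ?ev n * a n - a' n) {y..y + 1}"
          unfolding a_def a'_def by (intro has_integral_diff has_integral_mult_right V(3) V'(3))
        then show ?thesis by (simp add: orth_poly_eq q_def algebra_simps)
      qed
      ultimately have "diffusion P (y + 1) * stat_density P (y + 1) * poly W (y + 1) - diffusion P y * stat_density P y * poly W y
          = - ?ev n * a n - a' n" by (rule has_integral_unique)
      moreover have "poly W (y + 1) = 0" "poly W y = - poly q y"
        by (simp_all add: W_def v)
      ultimately show ?thesis by (simp add: orth_poly_eq q_def)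
    qed
    \<comment> \<open>For \<open>n = 0\<close> the quotient by the eigenvalue 0 is 0. Otherwise the
      eigenvalue is at least \<open>l\<close>, and the square of a sum is at most twice the sum of
      squares.\<close>
    have le: "pmin\<^sup>2 * (?Q n y / ?ev n)\<^sup>2 \<le> 2 * (a n)\<^sup>2 + 2 * (a' n)\<^sup>2 / l\<^sup>2" for n
    proof (cases "n = 0")
      case False
      then have ev: "l \<le> ?ev n"
        using strict_mono_less_eq[OF eigenvalue_strict_mono[OF P], of 1 n] by (simp add: l_def)
      define p where "p = diffusion P y * stat_density P y"
      have p: "pmin \<le> p" using pmin(2)[OF y] by (simp add: p_def)
      have "p * (?Q n y / ?ev n) = - a n - a' n / ?ev n"
        using green[of n] ev l by (simp add: p_def field_simps)
      then have "(p * (?Q n y / ?ev n))\<^sup>2 = (- a n - a' n / ?ev n)\<^sup>2" by simp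
      then have "p\<^sup>2 * (?Q n y / ?ev n)\<^sup>2 = (- (a n + a' n / ?ev n))\<^sup>2"
        unfolding power_mult_distrib by simp
      then have "p\<^sup>2 * (?Q n y / ?ev n)\<^sup>2 = (a n + a' n / ?ev n)\<^sup>2"
        unfolding power2_minus .
      also have "\<dots> \<le> 2 * (a n)\<^sup>2 + 2 * (a' n / ?ev n)\<^sup>2"
        using sum_squares_bound[of "a n" "a' n / ?ev n"] by (simp add: power2_sum)
      also have "(a' n / ?ev n)\<^sup>2 \<le> (a' n)\<^sup>2 / l\<^sup>2"
        using ev l by (simp add: power_divide divide_left_mono power_mono)
      also have "pmin\<^sup>2 * (?Q n y / ?ev n)\<^sup>2 \<le> p\<^sup>2 * (?Q n y / ?ev n)\<^sup>2"
        using p pmin(1) by (intro mult_right_mono power_mono) auto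
      finally show ?thesis by simp
    qed simp
    have bessel: "(\<Sum>n\<in>A. (fourier_coeff P h n)\<^sup>2) \<le> (LINT x|lborel. weight P x * (h x)\<^sup>2)" if "in_L2 P h" for h
      using that in_L2_orth_poly[OF P unb] orth_poly_orthogonal[OF P unb] A by (intro bessel_inequality[OF P]) auto
    have "pmin\<^sup>2 * (\<Sum>n\<in>A. (?Q n y / ?ev n)\<^sup>2) \<le> 2 * (\<Sum>n\<in>A. (a n)\<^sup>2) + 2 * (\<Sum>n\<in>A. (a' n)\<^sup>2) / l\<^sup>2"
      unfolding sum_distrib_left sum_divide_distrib sum.distrib[symmetric] by (intro sum_mono le)
    also have "\<dots> \<le> 2 * (mmax * 1\<^sup>2 * 1) + 2 * (mmax * B\<^sup>2 * 1) / l\<^sup>2"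
      unfolding a_def a'_def
      using order_trans[OF bessel[OF V(1)] V(2)] order_trans[OF bessel[OF V'(1)] V'(2)]
      by (intro add_mono mult_left_mono divide_right_mono) auto
    finally show "(\<Sum>n\<in>A. (?Q n y / ?ev n)\<^sup>2) \<le> R"
      using pmin(1) by (simp add: R_def field_simps)
  qed
qed

section \<open>The series solution\<close>

lemma uniformly_convergent_sumI:
  fixes f :: "nat \<Rightarrow> 'a \<Rightarrow> real"
  assumes "\<And>\<epsilon>. \<epsilon> > 0 \<Longrightarrow> \<exists>N0. \<forall>N\<ge>N0. \<forall>M. \<forall>x\<in>X. \<bar>\<Sum>n\<in>{N..<M}. f n x\<bar> \<le> \<epsilon>"
  shows "uniformly_convergent_on X (\<lambda>N x. \<Sum>n<N. f n x)"
  unfolding uniformly_convergent_sum_iff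
proof (intro allI impI)
  fix \<epsilon> :: real assume \<epsilon>: "\<epsilon> > 0"
  then have "\<epsilon> / 2 > 0" "\<epsilon> / 2 < \<epsilon>" by auto
  with assms[of "\<epsilon> / 2"] show "\<exists>N0. \<forall>N\<ge>N0. \<forall>M. \<forall>x\<in>X. \<bar>\<Sum>n\<in>{N..<M}. f n x\<bar> < \<epsilon>"
    by (meson le_less_trans)
qed

lemma uniformly_convergent_imp_summable:
  fixes f :: "nat \<Rightarrow> 'a \<Rightarrow> real"
  assumes "uniformly_convergent_on X (\<lambda>N x. \<Sum>n<N. f n x)" "x \<in> X"
  shows "summable (\<lambda>n. f n x)"
  using assms
  by (auto simp: uniformly_convergent_on_def summable_iff_convergent convergent_def dest: tendsto_uniform_limitI)

lemma uniform_limit_suminf_of_convergent: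
  fixes f :: "nat \<Rightarrow> 'a \<Rightarrow> real"
  assumes "uniformly_convergent_on X (\<lambda>N x. \<Sum>n<N. f n x)"
  shows "uniform_limit X (\<lambda>N x. \<Sum>n<N. f n x) (\<lambda>x. \<Sum>n. f n x) sequentially"
  using assms by (simp add: uniformly_convergent_uniform_limit_iff suminf_eq_lim)

lemma suminf_tail_le:
  fixes f :: "nat \<Rightarrow> real"
  assumes "summable f" and "\<And>M. \<bar>\<Sum>n\<in>{N..<M}. f n\<bar> \<le> \<epsilon>"
  shows "\<bar>suminf f - (\<Sum>n<N. f n)\<bar> \<le> \<epsilon>"
proof (rule LIMSEQ_le_const2)
  show "(\<lambda>M. \<bar>(\<Sum>n<M. f n) - (\<Sum>n<N. f n)\<bar>) \<longlonglongrightarrow> \<bar>suminf f - (\<Sum>n<N. f n)\<bar>"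
    using assms(1) by (intro tendsto_intros summable_LIMSEQ)
  have "(\<Sum>n<M. f n) - (\<Sum>n<N. f n) = (\<Sum>n\<in>{N..<M}. f n)" if "N \<le> M" for M
    using that by (simp add: lessThan_atLeast0 sum_diff_nat_ivl)
  then show "\<exists>K. \<forall>M\<ge>K. \<bar>(\<Sum>n<M. f n) - (\<Sum>n<N. f n)\<bar> \<le> \<epsilon>"
    using assms(2) by (intro exI[of _ N]) auto
qed

lemma eigenvalue_pos: "admissible P \<Longrightarrow> n > 0 \<Longrightarrow> eigenvalue P n > 0"
  using strict_monoD[OF eigenvalue_strict_mono, of P 0 n] by simp

lemma eigenvalue_nonneg: "admissible P \<Longrightarrow> eigenvalue P n \<ge> 0"
  using eigenvalue_pos[of P n] by (cases "n = 0") auto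

text \<open>The term \<open>n = 0\<close> is 0 by division by zero. Linear growth of the eigenvalues
  requires the Cauchy-Schwarz inequality; quadratic growth needs only that the terms are eventually
  at most 1, uniformly in \<open>y\<close>.\<close>

lemma fourier_series_over_eigenvalue:
  assumes P: "admissible P" and h: "in_L2 P h" and cd: "c \<le> d" "{c..d} \<subseteq> state_space P"
    and conv: "uniformly_convergent_on {c..d} (\<lambda>N y. \<Sum>n<N. orth_poly P n y * fourier_coeff P h n)"
  shows "uniformly_convergent_on {c..d} (\<lambda>N y. \<Sum>n<N. \<bar>orth_poly P n y * fourier_coeff P h n\<bar> / eigenvalue P n)"
    (is "uniformly_convergent_on _ (\<lambda>N y. \<Sum>n<N. ?f n y)")
proof (cases "bounded (state_space P)")
  case False
  define a where "a = fourier_coeff P h"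
  have "c \<in> state_space P" using cd by auto
  then obtain R where R: "\<And>y A. y \<in> {c..d} \<Longrightarrow> finite A \<Longrightarrow> (\<Sum>n\<in>A. (orth_poly P n y / eigenvalue P n)\<^sup>2) \<le> R"
    using sum_orth_poly_over_eigenvalue[OF P False cd(1)] by metis
  have "R \<ge> 0" using R[of c "{}"] cd by simp
  have "summable (\<lambda>n. (a n)\<^sup>2)"
    unfolding a_def
    by (rule summableI_nonneg_bounded[OF _ bessel_inequality[OF P h in_L2_orth_poly[OF P False] orth_poly_orthogonal[OF P False]]])
      auto
  show ?thesis
    unfolding uniformly_convergent_sum_iff
  proof (intro allI impI)
    fix \<epsilon> :: real assume \<epsilon>: "\<epsilon> > 0"
    then have "\<epsilon>\<^sup>2 / (R + 1) > 0" using \<open>R \<ge> 0\<close> by simp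
    with \<open>summable (\<lambda>n. (a n)\<^sup>2)\<close> obtain N0 where
      N0: "\<And>N M. N \<ge> N0 \<Longrightarrow> norm (\<Sum>n\<in>{N..<M}. (a n)\<^sup>2) < \<epsilon>\<^sup>2 / (R + 1)"
      unfolding summable_Cauchy by meson
    have "\<bar>\<Sum>n\<in>{N..<M}. ?f n y\<bar> < \<epsilon>" if "N \<ge> N0" "y \<in> {c..d}" for N M y
    proof -
      let ?q = "\<lambda>n. orth_poly P n y / eigenvalue P n"
      have "(\<Sum>n\<in>{N..<M}. ?f n y) = (\<Sum>n\<in>{N..<M}. \<bar>a n\<bar> * \<bar>?q n\<bar>)"
        using eigenvalue_nonneg[OF P] by (intro sum.cong) (auto simp: abs_mult a_def)
      then have "(\<Sum>n\<in>{N..<M}. ?f n y)\<^sup>2 \<le> (\<Sum>n\<in>{N..<M}. \<bar>a n\<bar>\<^sup>2) * (\<Sum>n\<in>{N..<M}. \<bar>?q n\<bar>\<^sup>2)"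
        by (simp only: Cauchy_Schwarz_ineq_sum)
      also have "\<dots> \<le> (\<Sum>n\<in>{N..<M}. (a n)\<^sup>2) * R"
        unfolding power2_abs using R[OF that(2), of "{N..<M}"] by (intro mult_left_mono sum_nonneg) auto
      also have "\<dots> \<le> \<epsilon>\<^sup>2 / (R + 1) * R"
        using N0[OF that(1), of M] \<open>R \<ge> 0\<close> by (intro mult_right_mono) auto
      also have "\<dots> < \<epsilon>\<^sup>2" using \<epsilon> \<open>R \<ge> 0\<close> by (simp add: field_simps)
      finally have "\<bar>\<Sum>n\<in>{N..<M}. ?f n y\<bar>\<^sup>2 < \<epsilon>\<^sup>2" by simp
      then show ?thesis using \<epsilon> by (intro power2_less_imp_less[of _ \<epsilon>]) auto
    qed
    then show "\<exists>N0. \<forall>N\<ge>N0. \<forall>M. \<forall>y\<in>{c..d}. \<bar>\<Sum>n\<in>{N..<M}. ?f n y\<bar> < \<epsilon>" by blast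
  qed
next
  case True
  then obtain a b where J: "P = Jacobi a b"
  proof (cases P)
    case (CIR \<theta> a b)
    then obtain u :: real where u: "\<And>x. 0 < x \<Longrightarrow> x \<le> u"
      using bounded_imp_bdd_above[OF True] by (auto simp: bdd_above_def)
    have "\<bar>u\<bar> + 1 \<le> u" by (rule u) simp
    then show ?thesis by simp
  qed (use that in auto)
  obtain N1 where N1: "\<And>N M y. N \<ge> N1 \<Longrightarrow> y \<in> {c..d} \<Longrightarrow> \<bar>\<Sum>n\<in>{N..<M}. orth_poly P n y * fourier_coeff P h n\<bar> < 1"
    using conv unfolding uniformly_convergent_sum_iff by (meson zero_less_one)
  have "summable (\<lambda>n. 2 * inverse (real n ^ 2))"
    by (intro summable_mult inverse_power_summable) auto
  show ?thesis
    unfolding uniformly_convergent_sum_iff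
  proof (intro allI impI)
    fix \<epsilon> :: real assume \<epsilon>: "\<epsilon> > 0"
    with \<open>summable (\<lambda>n. 2 * inverse (real n ^ 2))\<close> obtain N0 where
      N0: "\<And>N M. N \<ge> N0 \<Longrightarrow> norm (\<Sum>n\<in>{N..<M}. 2 * inverse (real n ^ 2)) < \<epsilon>"
      unfolding summable_Cauchy by meson
    have "\<bar>\<Sum>n\<in>{N..<M}. ?f n y\<bar> < \<epsilon>" if N: "N \<ge> max 2 (max N0 N1)" and y: "y \<in> {c..d}" for N M y
    proof -
      have "\<bar>\<Sum>n\<in>{N..<M}. ?f n y\<bar> \<le> (\<Sum>n\<in>{N..<M}. 2 * inverse (real n ^ 2))"
      proof (intro order_trans[OF sum_abs] sum_mono)
        fix n assume "n \<in> {N..<M}"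
        then have n: "real n \<ge> 2" "n \<ge> N1" using N by auto
        \<comment> \<open>Hence \<open>n + a + b + 1 > n - 1 \<ge> n / 2\<close> for
          \<open>n \<ge> 2\<close>, which explains the lower bound 2 for the tail.\<close>
        have "a + b + 2 > 0" using P J by simp
        then have "real n * (real n / 2) \<le> real n * (real n + a + b + 1)"
          using n by (intro mult_left_mono) auto
        then have "(real n)\<^sup>2 / 2 \<le> eigenvalue P n" by (simp add: J power2_eq_square)
        \<comment> \<open>A single term is the block from \<open>n\<close> to
          \<open>Suc n\<close>.\<close>
        moreover have "\<bar>orth_poly P n y * fourier_coeff P h n\<bar> \<le> 1"
          using N1[OF n(2) y, of "Suc n"] by simp
        ultimately have "?f n y \<le> 1 / ((real n)\<^sup>2 / 2)"
          using n by (intro frac_le) auto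
        then show "\<bar>?f n y\<bar> \<le> 2 * inverse (real n ^ 2)"
          using eigenvalue_nonneg[OF P, of n] by (simp only: abs_of_nonneg divide_nonneg_nonneg abs_ge_zero) (simp add: inverse_eq_divide)
      qed
      also have "\<dots> < \<epsilon>" using N0[of N M] N by auto
      finally show ?thesis .
    qed
    then show "\<exists>N0. \<forall>N\<ge>N0. \<forall>M. \<forall>y\<in>{c..d}. \<bar>\<Sum>n\<in>{N..<M}. ?f n y\<bar> < \<epsilon>" by blast
  qed
qed

section \<open>Tails of the series and of its time derivative\<close>

locale frac_pearson = frac_order +
  fixes P :: pearson and h :: "real \<Rightarrow> real"
  assumes P: "admissible P" and h: "in_L2 P h"
    and uniform: "\<And>I. is_interval I \<Longrightarrow> bounded I \<Longrightarrow> I \<subseteq> state_space P \<Longrightarrow>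
           uniform_limit I (\<lambda>N y. \<Sum>n<N. fourier_coeff P h n * orth_poly P n y) h sequentially"
begin

abbreviation ev :: "nat \<Rightarrow> real" where "ev \<equiv> eigenvalue P"

definition fterm :: "nat \<Rightarrow> real \<Rightarrow> real" where "fterm n y = orth_poly P n y * fourier_coeff P h n"

lemma ev_nonneg: "ev n \<ge> 0" by (rule eigenvalue_nonneg[OF P])

lemma ev_mono: "ev n \<le> ev (Suc n)"
  using strict_monoD[OF eigenvalue_strict_mono[OF P], of n "Suc n"] by simp

lemma fterm_sums: "y \<in> state_space P \<Longrightarrow> (\<lambda>n. fterm n y) sums h y"
  using uniform[of "{y}"] by (simp add: fterm_def sums_def mult.commute is_interval_1)

lemma uniformly_convergent_fterm:
  assumes "{c..d} \<subseteq> state_space P"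
  shows "uniformly_convergent_on {c..d} (\<lambda>N y. \<Sum>n<N. fterm n y)"
  using uniform[of "{c..d}"] assms
  by (auto simp: uniformly_convergent_on_def fterm_def mult.commute is_interval_cc)

text \<open>The modes do not decay at \<open>s = 0\<close>, so Abel summation replaces absolute
  convergence: they decrease in \<open>n\<close> and are at most 1, so the tails of the initial
  expansion bound all tails uniformly in \<open>s\<close>.\<close>

lemma tail_relax:
  assumes "{c..d} \<subseteq> state_space P" "\<epsilon> > 0"
  obtains N0 where "\<And>N M y s. N \<ge> N0 \<Longrightarrow> y \<in> {c..d} \<Longrightarrow> \<bar>\<Sum>n\<in>{N..<M}. relax (ev n) s * fterm n y\<bar> \<le> \<epsilon>"
proof -
  obtain N0 where N0: "\<And>N M y. N \<ge> N0 \<Longrightarrow> y \<in> {c..d} \<Longrightarrow> \<bar>\<Sum>n\<in>{N..<M}. fterm n y\<bar> < \<epsilon>"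
    using uniformly_convergent_fterm[OF assms(1)] assms(2) unfolding uniformly_convergent_sum_iff by meson
  show ?thesis
  proof (rule that[of N0])
    fix N M y s assume N: "N \<ge> N0" and y: "y \<in> {c..d}"
    show "\<bar>\<Sum>n\<in>{N..<M}. relax (ev n) s * fterm n y\<bar> \<le> \<epsilon>"
    proof (cases "N \<le> M")
      case True
      have "\<bar>\<Sum>n\<in>{N..<M}. relax (ev n) s * fterm n y\<bar> \<le> relax (ev N) s * \<epsilon>"
        using N0[OF N y] relax_bounds[OF ev_nonneg] relax_antimono[OF ev_nonneg ev_mono] True
        by (intro abel_bound) (auto intro: less_imp_le)
      also have "\<dots> \<le> 1 * \<epsilon>"
        using relax_bounds[OF ev_nonneg] assms(2) by (intro mult_right_mono) auto
      finally show ?thesis by simp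
    qed (use assms(2) in auto)
  qed
qed

lemma uniformly_convergent_fterm_over_ev:
  assumes "{c..d} \<subseteq> state_space P"
  shows "uniformly_convergent_on {c..d} (\<lambda>N y. \<Sum>n<N. \<bar>fterm n y\<bar> / ev n)"
proof (cases "c \<le> d")
  case True
  then show ?thesis
    using fourier_series_over_eigenvalue[OF P h True assms] uniformly_convergent_fterm[OF assms] by (simp add: fterm_def)
qed (auto simp: uniformly_convergent_on_def)

text \<open>For \<open>s \<ge> t\<close> the differentiated mode is at most \<open>K\<close> divided
  by the eigenvalue. At \<open>n = 0\<close> both it and the quotient by 0 are 0.\<close>

lemma tail_relax':
  assumes cd: "{c..d} \<subseteq> state_space P" and \<epsilon>: "\<epsilon> > 0" and t: "t > 0"
  obtains N0 where "\<And>N M y s. N \<ge> N0 \<Longrightarrow> y \<in> {c..d} \<Longrightarrow> t \<le> s \<Longrightarrow> \<bar>\<Sum>n\<in>{N..<M}. relax' (ev n) s * fterm n y\<bar> \<le> \<epsilon>"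
proof -
  define K where "K = \<beta> * deriv_decay_const / t powr (\<beta> + 1)"
  have K: "K > 0" using \<beta>_pos deriv_decay_const_pos t by (simp add: K_def)
  then have "\<epsilon> / K > 0" using \<epsilon> by simp
  then obtain N0 where N0: "\<And>N M y. N \<ge> N0 \<Longrightarrow> y \<in> {c..d} \<Longrightarrow> \<bar>\<Sum>n\<in>{N..<M}. \<bar>fterm n y\<bar> / ev n\<bar> < \<epsilon> / K"
    using uniformly_convergent_fterm_over_ev[OF cd] unfolding uniformly_convergent_sum_iff by meson
  have e': "\<bar>relax' (ev n) s\<bar> \<le> K / ev n" if "t \<le> s" for n s
  proof (cases "n = 0")
    case False
    then have ev: "ev n > 0" using eigenvalue_pos[OF P] by simp
    have "\<bar>relax' (ev n) s\<bar> \<le> \<beta> * deriv_decay_const / (ev n * s powr (\<beta> + 1))"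
      using ev t that by (intro relax'_decay) auto
    also have "\<dots> \<le> \<beta> * deriv_decay_const / (ev n * t powr (\<beta> + 1))"
      using ev t that \<beta>_pos deriv_decay_const_pos by (intro divide_left_mono mult_left_mono powr_mono2) auto
    finally show ?thesis by (simp add: K_def mult.commute)
  qed (simp add: relax'_def)
  show ?thesis
  proof (rule that[of N0])
    fix N M y s assume N: "N \<ge> N0" and y: "y \<in> {c..d}" and s: "t \<le> s"
    have "\<bar>\<Sum>n\<in>{N..<M}. relax' (ev n) s * fterm n y\<bar> \<le> (\<Sum>n\<in>{N..<M}. K * (\<bar>fterm n y\<bar> / ev n))"
    proof (intro order_trans[OF sum_abs] sum_mono)
      fix n
      show "\<bar>relax' (ev n) s * fterm n y\<bar> \<le> K * (\<bar>fterm n y\<bar> / ev n)"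
        using mult_right_mono[OF e'[OF s, of n], of "\<bar>fterm n y\<bar>"] by (simp add: abs_mult)
    qed
    also have "\<dots> \<le> K * (\<epsilon> / K)"
      unfolding sum_distrib_left[symmetric] using N0[OF N y, of M] K by (intro mult_left_mono) auto
    finally show "\<bar>\<Sum>n\<in>{N..<M}. relax' (ev n) s * fterm n y\<bar> \<le> \<epsilon>" using K by simp
  qed
qed

section \<open>Fractional derivatives of the tails\<close>

text \<open>The reciprocal of the prefactor in \<open>frac_deriv\<close>.\<close>

definition caputo_weight :: "real \<Rightarrow> real" where "caputo_weight t = Gamma (1 - \<alpha>) * t powr \<gamma>"

lemma caputo_weight_pos: "t > 0 \<Longrightarrow> caputo_weight t > 0" unfolding caputo_weight_def using Gamma_pos by simp

lemma caputo_partial_sum: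
  assumes "t > 0" "finite A"
  shows "((\<lambda>s. (\<Sum>n\<in>A. relax' (ev n) s * fterm n y) / (t - s) powr \<alpha>) has_integral
    - caputo_weight t * (\<Sum>n\<in>A. ev n * relax (ev n) t * fterm n y)) {0..t}"
proof -
  have "((\<lambda>s. \<Sum>n\<in>A. relax' (ev n) s / (t - s) powr \<alpha> * fterm n y) has_integral
      (\<Sum>n\<in>A. - (Gamma (1 - \<alpha>) * t powr \<gamma> * (ev n * relax (ev n) t)) * fterm n y)) {0..t}"
    by (intro has_integral_sum has_integral_mult_left relax_eigen assms)
  then show ?thesis
    by (simp add: caputo_weight_def sum_divide_distrib sum_distrib_left sum_negf mult_ac)
qed

text \<open>The decay of the modes leaves their products with the eigenvalues merely bounded. By the
  eigenvalue equation, however, such a block is up to sign the fractional derivative of a block of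
  the series, which \<open>caputo_bound\<close> controls through \<open>tail_relax\<close> and
  \<open>tail_relax'\<close>.\<close>

lemma tail_ev_relax:
  assumes cd: "{c..d} \<subseteq> state_space P" and \<epsilon>: "\<epsilon> > 0" and t: "t > 0"
  obtains N0 where "\<And>N M y. N \<ge> N0 \<Longrightarrow> y \<in> {c..d} \<Longrightarrow> \<bar>\<Sum>n\<in>{N..<M}. ev n * relax (ev n) t * fterm n y\<bar> \<le> \<epsilon>"
proof -
  \<comment> \<open>Chosen so that \<open>kernel_const \<alpha> t * \<delta>\<close> is at most
    \<open>caputo_weight t * \<epsilon>\<close>; the added 1 keeps the denominator positive.\<close>
  define \<delta> where "\<delta> = \<epsilon> * caputo_weight t / (kernel_const \<alpha> t + 1)"
  have k: "kernel_const \<alpha> t \<ge> 0" by (rule kernel_const_nonneg[OF \<alpha> t])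
  have \<delta>: "\<delta> > 0" unfolding \<delta>_def using \<epsilon> caputo_weight_pos[OF t] k by (intro divide_pos_pos mult_pos_pos) auto
  obtain N1 where N1: "\<And>N M y s. N \<ge> N1 \<Longrightarrow> y \<in> {c..d} \<Longrightarrow> \<bar>\<Sum>n\<in>{N..<M}. relax (ev n) s * fterm n y\<bar> \<le> \<delta>"
    using tail_relax[OF cd \<delta>] by metis
  obtain N2 where N2: "\<And>N M y s. N \<ge> N2 \<Longrightarrow> y \<in> {c..d} \<Longrightarrow> t / 2 \<le> s \<Longrightarrow> \<bar>\<Sum>n\<in>{N..<M}. relax' (ev n) s * fterm n y\<bar> \<le> \<delta>"
    using tail_relax'[OF cd \<delta>, of "t / 2"] t by (metis half_gt_zero)
  show ?thesis
  proof (rule that[of "max N1 N2"])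
    fix N M y assume N: "N \<ge> max N1 N2" and y: "y \<in> {c..d}"
    let ?S = "\<Sum>n\<in>{N..<M}. ev n * relax (ev n) t * fterm n y"
    have "\<bar>integral {0..t} (\<lambda>s. (\<Sum>n\<in>{N..<M}. relax' (ev n) s * fterm n y) / (t - s) powr \<alpha>)\<bar> \<le> kernel_const \<alpha> t * \<delta>"
    proof (rule caputo_bound(2)[OF \<alpha> t])
      show "continuous_on {0..t/2} (\<lambda>s. \<Sum>n\<in>{N..<M}. relax (ev n) s * fterm n y)"
        by (intro continuous_intros continuous_on_relax)
      show "continuous_on {t/2..t} (\<lambda>s. \<Sum>n\<in>{N..<M}. relax' (ev n) s * fterm n y)"
        using t by (intro continuous_intros continuous_on_relax') auto
      show "((\<lambda>s. \<Sum>n\<in>{N..<M}. relax (ev n) s * fterm n y) has_real_derivative (\<Sum>n\<in>{N..<M}. relax' (ev n) s * fterm n y)) (at s)"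
        if "0 < s" for s
        by (intro DERIV_sum DERIV_cmult_right DERIV_relax that)
    qed (use N y N1 N2 in auto)
    then have "caputo_weight t * \<bar>?S\<bar> \<le> kernel_const \<alpha> t * \<delta>"
      unfolding integral_unique[OF caputo_partial_sum[OF t finite_atLeastLessThan]]
      using caputo_weight_pos[OF t] by (simp add: abs_mult)
    also have "\<dots> \<le> (kernel_const \<alpha> t + 1) * \<delta>" using \<delta> by simp
    also have "\<dots> = caputo_weight t * \<epsilon>" using k by (simp add: \<delta>_def field_simps)
    finally show "\<bar>?S\<bar> \<le> \<epsilon>" using caputo_weight_pos[OF t] by simp
  qed
qed

section \<open>Convergence at a fixed state\<close>

lemma uniformly_convergent_relax:
  assumes "y \<in> state_space P" shows "uniformly_convergent_on A (\<lambda>N s. \<Sum>n<N. relax (ev n) s * fterm n y)"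
proof (rule uniformly_convergent_sumI)
  fix \<epsilon> :: real assume \<epsilon>: "\<epsilon> > 0"
  have "{y..y} \<subseteq> state_space P" using assms by simp
  from tail_relax[OF this \<epsilon>] obtain N0 where
    "\<And>N M x s. N \<ge> N0 \<Longrightarrow> x \<in> {y..y} \<Longrightarrow> \<bar>\<Sum>n\<in>{N..<M}. relax (ev n) s * fterm n x\<bar> \<le> \<epsilon>" by blast
  then show "\<exists>N0. \<forall>N\<ge>N0. \<forall>M. \<forall>s\<in>A. \<bar>\<Sum>n\<in>{N..<M}. relax (ev n) s * fterm n y\<bar> \<le> \<epsilon>"
    by (intro exI[of _ N0] allI impI ballI) simp
qed

lemma uniformly_convergent_relax':
  assumes "y \<in> state_space P" "s0 > 0" "A \<subseteq> {s0..}"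
  shows "uniformly_convergent_on A (\<lambda>N s. \<Sum>n<N. relax' (ev n) s * fterm n y)"
proof (rule uniformly_convergent_sumI)
  fix \<epsilon> :: real assume \<epsilon>: "\<epsilon> > 0"
  have "{y..y} \<subseteq> state_space P" using assms by simp
  from tail_relax'[OF this \<epsilon> assms(2)] obtain N0 where
    "\<And>N M x s. N \<ge> N0 \<Longrightarrow> x \<in> {y..y} \<Longrightarrow> s0 \<le> s \<Longrightarrow> \<bar>\<Sum>n\<in>{N..<M}. relax' (ev n) s * fterm n x\<bar> \<le> \<epsilon>" by blast
  then show "\<exists>N0. \<forall>N\<ge>N0. \<forall>M. \<forall>s\<in>A. \<bar>\<Sum>n\<in>{N..<M}. relax' (ev n) s * fterm n y\<bar> \<le> \<epsilon>"
    using assms(3) by (intro exI[of _ N0] allI impI ballI) auto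
qed

lemma summable_relax: "y \<in> state_space P \<Longrightarrow> summable (\<lambda>n. relax (ev n) s * fterm n y)"
  by (rule uniformly_convergent_imp_summable[OF uniformly_convergent_relax UNIV_I])

lemma summable_relax': "y \<in> state_space P \<Longrightarrow> s > 0 \<Longrightarrow> summable (\<lambda>n. relax' (ev n) s * fterm n y)"
  by (rule uniformly_convergent_imp_summable[OF uniformly_convergent_relax'[of _ s "{s}"]]) auto

lemma summable_ev_relax: assumes "y \<in> state_space P" "t > 0" shows "summable (\<lambda>n. ev n * relax (ev n) t * fterm n y)"
proof (rule uniformly_convergent_imp_summable[of "{y..y}" "\<lambda>n y. ev n * relax (ev n) t * fterm n y", OF uniformly_convergent_sumI])
  fix \<epsilon> :: real assume \<epsilon>: "\<epsilon> > 0"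
  have "{y..y} \<subseteq> state_space P" using assms by simp
  from tail_ev_relax[OF this \<epsilon> assms(2)] obtain N0 where
    "\<And>N M x. N \<ge> N0 \<Longrightarrow> x \<in> {y..y} \<Longrightarrow> \<bar>\<Sum>n\<in>{N..<M}. ev n * relax (ev n) t * fterm n x\<bar> \<le> \<epsilon>" by blast
  then show "\<exists>N0. \<forall>N\<ge>N0. \<forall>M. \<forall>x\<in>{y..y}. \<bar>\<Sum>n\<in>{N..<M}. ev n * relax (ev n) t * fterm n x\<bar> \<le> \<epsilon>"
    by blast
qed simp

text \<open>For \<open>t > 0\<close> the modes decay like the reciprocal eigenvalue, which leads
  back to the convergent series of \<open>\<bar>fterm n y\<bar> / ev n\<close>; the comparison
  starts at 1 because the eigenvalue at 0 vanishes.\<close>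

lemma abs_summable_relax:
  assumes y: "y \<in> state_space P" and t: "t > 0"
  shows "summable (\<lambda>n. \<bar>relax (ev n) t * fterm n y\<bar>)"
proof (rule summable_comparison_test')
  have "summable (\<lambda>n. \<bar>fterm n y\<bar> / ev n)"
    using uniformly_convergent_imp_summable[OF uniformly_convergent_fterm_over_ev[of y y]] y by simp
  then show "summable (\<lambda>n. decay_const / t powr \<beta> * (\<bar>fterm n y\<bar> / ev n))" by (rule summable_mult)
  fix n :: nat assume n: "n \<ge> 1"
  then have ev: "ev n > 0" using eigenvalue_pos[OF P] by simp
  have "\<bar>relax (ev n) t * fterm n y\<bar> = relax (ev n) t * \<bar>fterm n y\<bar>"
    using relax_bounds[OF ev_nonneg] by (simp add: abs_mult)
  also have "\<dots> \<le> decay_const / (ev n * t powr \<beta>) * \<bar>fterm n y\<bar>"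
    using relax_decay[OF ev t] by (rule mult_right_mono) simp
  finally show "norm \<bar>relax (ev n) t * fterm n y\<bar> \<le> decay_const / t powr \<beta> * (\<bar>fterm n y\<bar> / ev n)"
    by (simp add: mult.commute)
qed

section \<open>Time derivative and fractional derivative of the sum\<close>

definition sol :: "real \<Rightarrow> real \<Rightarrow> real" where "sol t y = (\<Sum>n. relax (ev n) t * fterm n y)"
definition sol_dt :: "real \<Rightarrow> real \<Rightarrow> real" where "sol_dt t y = (\<Sum>n. relax' (ev n) t * fterm n y)"
definition sol_gen :: "real \<Rightarrow> real \<Rightarrow> real" where "sol_gen t y = (\<Sum>n. ev n * relax (ev n) t * fterm n y)"

lemma DERIV_sol:
  assumes y: "y \<in> state_space P" and s: "s > 0"
  shows "((\<lambda>s. sol s y) has_real_derivative sol_dt s y) (at s)"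
  unfolding sol_def sol_dt_def
proof (rule has_field_derivative_series'(2))
  \<comment> \<open>A neighbourhood of \<open>s\<close> away from 0, where the differentiated series
    converges uniformly.\<close>
  let ?S = "{s / 2..2 * s}"
  show "convex ?S" by simp
  show "((\<lambda>s. relax (ev n) s * fterm n y) has_real_derivative relax' (ev n) x * fterm n y) (at x within ?S)" if "x \<in> ?S" for n x
    using that s by (intro DERIV_cmult_right has_field_derivative_at_within[OF DERIV_relax]) auto
  show "uniformly_convergent_on ?S (\<lambda>n x. \<Sum>i<n. relax' (ev i) x * fterm i y)"
    using s by (intro uniformly_convergent_relax'[OF y, of "s / 2"]) auto
  show "s \<in> ?S" "s \<in> interior ?S" using s by auto
  show "summable (\<lambda>n. relax (ev n) s * fterm n y)" by (rule summable_relax[OF y])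
qed

lemma continuous_on_sol:
  assumes y: "y \<in> state_space P"
  shows "continuous_on {0..t} (\<lambda>s. sol s y)"
  unfolding sol_def
  by (rule uniform_limit_theorem[OF _ uniform_limit_suminf_of_convergent[OF uniformly_convergent_relax[OF y]]])
    (auto intro!: always_eventually continuous_intros continuous_on_relax)

lemma continuous_on_sol_dt:
  assumes y: "y \<in> state_space P" and s0: "s0 > 0"
  shows "continuous_on {s0..t} (\<lambda>s. sol_dt s y)"
  unfolding sol_dt_def
  by (rule uniform_limit_theorem[OF _ uniform_limit_suminf_of_convergent[OF uniformly_convergent_relax'[OF y s0]]])
    (use s0 in \<open>auto intro!: always_eventually continuous_intros continuous_on_relax'\<close>)

text \<open>Applied to the remainder after \<open>N\<close> terms, \<open>caputo_bound\<close>
  yields both integrability and closeness to the integral of the partial sum, without an integrable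
  majorant near 0.\<close>

lemma caputo_sol:
  assumes y: "y \<in> state_space P" and t: "t > 0"
  shows "((\<lambda>s. sol_dt s y / (t - s) powr \<alpha>) has_integral - caputo_weight t * sol_gen t y) {0..t}"
proof -
  let ?k = "\<lambda>s. sol_dt s y / (t - s) powr \<alpha>"
  define I where "I N = - caputo_weight t * (\<Sum>n<N. ev n * relax (ev n) t * fterm n y)" for N
  have approx: "\<exists>N0. \<forall>N\<ge>N0. ?k integrable_on {0..t} \<and> \<bar>integral {0..t} ?k - I N\<bar> \<le> kernel_const \<alpha> t * \<delta>"
    if \<delta>: "\<delta> > 0" for \<delta>
  proof -
    obtain N1 where N1: "\<And>N M x s. N \<ge> N1 \<Longrightarrow> x \<in> {y..y} \<Longrightarrow> \<bar>\<Sum>n\<in>{N..<M}. relax (ev n) s * fterm n x\<bar> \<le> \<delta>"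
      using tail_relax[of y y \<delta>] y \<delta> by auto
    obtain N2 where N2: "\<And>N M x s. N \<ge> N2 \<Longrightarrow> x \<in> {y..y} \<Longrightarrow> t / 2 \<le> s \<Longrightarrow> \<bar>\<Sum>n\<in>{N..<M}. relax' (ev n) s * fterm n x\<bar> \<le> \<delta>"
      using tail_relax'[of y y \<delta> "t / 2"] y \<delta> t by auto
    have "?k integrable_on {0..t} \<and> \<bar>integral {0..t} ?k - I N\<bar> \<le> kernel_const \<alpha> t * \<delta>" if N: "N \<ge> max N1 N2" for N
    proof -
      let ?F = "\<lambda>s. sol s y - (\<Sum>n<N. relax (ev n) s * fterm n y)" and ?F' = "\<lambda>s. sol_dt s y - (\<Sum>n<N. relax' (ev n) s * fterm n y)"
      have 1: "continuous_on {0..t/2} ?F"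
        by (intro continuous_intros continuous_on_sol continuous_on_relax y)
      have 2: "continuous_on {t/2..t} ?F'"
        using t by (intro continuous_intros continuous_on_sol_dt continuous_on_relax' y) auto
      have 3: "(?F has_real_derivative ?F' s) (at s)" if "0 < s" "s \<le> t" for s
        by (intro DERIV_diff DERIV_sum DERIV_cmult_right DERIV_relax DERIV_sol y that)
      have 4: "\<bar>?F s\<bar> \<le> \<delta>" for s
        unfolding sol_def using N1 N by (intro suminf_tail_le summable_relax y) auto
      have 5: "\<bar>?F' s\<bar> \<le> \<delta>" if "t / 2 \<le> s" for s
        unfolding sol_dt_def using N2[OF _ _ that] N that t by (intro suminf_tail_le summable_relax' y) auto
      note bd = caputo_bound[OF \<alpha> t 1 2 3 4 5]
      have ps: "((\<lambda>s. (\<Sum>n<N. relax' (ev n) s * fterm n y) / (t - s) powr \<alpha>) has_integral I N) {0..t}"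
        unfolding I_def by (intro caputo_partial_sum t) simp
      have eq: "?F' s / (t - s) powr \<alpha> + (\<Sum>n<N. relax' (ev n) s * fterm n y) / (t - s) powr \<alpha> = ?k s" for s
        by (simp add: diff_divide_distrib)
      have "(?k has_integral integral {0..t} (\<lambda>s. ?F' s / (t - s) powr \<alpha>) + I N) {0..t}"
        using has_integral_add[OF integrable_integral[OF bd(1)] ps] unfolding eq .
      then show ?thesis using bd(2) by (auto simp: has_integral_iff)
    qed
    then show ?thesis by blast
  qed
  have "I \<longlonglongrightarrow> integral {0..t} ?k"
    unfolding LIMSEQ_iff
  proof (intro allI impI)
    fix r :: real assume r: "r > 0"
    have k: "kernel_const \<alpha> t \<ge> 0" by (rule kernel_const_nonneg[OF \<alpha> t])
    define \<delta> where "\<delta> = r / (kernel_const \<alpha> t + 1)"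
    have \<delta>: "\<delta> > 0" using r k by (simp add: \<delta>_def)
    have "kernel_const \<alpha> t * \<delta> < r" using r k by (simp add: \<delta>_def field_simps)
    with approx[OF \<delta>] show "\<exists>no. \<forall>n\<ge>no. norm (I n - integral {0..t} ?k) < r"
      by (auto simp: abs_minus_commute intro: le_less_trans)
  qed
  moreover have "I \<longlonglongrightarrow> - caputo_weight t * sol_gen t y"
    unfolding I_def sol_gen_def by (intro tendsto_intros summable_LIMSEQ summable_ev_relax y t)
  ultimately have "integral {0..t} ?k = - caputo_weight t * sol_gen t y" by (rule LIMSEQ_unique)
  moreover have "?k integrable_on {0..t}" using approx[of 1] by auto
  ultimately show ?thesis by (simp add: has_integral_iff)
qed

section \<open>Space derivatives of the sum\<close>

definition term_pol :: "real \<Rightarrow> nat \<Rightarrow> real poly" where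
  "term_pol t n = smult (relax (ev n) t * fourier_coeff P h n) (orth_pol P n)"

lemma poly_term_pol: "poly (term_pol t n) y = relax (ev n) t * fterm n y"
  by (simp add: term_pol_def fterm_def orth_poly_eq)

lemma generator_term_pol:
  "diffusion P y * poly (pderiv (pderiv (term_pol t n))) y + drift P y * poly (pderiv (term_pol t n)) y
     = - (ev n * relax (ev n) t * fterm n y)"
proof -
  have "diffusion P y * poly (pderiv (pderiv (term_pol t n))) y + drift P y * poly (pderiv (term_pol t n)) y
     = relax (ev n) t * fourier_coeff P h n *
       (diffusion P y * poly (pderiv (pderiv (orth_pol P n))) y + drift P y * poly (pderiv (orth_pol P n)) y)"
    by (simp add: term_pol_def pderiv_smult algebra_simps)
  then show ?thesis unfolding orth_pol_ode[OF P] by (simp add: fterm_def orth_poly_eq)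
qed

text \<open>A block \<open>T\<close> and its image under the generator are both uniformly small by
  the tail estimates. The a priori estimate then makes \<open>T'\<close> small, and solving for
  \<open>D T''\<close> makes \<open>T''\<close> small.\<close>

lemma uniformly_convergent_space_derivs:
  assumes cd: "c < d" "{c..d} \<subseteq> state_space P" and t: "t > 0"
  shows "uniformly_convergent_on {c..d} (\<lambda>N y. \<Sum>n<N. poly (pderiv (term_pol t n)) y)"
    and "uniformly_convergent_on {c..d} (\<lambda>N y. \<Sum>n<N. poly (pderiv (pderiv (term_pol t n))) y)"
proof -
  let ?p = "\<lambda>y. diffusion P y * stat_density P y"
  have mc: "continuous_on {c..d} (stat_density P)"
    by (rule continuous_on_subset[OF continuous_on_stat_density[OF P] cd(2)])
  have pc: "continuous_on {c..d} ?p"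
    by (intro continuous_intros continuous_on_diffusion mc)
  have ne: "{c..d} \<noteq> {}" using cd by simp
  have pos: "stat_density P y > 0" "diffusion P y > 0" if "y \<in> {c..d}" for y
    using that cd(2) stat_density_pos[OF P] diffusion_pos[OF P] by auto
  obtain mmax where mmax: "\<And>y. y \<in> {c..d} \<Longrightarrow> stat_density P y \<le> mmax"
    using continuous_attains_sup[OF compact_Icc ne mc] by metis
  obtain pmax where pmax: "\<And>y. y \<in> {c..d} \<Longrightarrow> ?p y \<le> pmax"
    using continuous_attains_sup[OF compact_Icc ne pc] by metis
  obtain pmin where pmin: "pmin > 0" "\<And>y. y \<in> {c..d} \<Longrightarrow> pmin \<le> ?p y"
    using continuous_attains_inf[OF compact_Icc ne pc] pos by (metis mult_pos_pos)
  obtain Dmin where Dmin: "Dmin > 0" "\<And>y. y \<in> {c..d} \<Longrightarrow> Dmin \<le> diffusion P y"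
    using continuous_attains_inf[OF compact_Icc ne continuous_on_diffusion] pos by metis
  obtain \<mu>max where \<mu>max: "\<And>y. y \<in> {c..d} \<Longrightarrow> \<bar>drift P y\<bar> \<le> \<mu>max"
    using continuous_attains_sup[OF compact_Icc ne continuous_on_rabs[OF continuous_on_drift]] by metis
  \<comment> \<open>The constant of \<open>sturm_liouville_deriv_bound\<close>, in absolute value so
    that its sign needs no argument; \<open>K'\<close> results from \<open>Dmin * \<bar>T''\<bar>
    \<le> \<epsilon> + \<mu>max * K * \<epsilon>\<close>.\<close>
  define K where "K = \<bar>(2 * pmax / (d - c) + (d - c) * mmax) / pmin\<bar>"
  define K' where "K' = (1 + \<mu>max * K) / Dmin"
  have \<mu>0: "\<mu>max \<ge> 0" using \<mu>max[of c] cd by auto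
  have K0: "K \<ge> 0" by (simp add: K_def)
  have K'0: "K' \<ge> 0" using \<mu>0 K0 Dmin(1) by (simp add: K'_def)
  have tail: "\<exists>N0. \<forall>N\<ge>N0. \<forall>M. \<forall>y\<in>{c..d}.
      \<bar>\<Sum>n\<in>{N..<M}. poly (pderiv (term_pol t n)) y\<bar> \<le> K * \<epsilon> \<and>
      \<bar>\<Sum>n\<in>{N..<M}. poly (pderiv (pderiv (term_pol t n))) y\<bar> \<le> K' * \<epsilon>" if \<epsilon>: "\<epsilon> > 0" for \<epsilon>
  proof -
    obtain N1 where N1: "\<And>N M y s. N \<ge> N1 \<Longrightarrow> y \<in> {c..d} \<Longrightarrow> \<bar>\<Sum>n\<in>{N..<M}. relax (ev n) s * fterm n y\<bar> \<le> \<epsilon>"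
      using tail_relax[OF cd(2) \<epsilon>] by metis
    obtain N2 where N2: "\<And>N M y. N \<ge> N2 \<Longrightarrow> y \<in> {c..d} \<Longrightarrow> \<bar>\<Sum>n\<in>{N..<M}. ev n * relax (ev n) t * fterm n y\<bar> \<le> \<epsilon>"
      using tail_ev_relax[OF cd(2) \<epsilon> t] by metis
    have "\<bar>\<Sum>n\<in>{N..<M}. poly (pderiv (term_pol t n)) y\<bar> \<le> K * \<epsilon> \<and>
      \<bar>\<Sum>n\<in>{N..<M}. poly (pderiv (pderiv (term_pol t n))) y\<bar> \<le> K' * \<epsilon>"
      if N: "N \<ge> max N1 N2" and y: "y \<in> {c..d}" for N M y
    proof -
      define T where "T = (\<Sum>n\<in>{N..<M}. term_pol t n)"
      have T: "poly T y = (\<Sum>n\<in>{N..<M}. relax (ev n) t * fterm n y)"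
        "poly (pderiv T) y = (\<Sum>n\<in>{N..<M}. poly (pderiv (term_pol t n)) y)"
        "poly (pderiv (pderiv T)) y = (\<Sum>n\<in>{N..<M}. poly (pderiv (pderiv (term_pol t n))) y)" for y
        by (simp_all add: T_def poly_sum pderiv_sum poly_term_pol)
      have GT: "diffusion P y * poly (pderiv (pderiv T)) y + drift P y * poly (pderiv T) y
          = - (\<Sum>n\<in>{N..<M}. ev n * relax (ev n) t * fterm n y)" for y
        unfolding T sum_distrib_left sum.distrib[symmetric] generator_term_pol sum_negf ..
      have GT_le: "\<bar>diffusion P y * poly (pderiv (pderiv T)) y + drift P y * poly (pderiv T) y\<bar> \<le> \<epsilon>"
        if "y \<in> {c..d}" for y
        unfolding GT using N2[of N y M] N that by simp
      have "\<bar>poly (pderiv T) y\<bar> \<le> (2 * pmax / (d - c) + (d - c) * mmax) / pmin * \<epsilon>"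
      proof (rule sturm_liouville_deriv_bound[OF cd(1) y, where u = "poly T" and u'' = "poly (pderiv (pderiv T))"
            and p = ?p and m = "stat_density P" and D = "diffusion P" and \<mu> = "drift P"])
        show "\<bar>poly T y\<bar> \<le> \<epsilon>" if "y \<in> {c..d}" for y
          unfolding T using N1 N that by simp
        show "(?p has_real_derivative drift P y * stat_density P y) (at y)" if "y \<in> {c..d}" for y
          using cd(2) that by (intro has_real_derivative_flux[OF P]) auto
        show "\<bar>stat_density P y\<bar> \<le> mmax" if "y \<in> {c..d}" for y
          using mmax[OF that] pos(1)[OF that] by simp
      qed (use pmin pmax GT_le in \<open>auto intro: poly_DERIV\<close>)
      also have "\<dots> \<le> K * \<epsilon>" unfolding K_def using \<epsilon> by (intro mult_right_mono abs_ge_self less_imp_le)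
      finally have 1: "\<bar>poly (pderiv T) y\<bar> \<le> K * \<epsilon>" .
      have "Dmin * \<bar>poly (pderiv (pderiv T)) y\<bar> \<le> \<bar>diffusion P y * poly (pderiv (pderiv T)) y\<bar>"
        unfolding abs_mult using Dmin(2)[OF y] by (intro mult_right_mono) auto
      also have "\<dots> \<le> \<epsilon> + \<bar>drift P y * poly (pderiv T) y\<bar>"
        using GT_le[OF y] by linarith
      also have "\<dots> \<le> \<epsilon> + \<mu>max * (K * \<epsilon>)"
        unfolding abs_mult using \<mu>max[OF y] 1 \<mu>0 by (intro add_left_mono mult_mono) auto
      finally have "\<bar>poly (pderiv (pderiv T)) y\<bar> \<le> K' * \<epsilon>"
        using Dmin(1) by (simp add: K'_def field_simps)
      then show ?thesis using 1 unfolding T by simp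
    qed
    then show ?thesis by blast
  qed
  have small: "\<exists>\<epsilon>>0. k * \<epsilon> < \<delta>" if "k \<ge> 0" "\<delta> > 0" for k \<delta> :: real
    using that by (intro exI[of _ "\<delta> / (k + 1)"]) (auto simp: field_simps)
  show "uniformly_convergent_on {c..d} (\<lambda>N y. \<Sum>n<N. poly (pderiv (term_pol t n)) y)"
    unfolding uniformly_convergent_sum_iff
  proof (intro allI impI)
    fix \<delta> :: real assume "\<delta> > 0"
    then obtain \<epsilon> where "\<epsilon> > 0" "K * \<epsilon> < \<delta>" using small[OF K0] by blast
    with tail[of \<epsilon>] show "\<exists>N0. \<forall>N\<ge>N0. \<forall>M. \<forall>y\<in>{c..d}. \<bar>\<Sum>n\<in>{N..<M}. poly (pderiv (term_pol t n)) y\<bar> < \<delta>"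
      by (meson le_less_trans)
  qed
  show "uniformly_convergent_on {c..d} (\<lambda>N y. \<Sum>n<N. poly (pderiv (pderiv (term_pol t n))) y)"
    unfolding uniformly_convergent_sum_iff
  proof (intro allI impI)
    fix \<delta> :: real assume "\<delta> > 0"
    then obtain \<epsilon> where "\<epsilon> > 0" "K' * \<epsilon> < \<delta>" using small[OF K'0] by blast
    with tail[of \<epsilon>] show "\<exists>N0. \<forall>N\<ge>N0. \<forall>M. \<forall>y\<in>{c..d}. \<bar>\<Sum>n\<in>{N..<M}. poly (pderiv (pderiv (term_pol t n))) y\<bar> < \<delta>"
      by (meson le_less_trans)
  qed
qed

lemma generator_sol:
  assumes y: "y \<in> state_space P" and t: "t > 0"
  shows "sol t field_differentiable (at y)" "deriv (sol t) field_differentiable (at y)"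
    and "generator P (sol t) y = - sol_gen t y"
proof -
  define u1 u2 where "u1 x = (\<Sum>n. poly (pderiv (term_pol t n)) x)"
    and "u2 x = (\<Sum>n. poly (pderiv (pderiv (term_pol t n))) x)" for x
  obtain r where r: "r > 0" "cball y r \<subseteq> state_space P"
    using open_state_space y by (meson open_contains_cball)
  define c d where "c = y - r" and "d = y + r"
  have cd: "c < d" "{c..d} \<subseteq> state_space P" and yi: "y \<in> {c<..<d}"
    using r by (auto simp: c_def d_def cball_eq_atLeastAtMost)
  note unif = uniformly_convergent_space_derivs[OF cd t]
  have summable: "summable (\<lambda>n. poly (pderiv (term_pol t n)) x)" "summable (\<lambda>n. poly (pderiv (pderiv (term_pol t n))) x)"
    if "x \<in> {c..d}" for x
    by (rule uniformly_convergent_imp_summable[OF unif(1) that], rule uniformly_convergent_imp_summable[OF unif(2) that])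
  have D1: "(sol t has_real_derivative u1 x) (at x)" if x: "x \<in> {c<..<d}" for x
  proof -
    have "((\<lambda>x. \<Sum>n. poly (term_pol t n) x) has_real_derivative u1 x) (at x)"
      unfolding u1_def
    proof (rule has_field_derivative_series'(2)[OF _ _ unif(1)])
      show "x \<in> {c..d}" using x by simp
      then show "summable (\<lambda>n. poly (term_pol t n) x)"
        using cd(2) unfolding poly_term_pol by (intro summable_relax) auto
    qed (use x in \<open>auto intro: has_field_derivative_at_within[OF poly_DERIV]\<close>)
    then show ?thesis by (simp add: poly_term_pol sol_def[abs_def])
  qed
  have D2: "(u1 has_real_derivative u2 x) (at x)" if x: "x \<in> {c<..<d}" for x
    unfolding u1_def[abs_def] u2_def
  proof (rule has_field_derivative_series'(2)[OF _ _ unif(2)])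
    show "x \<in> {c..d}" using x by simp
    then show "summable (\<lambda>n. poly (pderiv (term_pol t n)) x)" by (rule summable)
  qed (use x in \<open>auto intro: has_field_derivative_at_within[OF poly_DERIV]\<close>)
  have "deriv (sol t) x = u1 x" if "x \<in> {c<..<d}" for x
    using D1[OF that] by (rule DERIV_imp_deriv)
  \<comment> \<open>Differentiating \<open>deriv (sol t)\<close> at \<open>y\<close> requires its
    agreement with \<open>u1\<close> in a neighbourhood, not just at \<open>y\<close>.\<close>
  then have "\<forall>\<^sub>F x in nhds y. deriv (sol t) x = u1 x"
    using yi by (intro eventually_nhds[THEN iffD2] exI[of _ "{c<..<d}"]) auto
  then have D2': "(deriv (sol t) has_real_derivative u2 y) (at y)"
    using D2[OF yi] by (subst DERIV_cong_ev[OF refl _ refl])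
  show "sol t field_differentiable (at y)" using D1[OF yi] by (auto simp: field_differentiable_def)
  show "deriv (sol t) field_differentiable (at y)" using D2' by (auto simp: field_differentiable_def)
  have y': "y \<in> {c..d}" using yi by simp
  have "generator P (sol t) y = diffusion P y * u2 y + drift P y * u1 y"
    using DERIV_imp_deriv[OF D1[OF yi]] DERIV_imp_deriv[OF D2'] by (simp add: generator_def)
  also have "\<dots> = (\<Sum>n. diffusion P y * poly (pderiv (pderiv (term_pol t n))) y + drift P y * poly (pderiv (term_pol t n)) y)"
    unfolding u1_def u2_def using summable[OF y'] by (simp add: suminf_add[symmetric] suminf_mult summable_mult)
  also have "\<dots> = - sol_gen t y"
    unfolding generator_term_pol sol_gen_def using summable_ev_relax[OF y t] by (rule suminf_minus)
  finally show "generator P (sol t) y = - sol_gen t y" .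
qed

section \<open>The fractional Cauchy problem\<close>

lemma strong_solution_sol: "strong_solution \<alpha> \<gamma> P h sol"
  unfolding strong_solution_def
proof (intro conjI allI impI ballI)
  fix t y :: real assume t: "t > 0" and y: "y \<in> state_space P"
  have deriv: "deriv (\<lambda>s. sol s y) s = sol_dt s y" if "s > 0" for s
    using DERIV_sol[OF y that] by (rule DERIV_imp_deriv)
  \<comment> \<open>\<open>deriv\<close> is identified for positive times only; its value at 0 is
    irrelevant to the integral.\<close>
  have int: "((\<lambda>s. deriv (\<lambda>s. sol s y) s / (t - s) powr \<alpha>) has_integral - caputo_weight t * sol_gen t y) {0..t}"
    using caputo_sol[OF y t] by (rule has_integral_spike[of "{0}", rotated 2]) (auto simp: deriv)
  show "has_frac_deriv \<alpha> (\<lambda>s. sol s y) t"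
    unfolding has_frac_deriv_def field_differentiable_def
    using has_integral_integrable[OF int] DERIV_sol[OF y] by (metis greaterThanAtMost_iff)
  show "frac_deriv \<alpha> \<gamma> (\<lambda>s. sol s y) t = generator P (sol t) y"
    unfolding frac_deriv_def integral_unique[OF int] generator_sol(3)[OF y t]
    using t Gamma_pos by (simp add: caputo_weight_def powr_minus)
\<comment> \<open>At time 0 every mode equals 1, so the sum is the expansion of
  \<open>h\<close>.\<close>
qed (use generator_sol in auto, simp add: sol_def fterm_sums sums_unique[symmetric])

end

theorem theorem4p2:
  fixes \<alpha> \<gamma> :: real and P :: pearson and h :: "real \<Rightarrow> real"
  assumes "0 < \<alpha>" "\<alpha> < 1" "0 \<le> \<gamma>" "0 < \<alpha> + \<gamma>" "\<alpha> + \<gamma> \<le> 1"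
    and "admissible P"
    and "in_L2 P h"
    and "\<And>I. is_interval I \<Longrightarrow> bounded I \<Longrightarrow> I \<subseteq> state_space P \<Longrightarrow>
           uniform_limit I (\<lambda>N y. \<Sum>n<N. fourier_coeff P h n * orth_poly P n y) h sequentially"
  shows "(\<forall>t>0. \<forall>y\<in>state_space P.
            summable (\<lambda>n. \<bar>kilbas_saigo \<alpha> (1 + \<gamma> / \<alpha>) (\<gamma> / \<alpha>)
              (- eigenvalue P n * t powr (\<alpha> + \<gamma>)) * orth_poly P n y * fourier_coeff P h n\<bar>))
       \<and> strong_solution \<alpha> \<gamma> P h
           (\<lambda>t y. \<Sum>n. kilbas_saigo \<alpha> (1 + \<gamma> / \<alpha>) (\<gamma> / \<alpha>)
              (- eigenvalue P n * t powr (\<alpha> + \<gamma>)) * orth_poly P n y * fourier_coeff P h n)"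
proof -
  interpret frac_pearson \<alpha> \<gamma> "\<alpha> + \<gamma>" P h
    using assms by unfold_locales auto
  have eq: "kilbas_saigo \<alpha> (1 + \<gamma> / \<alpha>) (\<gamma> / \<alpha>) (- eigenvalue P n * t powr (\<alpha> + \<gamma>)) * orth_poly P n y * fourier_coeff P h n
      = relax (ev n) t * fterm n y" for n t y
    unfolding kilbas_saigo_relax by (simp add: fterm_def)
  show ?thesis
    unfolding eq using abs_summable_relax strong_solution_sol by (simp add: sol_def[abs_def])
qed

end
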